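(* Let $\mathcal{A}$ be a unital $C^*$-algebra, $\mathcal{E}$ a right Hilbert $\mathcal{A}$-module, $H_1,H_2$ Hilbert spaces, $\varphi:\mathcal{A}\to\mathcal{B}(H_1)$ a completely positive map and $\Phi:\mathcal{E}\to\mathcal{B}(H_1,H_2)$ a completely semi-$\varphi$-map. Then there exist Hilbert spaces $K_1,K_2$, a bounded operator $V:H_1\to K_1$, an isometry $W:H_2\to K_2$, a $*$-homomorphism $\rho:\mathcal{A}\to\mathcal{B}(K_1)$ and a $\rho$-representation $\Psi:\mathcal{E}\to\mathcal{B}(K_1,K_2)$ such that for all $a\in\mathcal{A}$ and $x\in\mathcal{E}$, $$\varphi(a)=V^*\rho(a)V,\qquad \Phi(x)=W^*\Psi(x)V.$$ Furthermore, if $\varphi$ is unital, then $V$ is an isometry.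
   Context: $\mathbb{M}_n(\mathcal{E})$ is a right Hilbert $\mathbb{M}_n(\mathcal{A})$-module with $(x_{ij})\cdot(a_{ij})=(\sum_k x_{ik}a_{kj})$ and $\langle (x_{ij}),(y_{ij})\rangle=(\sum_k\langle x_{ki},y_{kj}\rangle)$. For a linear map $\Phi$ (resp. $\varphi$), $\Phi_n$ (resp. $\varphi_n$) denotes the entrywise amplification to $n\times n$ matrices. The space $\mathcal{B}(H_1,H_2)$ is regarded as a Hilbert $\mathcal{B}(H_1)$-module with $\langle S,T\rangle=S^*T$. Given a completely positive map $\varphi:\mathcal{A}\to\mathcal{B}(H_1)$, a linear map $\Phi:\mathcal{E}\to\mathcal{B}(H_1,H_2)$ is a completely semi-$\varphi$-map if $\Phi_n(x)^*\Phi_n(x)\le\varphi_n(\langle x,x\rangle)$ for all $n\in\mathbb{N}$ and $x\in\mathbb{M}_n(\mathcal{E})$. For a $*$-homomorphism $\rho:\mathcal{A}\to\mathcal{B}(K_1)$, a linear map $\Psi:\mathcal{E}\to\mathcal{B}(K_1,K_2)$ is a $\rho$-representation if $\Psi(x)^*\Psi(y)=\rho(\langle x,y\rangle)$ for all $x,y\in\mathcal{E}$. *)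

theory Defs
  imports "Jordan_Normal_Form.VS_Connect"
begin

text \<open>
  All spaces and algebras are records with an explicit carrier, so that Hilbert spaces can be
  quantified existentially. Complex vector spaces are records \<^typ>\<open>(complex, 'v) module\<close>
  over \<^term>\<open>class_ring :: complex ring\<close>; the inherited fields \<^const>\<open>mult\<close> and \<^const>\<open>one\<close>
  have a meaning only for algebras. All inner products are conjugate linear in the first and
  linear in the second argument.
\<close>

abbreviation complex_space :: "(complex, 'v, 'm) module_scheme \<Rightarrow> bool" where
  "complex_space V \<equiv> vectorspace (class_ring :: complex ring) V"

abbreviation linear_maps ::
    "(complex, 'v, 'm) module_scheme \<Rightarrow> (complex, 'w, 'l) module_scheme \<Rightarrow> ('v \<Rightarrow> 'w) set" where
  "linear_maps V W \<equiv> LinearCombinations.module_hom (class_ring :: complex ring) V W"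

definition complete_under :: "('v, 'm) ring_scheme \<Rightarrow> ('v \<Rightarrow> real) \<Rightarrow> bool" where
  "complete_under V N \<longleftrightarrow>
    (\<forall>s :: nat \<Rightarrow> 'v. range s \<subseteq> carrier V \<longrightarrow>
      (\<forall>e>0. \<exists>M. \<forall>m\<ge>M. \<forall>n\<ge>M. N (s m \<ominus>\<^bsub>V\<^esub> s n) < e) \<longrightarrow>
      (\<exists>x\<in>carrier V. (\<lambda>n. N (s n \<ominus>\<^bsub>V\<^esub> x)) \<longlonglongrightarrow> 0))"


section \<open>Star-algebras and unital C*-algebras\<close>

record 'a star_algebra = "(complex, 'a) module" +
  star :: "'a \<Rightarrow> 'a"

record 'a normed_star_algebra = "'a star_algebra" +
  anorm :: "'a \<Rightarrow> real"

text \<open>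
  Positivity in a C*-algebra. It is applied to \<open>A\<close>, \<open>M\<^sub>n(A)\<close> and \<open>M\<^sub>n(B(H))\<close>; these are
  C*-algebras, whose norms are not needed here.
\<close>

definition positive :: "('a, 'm) star_algebra_scheme \<Rightarrow> 'a \<Rightarrow> bool" where
  "positive A a \<longleftrightarrow> (\<exists>b\<in>carrier A. a = star A b \<otimes>\<^bsub>A\<^esub> b)"

definition star_le :: "('a, 'm) star_algebra_scheme \<Rightarrow> 'a \<Rightarrow> 'a \<Rightarrow> bool" where
  "star_le A a b \<longleftrightarrow> a \<in> carrier A \<and> b \<in> carrier A \<and> positive A (b \<ominus>\<^bsub>A\<^esub> a)"

locale unital_cstar_algebra =
  fixes A :: "'a normed_star_algebra" (structure)
  assumes ring: "ring A"
    and complex_space: "complex_space A"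
    and smult_mult_left:
      "\<lbrakk>a \<in> carrier A; b \<in> carrier A\<rbrakk> \<Longrightarrow> (c \<odot> a) \<otimes> b = c \<odot> (a \<otimes> b)"
    and smult_mult_right:
      "\<lbrakk>a \<in> carrier A; b \<in> carrier A\<rbrakk> \<Longrightarrow> a \<otimes> (c \<odot> b) = c \<odot> (a \<otimes> b)"
    and star_closed: "a \<in> carrier A \<Longrightarrow> star A a \<in> carrier A"
    and star_star: "a \<in> carrier A \<Longrightarrow> star A (star A a) = a"
    and star_add:
      "\<lbrakk>a \<in> carrier A; b \<in> carrier A\<rbrakk> \<Longrightarrow> star A (a \<oplus> b) = star A a \<oplus> star A b"
    and star_smult: "a \<in> carrier A \<Longrightarrow> star A (c \<odot> a) = cnj c \<odot> star A a"
    and star_mult: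
      "\<lbrakk>a \<in> carrier A; b \<in> carrier A\<rbrakk> \<Longrightarrow> star A (a \<otimes> b) = star A b \<otimes> star A a"
    and anorm_nonneg: "a \<in> carrier A \<Longrightarrow> 0 \<le> anorm A a"
    and anorm_eq_0: "a \<in> carrier A \<Longrightarrow> anorm A a = 0 \<longleftrightarrow> a = \<zero>"
    and anorm_smult: "a \<in> carrier A \<Longrightarrow> anorm A (c \<odot> a) = cmod c * anorm A a"
    and anorm_add:
      "\<lbrakk>a \<in> carrier A; b \<in> carrier A\<rbrakk> \<Longrightarrow> anorm A (a \<oplus> b) \<le> anorm A a + anorm A b"
    and anorm_mult:
      "\<lbrakk>a \<in> carrier A; b \<in> carrier A\<rbrakk> \<Longrightarrow> anorm A (a \<otimes> b) \<le> anorm A a * anorm A b"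
    and cstar_identity: "a \<in> carrier A \<Longrightarrow> anorm A (star A a \<otimes> a) = (anorm A a)\<^sup>2"
    and complete: "complete_under A (anorm A)"

definition star_hom ::
    "('a, 'm) star_algebra_scheme \<Rightarrow> ('b, 'l) star_algebra_scheme \<Rightarrow> ('a \<Rightarrow> 'b) \<Rightarrow> bool" where
  "star_hom A B \<rho> \<longleftrightarrow> \<rho> \<in> linear_maps A B \<and>
    (\<forall>a\<in>carrier A. \<forall>b\<in>carrier A. \<rho> (a \<otimes>\<^bsub>A\<^esub> b) = \<rho> a \<otimes>\<^bsub>B\<^esub> \<rho> b) \<and>
    (\<forall>a\<in>carrier A. \<rho> (star A a) = star B (\<rho> a))"

definition mat_algebra :: "nat \<Rightarrow> ('a, 'm) star_algebra_scheme \<Rightarrow> 'a mat star_algebra" where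
  "mat_algebra n A = \<lparr>
    carrier = {X \<in> carrier_mat n n. elements_mat X \<subseteq> carrier A},
    mult = (\<lambda>X Y. mat n n (\<lambda>(i, j). \<Oplus>\<^bsub>A\<^esub>k\<in>{..<n}. X $$ (i, k) \<otimes>\<^bsub>A\<^esub> Y $$ (k, j))),
    one = mat n n (\<lambda>(i, j). if i = j then \<one>\<^bsub>A\<^esub> else \<zero>\<^bsub>A\<^esub>),
    zero = mat n n (\<lambda>_. \<zero>\<^bsub>A\<^esub>),
    add = (\<lambda>X Y. mat n n (\<lambda>ij. X $$ ij \<oplus>\<^bsub>A\<^esub> Y $$ ij)),
    smult = (\<lambda>c X. mat n n (\<lambda>ij. c \<odot>\<^bsub>A\<^esub> X $$ ij)),
    star = (\<lambda>X. mat n n (\<lambda>(i, j). star A (X $$ (j, i))))\<rparr>"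

text \<open>The amplification of \<open>\<phi>\<close> to \<open>n \<times> n\<close> matrices is \<^term>\<open>map_mat \<phi>\<close>.\<close>

definition completely_positive ::
    "('a, 'm) star_algebra_scheme \<Rightarrow> ('b, 'l) star_algebra_scheme \<Rightarrow> ('a \<Rightarrow> 'b) \<Rightarrow> bool" where
  "completely_positive A B \<phi> \<longleftrightarrow> \<phi> \<in> linear_maps A B \<and>
    (\<forall>n\<ge>1. \<forall>X\<in>carrier (mat_algebra n A).
      positive (mat_algebra n A) X \<longrightarrow> positive (mat_algebra n B) (map_mat \<phi> X))"


section \<open>Right Hilbert modules\<close>

record ('a, 'e) inner_module = "(complex, 'e) module" +
  ract :: "'e \<Rightarrow> 'a \<Rightarrow> 'e"
  ainner :: "'e \<Rightarrow> 'e \<Rightarrow> 'a"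

locale hilbert_module =
  fixes A :: "'a normed_star_algebra" and E :: "('a, 'e) inner_module"
  assumes algebra: "unital_cstar_algebra A"
    and complex_space: "complex_space E"
    and ract_closed: "\<lbrakk>x \<in> carrier E; a \<in> carrier A\<rbrakk> \<Longrightarrow> ract E x a \<in> carrier E"
    and ract_add_left: "\<lbrakk>x \<in> carrier E; y \<in> carrier E; a \<in> carrier A\<rbrakk> \<Longrightarrow>
      ract E (x \<oplus>\<^bsub>E\<^esub> y) a = ract E x a \<oplus>\<^bsub>E\<^esub> ract E y a"
    and ract_add_right: "\<lbrakk>x \<in> carrier E; a \<in> carrier A; b \<in> carrier A\<rbrakk> \<Longrightarrow>
      ract E x (a \<oplus>\<^bsub>A\<^esub> b) = ract E x a \<oplus>\<^bsub>E\<^esub> ract E x b"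
    and ract_smult_left: "\<lbrakk>x \<in> carrier E; a \<in> carrier A\<rbrakk> \<Longrightarrow>
      ract E (c \<odot>\<^bsub>E\<^esub> x) a = c \<odot>\<^bsub>E\<^esub> ract E x a"
    and ract_smult_right: "\<lbrakk>x \<in> carrier E; a \<in> carrier A\<rbrakk> \<Longrightarrow>
      ract E x (c \<odot>\<^bsub>A\<^esub> a) = c \<odot>\<^bsub>E\<^esub> ract E x a"
    and ract_mult: "\<lbrakk>x \<in> carrier E; a \<in> carrier A; b \<in> carrier A\<rbrakk> \<Longrightarrow>
      ract E x (a \<otimes>\<^bsub>A\<^esub> b) = ract E (ract E x a) b"
    and ract_one: "x \<in> carrier E \<Longrightarrow> ract E x \<one>\<^bsub>A\<^esub> = x"
    and ainner_closed: "\<lbrakk>x \<in> carrier E; y \<in> carrier E\<rbrakk> \<Longrightarrow> ainner E x y \<in> carrier A"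
    and ainner_add: "\<lbrakk>x \<in> carrier E; y \<in> carrier E; z \<in> carrier E\<rbrakk> \<Longrightarrow>
      ainner E x (y \<oplus>\<^bsub>E\<^esub> z) = ainner E x y \<oplus>\<^bsub>A\<^esub> ainner E x z"
    and ainner_smult: "\<lbrakk>x \<in> carrier E; y \<in> carrier E\<rbrakk> \<Longrightarrow>
      ainner E x (c \<odot>\<^bsub>E\<^esub> y) = c \<odot>\<^bsub>A\<^esub> ainner E x y"
    and ainner_ract: "\<lbrakk>x \<in> carrier E; y \<in> carrier E; a \<in> carrier A\<rbrakk> \<Longrightarrow>
      ainner E x (ract E y a) = ainner E x y \<otimes>\<^bsub>A\<^esub> a"
    and ainner_star: "\<lbrakk>x \<in> carrier E; y \<in> carrier E\<rbrakk> \<Longrightarrow>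
      star A (ainner E x y) = ainner E y x"
    and ainner_positive: "x \<in> carrier E \<Longrightarrow> positive A (ainner E x x)"
    and ainner_definite: "\<lbrakk>x \<in> carrier E; ainner E x x = \<zero>\<^bsub>A\<^esub>\<rbrakk> \<Longrightarrow> x = \<zero>\<^bsub>E\<^esub>"
    and complete: "complete_under E (\<lambda>x. sqrt (anorm A (ainner E x x)))"

definition mat_module ::
    "nat \<Rightarrow> ('a, 'm) star_algebra_scheme \<Rightarrow> ('a, 'e) inner_module \<Rightarrow> ('a mat, 'e mat) inner_module"
where
  "mat_module n A E = \<lparr>
    carrier = {X \<in> carrier_mat n n. elements_mat X \<subseteq> carrier E},
    mult = undefined, one = undefined,
    zero = mat n n (\<lambda>_. \<zero>\<^bsub>E\<^esub>),
    add = (\<lambda>X Y. mat n n (\<lambda>ij. X $$ ij \<oplus>\<^bsub>E\<^esub> Y $$ ij)),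
    smult = (\<lambda>c X. mat n n (\<lambda>ij. c \<odot>\<^bsub>E\<^esub> X $$ ij)),
    ract = (\<lambda>X Y. mat n n (\<lambda>(i, j). \<Oplus>\<^bsub>E\<^esub>k\<in>{..<n}. ract E (X $$ (i, k)) (Y $$ (k, j)))),
    ainner = (\<lambda>X Y. mat n n (\<lambda>(i, j). \<Oplus>\<^bsub>A\<^esub>k\<in>{..<n}. ainner E (X $$ (k, i)) (Y $$ (k, j))))\<rparr>"


section \<open>Hilbert spaces and bounded operators\<close>

record 'v inner_space = "(complex, 'v) module" +
  cinner :: "'v \<Rightarrow> 'v \<Rightarrow> complex"

definition hnorm :: "'v inner_space \<Rightarrow> 'v \<Rightarrow> real" where
  "hnorm H x = sqrt (Re (cinner H x x))"

locale hilbert_space =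
  fixes H :: "'v inner_space" (structure)
  assumes complex_space: "complex_space H"
    and cinner_add: "\<lbrakk>x \<in> carrier H; y \<in> carrier H; z \<in> carrier H\<rbrakk> \<Longrightarrow>
      cinner H x (y \<oplus> z) = cinner H x y + cinner H x z"
    and cinner_smult: "\<lbrakk>x \<in> carrier H; y \<in> carrier H\<rbrakk> \<Longrightarrow>
      cinner H x (c \<odot> y) = c * cinner H x y"
    and cinner_commute: "\<lbrakk>x \<in> carrier H; y \<in> carrier H\<rbrakk> \<Longrightarrow>
      cinner H x y = cnj (cinner H y x)"
    and cinner_nonneg: "x \<in> carrier H \<Longrightarrow> 0 \<le> Re (cinner H x x)"
    and cinner_definite: "\<lbrakk>x \<in> carrier H; cinner H x x = 0\<rbrakk> \<Longrightarrow> x = \<zero>"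
    and complete: "complete_under H (hnorm H)"

text \<open>
  Operators are extensional functions (\<^const>\<open>undefined\<close> outside the carrier of their domain), so
  that equality of operators is equality on that carrier; \<^const>\<open>compose\<close> respects this.
\<close>

definition bounded_ops :: "'v inner_space \<Rightarrow> 'w inner_space \<Rightarrow> ('v \<Rightarrow> 'w) set" where
  "bounded_ops H K = {T \<in> linear_maps H K. T \<in> extensional (carrier H) \<and>
    (\<exists>c. \<forall>x\<in>carrier H. hnorm K (T x) \<le> c * hnorm H x)}"

definition adj :: "'v inner_space \<Rightarrow> 'w inner_space \<Rightarrow> ('v \<Rightarrow> 'w) \<Rightarrow> 'w \<Rightarrow> 'v" where
  "adj H K T = (THE S. S \<in> bounded_ops K H \<and>
    (\<forall>x\<in>carrier H. \<forall>y\<in>carrier K. cinner K (T x) y = cinner H x (S y)))"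

definition isometry :: "'v inner_space \<Rightarrow> 'w inner_space \<Rightarrow> ('v \<Rightarrow> 'w) \<Rightarrow> bool" where
  "isometry H K V \<longleftrightarrow> V \<in> bounded_ops H K \<and> (\<forall>x\<in>carrier H. hnorm K (V x) = hnorm H x)"

definition op_algebra :: "'v inner_space \<Rightarrow> ('v \<Rightarrow> 'v) star_algebra" where
  "op_algebra H = \<lparr>
    carrier = bounded_ops H H,
    mult = compose (carrier H),
    one = (\<lambda>x\<in>carrier H. x),
    zero = (\<lambda>x\<in>carrier H. \<zero>\<^bsub>H\<^esub>),
    add = (\<lambda>S T. \<lambda>x\<in>carrier H. S x \<oplus>\<^bsub>H\<^esub> T x),
    smult = (\<lambda>c T. \<lambda>x\<in>carrier H. c \<odot>\<^bsub>H\<^esub> T x),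
    star = adj H H\<rparr>"

text \<open>\<open>B(H, K)\<close> as a Hilbert \<open>B(H)\<close>-module, with inner product \<open>S\<^sup>* T\<close>.\<close>

definition op_module ::
    "'v inner_space \<Rightarrow> 'w inner_space \<Rightarrow> ('v \<Rightarrow> 'v, 'v \<Rightarrow> 'w) inner_module" where
  "op_module H K = \<lparr>
    carrier = bounded_ops H K,
    mult = undefined, one = undefined,
    zero = (\<lambda>x\<in>carrier H. \<zero>\<^bsub>K\<^esub>),
    add = (\<lambda>S T. \<lambda>x\<in>carrier H. S x \<oplus>\<^bsub>K\<^esub> T x),
    smult = (\<lambda>c T. \<lambda>x\<in>carrier H. c \<odot>\<^bsub>K\<^esub> T x),
    ract = compose (carrier H),
    ainner = (\<lambda>S T. compose (carrier H) (adj H K S) T)\<rparr>"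


section \<open>Completely semi-\<open>\<phi>\<close>-maps and \<open>\<rho>\<close>-representations\<close>

text \<open>
  The product \<open>\<Phi>\<^sub>n(x)\<^sup>* \<Phi>\<^sub>n(x)\<close> is the inner product of the \<open>M\<^sub>n(B(H\<^sub>1))\<close>-module
  \<open>M\<^sub>n(B(H\<^sub>1, H\<^sub>2))\<close>: its entry \<open>(i, j)\<close> is the sum over \<open>k\<close> of \<open>\<Phi>(x\<^sub>k\<^sub>i)\<^sup>* \<Phi>(x\<^sub>k\<^sub>j)\<close>.
\<close>

definition completely_semi ::
    "'a normed_star_algebra \<Rightarrow> ('a, 'e) inner_module \<Rightarrow> 'h inner_space \<Rightarrow> 'k inner_space \<Rightarrow>
      ('a \<Rightarrow> 'h \<Rightarrow> 'h) \<Rightarrow> ('e \<Rightarrow> 'h \<Rightarrow> 'k) \<Rightarrow> bool" where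
  "completely_semi A E H\<^sub>1 H\<^sub>2 \<phi> \<Phi> \<longleftrightarrow> \<Phi> \<in> linear_maps E (op_module H\<^sub>1 H\<^sub>2) \<and>
    (\<forall>n\<ge>1. \<forall>X\<in>carrier (mat_module n A E).
      star_le (mat_algebra n (op_algebra H\<^sub>1))
        (ainner (mat_module n (op_algebra H\<^sub>1) (op_module H\<^sub>1 H\<^sub>2)) (map_mat \<Phi> X) (map_mat \<Phi> X))
        (map_mat \<phi> (ainner (mat_module n A E) X X)))"

definition rho_representation ::
    "('a, 'e) inner_module \<Rightarrow> 'h inner_space \<Rightarrow> 'k inner_space \<Rightarrow>
      ('a \<Rightarrow> 'h \<Rightarrow> 'h) \<Rightarrow> ('e \<Rightarrow> 'h \<Rightarrow> 'k) \<Rightarrow> bool" where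
  "rho_representation E K\<^sub>1 K\<^sub>2 \<rho> \<Psi> \<longleftrightarrow> \<Psi> \<in> linear_maps E (op_module K\<^sub>1 K\<^sub>2) \<and>
    (\<forall>x\<in>carrier E. \<forall>y\<in>carrier E.
      compose (carrier K\<^sub>1) (adj K\<^sub>1 K\<^sub>2 (\<Psi> x)) (\<Psi> y) = \<rho> (ainner E x y))"

end

theory Submission
  imports Defs
begin

text \<open>
  Both dilation spaces are reproducing kernel Hilbert spaces, that is, spaces of complex functions
  generated by the sections of a positive semidefinite kernel (\<open>Moore_Aronszajn\<close>).

  The space \<open>K\<^sub>1\<close> is that of Stinespring's theorem. It belongs to the kernel
  \<open>((a, h), (b, g)) \<mapsto> \<langle>h, \<phi>(a\<^sup>* b) g\<rangle>\<close>, which is positive because \<open>\<phi>\<close> is completely positive, and whose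
  sections \<open>\<kappa>(a, h)\<close> play the part of the elementary tensors \<open>a \<otimes> h\<close>. Put \<open>\<rho>(c) \<kappa>(a, h) = \<kappa>(c a, h)\<close> and
  \<open>V h = \<kappa>(1, h)\<close>. That \<open>\<rho>(c)\<close> is bounded follows from the existence of some \<open>M \<ge> 0\<close> such that
  \<open>M \<cdot> 1 - c\<^sup>* c\<close> has the form \<open>b\<^sup>* b\<close> (\<open>star_mult_self_bounded\<close>).

  The space \<open>K\<^sub>2\<close> is generated by sections \<open>\<mu>(x, h)\<close>, for \<open>x\<close> in the module \<open>E\<close> and \<open>h\<close> in \<open>H\<^sub>1\<close>, and
  \<open>\<mu>(w)\<close>, for \<open>w\<close> in \<open>H\<^sub>2\<close>. Their inner products are prescribed to be
  \<open>\<langle>\<mu>(x, h), \<mu>(y, g)\<rangle> = \<langle>h, \<phi>(\<langle>x, y\<rangle>) g\<rangle>\<close>, \<open>\<langle>\<mu>(w), \<mu>(y, g)\<rangle> = \<langle>w, \<Phi>(y) g\<rangle>\<close> and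
  \<open>\<langle>\<mu>(v), \<mu>(w)\<rangle> = \<langle>v, w\<rangle>\<close>. The kernel so defined is positive (\<open>dilation_kernel_psd\<close>): for a combination of
  a vector \<open>w\<close> in \<open>H\<^sub>2\<close> and vectors \<open>(x\<^sub>i, h\<^sub>i)\<close>, the sum of all \<open>\<langle>h\<^sub>i, \<phi>(\<langle>x\<^sub>i, x\<^sub>j\<rangle>) h\<^sub>j\<rangle>\<close> is at least
  \<open>\<parallel>\<Sum>\<^sub>i \<Phi>(x\<^sub>i) h\<^sub>i\<parallel>\<^sup>2\<close> by the hypothesis on \<open>\<Phi>\<close>, so the form dominates \<open>\<parallel>w + \<Sum>\<^sub>i \<Phi>(x\<^sub>i) h\<^sub>i\<parallel>\<^sup>2\<close>.
  Now \<open>W w = \<mu>(w)\<close> is an isometry and \<open>\<Psi>(x) \<kappa>(a, h) = \<mu>(x a, h)\<close> satisfies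
  \<open>\<langle>\<Psi>(x) \<kappa>(p), \<Psi>(y) \<kappa>(q)\<rangle> = \<langle>\<kappa>(p), \<rho>(\<langle>x, y\<rangle>) \<kappa>(q)\<rangle>\<close>. This bounds \<open>\<Psi>(x)\<close> and shows that \<open>\<Psi>\<close> is a
  \<open>\<rho>\<close>-representation. Identities between operators on \<open>K\<^sub>1\<close> are checked on sections, since bounded
  operators that agree there are equal (\<open>spanning_op_eqI\<close>); the two factorizations are the prescribed inner
  products \<open>\<langle>\<kappa>(1, g), \<kappa>(a, h)\<rangle> = \<langle>g, \<phi>(a) h\<rangle>\<close> and \<open>\<langle>\<mu>(w), \<mu>(x, h)\<rangle> = \<langle>w, \<Phi>(x) h\<rangle>\<close>.
\<close>

section \<open>Semi-inner products, Riesz representation and adjoints\<close>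

text \<open>
  The one estimate behind the Cauchy--Schwarz inequality (\<open>p\<close> and \<open>q\<close> squared norms, \<open>r\<close> the inner
  product) and behind the variational characterization of a minimizer (\<open>p = 0\<close>, which forces \<open>r = 0\<close>).
\<close>
lemma quadratic_nonneg_imp_bound:
  fixes r :: complex and p q :: real
  assumes "0 \<le> q" and nonneg: "\<And>t. 0 \<le> p + 2 * Re (t * r) + (cmod t)\<^sup>2 * q"
  shows "(cmod r)\<^sup>2 \<le> p * q"
proof (cases "q = 0")
  case True
  have p: "2 * s * (cmod r)\<^sup>2 \<le> p" for s
    using nonneg[of "- of_real s * cnj r"] True
    by (simp add: cmod_power2) (simp add: power2_eq_square algebra_simps)
  have "r = 0"
  proof (rule ccontr)
    assume "r \<noteq> 0"
    then have "2 * ((p + 1) / (2 * (cmod r)\<^sup>2)) * (cmod r)\<^sup>2 = p + 1" by simp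
    then show False using p[of "(p + 1) / (2 * (cmod r)\<^sup>2)"] by simp
  qed
  then show ?thesis using True by simp
next
  case False
  then have q: "0 < q" using assms by simp
  have "Re (- cnj r / of_real q * r) = - (cmod r)\<^sup>2 / q"
    unfolding cmod_power2 by (simp add: power2_eq_square diff_divide_distrib add_divide_distrib)
  moreover have "(cmod (- cnj r / of_real q))\<^sup>2 * q = (cmod r)\<^sup>2 / q"
    using q by (simp add: norm_divide power_divide power2_eq_square)
  ultimately have "0 \<le> p - (cmod r)\<^sup>2 / q" using nonneg[of "- cnj r / of_real q"] by linarith
  then show ?thesis using q by (simp add: field_simps)
qed

lemma null_comparison:
  fixes f :: "nat \<Rightarrow> 'a :: real_normed_vector"
  assumes "\<And>n. norm (f n) \<le> g n" "g \<longlonglongrightarrow> 0"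
  shows "f \<longlonglongrightarrow> 0"
proof (rule tendsto_norm_zero_cancel, rule tendsto_sandwich[OF _ _ tendsto_const assms(2)])
qed (use assms in auto)

text \<open>
  A semi-inner product on a carrier \<open>C\<close> with operations \<open>pl\<close> and \<open>sm\<close>, which are not required to satisfy the
  axioms of a vector space. This covers Hilbert spaces, formal linear combinations (lists), and spaces
  of functions that are not yet known to be complete.
\<close>
locale semi_inner =
  fixes C :: "'v set" and pl :: "'v \<Rightarrow> 'v \<Rightarrow> 'v" and sm :: "complex \<Rightarrow> 'v \<Rightarrow> 'v"
    and ip :: "'v \<Rightarrow> 'v \<Rightarrow> complex"
  assumes pl_closed: "\<lbrakk>x \<in> C; y \<in> C\<rbrakk> \<Longrightarrow> pl x y \<in> C"
    and sm_closed: "x \<in> C \<Longrightarrow> sm c x \<in> C"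
    and ip_add: "\<lbrakk>x \<in> C; y \<in> C; z \<in> C\<rbrakk> \<Longrightarrow> ip x (pl y z) = ip x y + ip x z"
    and ip_smult: "\<lbrakk>x \<in> C; y \<in> C\<rbrakk> \<Longrightarrow> ip x (sm c y) = c * ip x y"
    and ip_commute: "\<lbrakk>x \<in> C; y \<in> C\<rbrakk> \<Longrightarrow> ip x y = cnj (ip y x)"
    and ip_nonneg: "x \<in> C \<Longrightarrow> 0 \<le> Re (ip x x)"
begin

text \<open>
  The seminorm of the semi-inner product.
\<close>

definition nm :: "'v \<Rightarrow> real" where "nm x = sqrt (Re (ip x x))"

lemma ip_add_left: "\<lbrakk>x \<in> C; y \<in> C; z \<in> C\<rbrakk> \<Longrightarrow> ip (pl x y) z = ip x z + ip y z"
  using ip_commute[of "pl x y" z] ip_commute[of z x] ip_commute[of z y]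
  by (simp add: pl_closed ip_add)

lemma ip_smult_left: "\<lbrakk>x \<in> C; y \<in> C\<rbrakk> \<Longrightarrow> ip (sm c x) y = cnj c * ip x y"
  using ip_commute[of "sm c x" y] ip_commute[of y x] by (simp add: sm_closed ip_smult)

lemma ip_self: assumes "x \<in> C" shows "ip x x = of_real ((nm x)\<^sup>2)"
proof -
  have "Im (ip x x) = 0" using ip_commute[OF assms assms] by (metis Reals_cnj_iff complex_is_Real_iff)
  then show ?thesis using ip_nonneg[OF assms] by (simp add: nm_def complex_eq_iff)
qed

lemma nm_nonneg: "x \<in> C \<Longrightarrow> 0 \<le> nm x"
  by (simp add: nm_def ip_nonneg)

lemma nm_squared: "x \<in> C \<Longrightarrow> (nm x)\<^sup>2 = Re (ip x x)"
  by (simp add: nm_def ip_nonneg)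

lemma nm_squared_add_smult:
  assumes "x \<in> C" "y \<in> C"
  shows "(nm (pl x (sm t y)))\<^sup>2 = (nm x)\<^sup>2 + 2 * Re (t * ip x y) + (cmod t)\<^sup>2 * (nm y)\<^sup>2"
proof -
  have yx: "ip y x = cnj (ip x y)" using assms ip_commute by blast
  have "ip (pl x (sm t y)) (pl x (sm t y))
      = ip x x + t * ip x y + cnj t * cnj (ip x y) + cnj t * t * ip y y"
    using assms by (simp add: ip_add ip_add_left ip_smult ip_smult_left pl_closed sm_closed yx algebra_simps)
  then have "ip (pl x (sm t y)) (pl x (sm t y))
      = of_real ((nm x)\<^sup>2 + 2 * Re (t * ip x y) + (cmod t)\<^sup>2 * (nm y)\<^sup>2)"
    unfolding ip_self[OF assms(1)] ip_self[OF assms(2)]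
    by (simp add: complex_eq_iff cmod_power2 algebra_simps) (simp add: power2_eq_square algebra_simps)
  then show ?thesis using assms by (simp add: nm_squared pl_closed sm_closed)
qed

lemma Cauchy_Schwarz: assumes "x \<in> C" "y \<in> C" shows "cmod (ip x y) \<le> nm x * nm y"
proof -
  have "(cmod (ip x y))\<^sup>2 \<le> (nm x)\<^sup>2 * (nm y)\<^sup>2"
    by (rule quadratic_nonneg_imp_bound) (simp, metis nm_squared_add_smult[OF assms] zero_le_power2)
  then show ?thesis
    by (metis power_mult_distrib power2_le_imp_le mult_nonneg_nonneg nm_nonneg assms)
qed

lemma nm_smult: assumes "x \<in> C" shows "nm (sm c x) = cmod c * nm x"
proof -
  have "c * (cnj c * ip x x) = of_real ((cmod c)\<^sup>2 * (nm x)\<^sup>2)"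
    unfolding of_real_mult complex_norm_square ip_self[OF assms] by (simp add: mult_ac)
  then have "ip (sm c x) (sm c x) = of_real ((cmod c)\<^sup>2 * (nm x)\<^sup>2)"
    using assms by (simp add: ip_smult ip_smult_left sm_closed)
  then have "(nm (sm c x))\<^sup>2 = (cmod c * nm x)\<^sup>2"
    using assms by (simp add: nm_squared sm_closed power_mult_distrib)
  then show ?thesis using assms by (simp add: nm_nonneg sm_closed)
qed

lemma nm_triangle: assumes "x \<in> C" "y \<in> C" shows "nm (pl x y) \<le> nm x + nm y"
proof (rule power2_le_imp_le)
  have yx: "ip y x = cnj (ip x y)" using assms ip_commute by blast
  have "(nm (pl x y))\<^sup>2 = (nm x)\<^sup>2 + 2 * Re (ip x y) + (nm y)\<^sup>2"
    using assms by (simp add: nm_squared pl_closed ip_add ip_add_left yx)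
  also have "\<dots> \<le> (nm x)\<^sup>2 + 2 * (nm x * nm y) + (nm y)\<^sup>2"
    using Cauchy_Schwarz[OF assms] complex_Re_le_cmod[of "ip x y"] by linarith
  finally show "(nm (pl x y))\<^sup>2 \<le> (nm x + nm y)\<^sup>2" by (simp add: power2_sum)
qed (use assms nm_nonneg in simp)

text \<open>
  The difference, formed without an additive inverse; in a vector space it is the usual one.
\<close>

definition df :: "'v \<Rightarrow> 'v \<Rightarrow> 'v" where "df x y = pl x (sm (- 1) y)"

lemma df_closed: "\<lbrakk>x \<in> C; y \<in> C\<rbrakk> \<Longrightarrow> df x y \<in> C"
  by (simp add: df_def pl_closed sm_closed)

lemma ip_diff: "\<lbrakk>x \<in> C; y \<in> C; z \<in> C\<rbrakk> \<Longrightarrow> ip x (df y z) = ip x y - ip x z"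
  by (simp add: df_def ip_add ip_smult sm_closed)

lemma ip_diff_left: "\<lbrakk>x \<in> C; y \<in> C; z \<in> C\<rbrakk> \<Longrightarrow> ip (df x y) z = ip x z - ip y z"
  by (simp add: df_def ip_add_left ip_smult_left sm_closed)

lemma nm_diff_commute: "\<lbrakk>x \<in> C; y \<in> C\<rbrakk> \<Longrightarrow> nm (df x y) = nm (df y x)"
  by (simp add: nm_def ip_diff ip_diff_left df_closed)

lemma nm_diff_triangle:
  assumes "x \<in> C" "y \<in> C" "z \<in> C" shows "nm (df x z) \<le> nm (df x y) + nm (df y z)"
proof -
  have "nm (df x z) = nm (pl (df x y) (df y z))"
    using assms by (simp add: nm_def ip_diff ip_diff_left df_closed pl_closed ip_add ip_add_left)
  then show ?thesis using nm_triangle[of "df x y" "df y z"] assms by (simp add: df_closed)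
qed

lemma nm_le_diff: assumes "x \<in> C" "y \<in> C" shows "nm x \<le> nm (df x y) + nm y"
proof -
  have "nm x = nm (pl (df x y) y)"
    using assms by (simp add: nm_def ip_diff ip_diff_left df_closed pl_closed ip_add ip_add_left)
  then show ?thesis using nm_triangle[of "df x y" y] assms by (simp add: df_closed)
qed

lemma parallelogram:
  assumes "x \<in> C" "y \<in> C"
  shows "(nm (df x y))\<^sup>2 = 2 * (nm x)\<^sup>2 + 2 * (nm y)\<^sup>2 - (nm (pl x y))\<^sup>2"
  using assms
  by (simp add: nm_squared ip_diff ip_diff_left df_closed pl_closed ip_add ip_add_left)

end

lemma linear_maps_iff:
  "T \<in> linear_maps V W \<longleftrightarrow> T \<in> carrier V \<rightarrow> carrier W \<and>
    (\<forall>x\<in>carrier V. \<forall>y\<in>carrier V. T (x \<oplus>\<^bsub>V\<^esub> y) = T x \<oplus>\<^bsub>W\<^esub> T y) \<and>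
    (\<forall>c. \<forall>x\<in>carrier V. T (c \<odot>\<^bsub>V\<^esub> x) = c \<odot>\<^bsub>W\<^esub> T x)"
  by (auto simp: LinearCombinations.module_hom_def)

lemma complete_underD:
  assumes "complete_under V N" and "\<And>n. s n \<in> carrier V"
    and "\<And>e. e > 0 \<Longrightarrow> \<exists>M. \<forall>m\<ge>M. \<forall>n\<ge>M. N (s m \<ominus>\<^bsub>V\<^esub> s n) < e"
  shows "\<exists>x\<in>carrier V. (\<lambda>n. N (s n \<ominus>\<^bsub>V\<^esub> x)) \<longlonglongrightarrow> 0"
proof -
  have "range s \<subseteq> carrier V" using assms(2) by blast
  then show ?thesis using assms(1,3) unfolding complete_under_def by (elim allE[of _ s]) blast
qed

lemma complex_space_minus:
  assumes "complex_space V" and x: "x \<in> carrier V" and y: "y \<in> carrier V"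
  shows "x \<ominus>\<^bsub>V\<^esub> y = x \<oplus>\<^bsub>V\<^esub> (- 1) \<odot>\<^bsub>V\<^esub> y"
proof -
  interpret V: vectorspace "class_ring :: complex ring" V by fact
  have "(- 1) \<odot>\<^bsub>V\<^esub> y = \<ominus>\<^bsub>V\<^esub> (1 \<odot>\<^bsub>V\<^esub> y)" using V.smult_l_minus[of 1 y] y by (simp add: class_ring_simps)
  then show ?thesis using V.smult_one[of y] x y by (simp add: a_minus_def)
qed

context hilbert_space
begin

sublocale vectorspace "class_ring :: complex ring" H
  by (rule complex_space)

lemma smult_cl [simp, intro]: "x \<in> carrier H \<Longrightarrow> c \<odot> x \<in> carrier H"
  using smult_closed[of c x] by simp

sublocale semi_inner "carrier H" "add H" "smult H" "cinner H"
  rewrites "semi_inner.nm (cinner H) = hnorm H"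
proof -
  show *: "semi_inner (carrier H) (add H) (smult H) (cinner H)"
    by unfold_locales (auto simp: cinner_add cinner_smult cinner_nonneg intro: cinner_commute)
  show "semi_inner.nm (cinner H) = hnorm H"
    by (rule ext) (simp add: semi_inner.nm_def[OF *] hnorm_def)
qed

lemma df_eq: "\<lbrakk>x \<in> carrier H; y \<in> carrier H\<rbrakk> \<Longrightarrow> df x y = x \<ominus> y"
  by (simp add: df_def complex_space_minus complex_space)

lemma cinner_diff: "\<lbrakk>x \<in> carrier H; y \<in> carrier H; z \<in> carrier H\<rbrakk> \<Longrightarrow> cinner H x (y \<ominus> z) = cinner H x y - cinner H x z"
  by (simp add: ip_diff flip: df_eq)

lemma hnorm_nonneg [simp]: "x \<in> carrier H \<Longrightarrow> 0 \<le> hnorm H x"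
  by (rule nm_nonneg)

lemma hnorm_eq_0: "\<lbrakk>x \<in> carrier H; hnorm H x = 0\<rbrakk> \<Longrightarrow> x = \<zero>"
  using ip_self[of x] cinner_definite by simp

lemma hnorm_zero [simp]: "hnorm H \<zero> = 0"
  using nm_smult[of "\<zero>" 0] by simp

lemma cinner_zero [simp]: "x \<in> carrier H \<Longrightarrow> cinner H x \<zero> = 0"
  using cinner_smult[of x "\<zero>" 0] by simp

lemma cinner_zero_left [simp]: "x \<in> carrier H \<Longrightarrow> cinner H \<zero> x = 0"
  using ip_smult_left[of "\<zero>" x 0] by simp

lemma hnorm_diff_eq_0:
  assumes "x \<in> carrier H" "y \<in> carrier H" "hnorm H (x \<ominus> y) = 0" shows "x = y"
  using hnorm_eq_0[of "x \<ominus> y"] assms by (metis M.minus_closed M.minus_equality M.minus_minus M.a_inv_closed a_minus_def)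

lemma cinner_eqI:
  assumes "x \<in> carrier H" "y \<in> carrier H" "\<And>z. z \<in> carrier H \<Longrightarrow> cinner H z x = cinner H z y"
  shows "x = y"
proof (rule hnorm_diff_eq_0)
  have "(hnorm H (df x y))\<^sup>2 = 0" using assms by (simp add: nm_squared df_closed ip_diff)
  then show "hnorm H (x \<ominus> y) = 0" using assms by (simp add: df_eq)
qed (use assms in auto)

lemma tendsto_hnorm:
  assumes s: "\<And>n. s n \<in> carrier H" and x: "x \<in> carrier H"
    and lim: "(\<lambda>n. hnorm H (s n \<ominus> x)) \<longlonglongrightarrow> 0"
  shows "(\<lambda>n. hnorm H (s n)) \<longlonglongrightarrow> hnorm H x"
proof (rule LIM_zero_cancel, rule null_comparison)
  show "norm (hnorm H (s n) - hnorm H x) \<le> hnorm H (s n \<ominus> x)" for n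
    using nm_le_diff[OF s x, of n] nm_le_diff[OF x s, of n] nm_diff_commute[OF s x, of n] s x
    by (simp add: df_eq abs_le_iff)
qed (rule lim)

text \<open>
  The representing vector is the minimizer of \<open>J x = \<parallel>x\<parallel>\<^sup>2 - 2 Re (f x)\<close>. By the parallelogram law every
  minimizing sequence is Cauchy.
\<close>
theorem Riesz_representation:
  assumes add: "\<And>x y. \<lbrakk>x \<in> carrier H; y \<in> carrier H\<rbrakk> \<Longrightarrow> f (x \<oplus> y) = f x + f y"
    and smult: "\<And>c x. x \<in> carrier H \<Longrightarrow> f (c \<odot> x) = c * f x"
    and bound: "\<And>x. x \<in> carrier H \<Longrightarrow> cmod (f x) \<le> C * hnorm H x"
  shows "\<exists>u\<in>carrier H. \<forall>x\<in>carrier H. f x = cinner H u x"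
proof -
  \<comment> \<open>\<open>J x = \<parallel>x - u\<parallel>\<^sup>2 - \<parallel>u\<parallel>\<^sup>2\<close> if \<open>u\<close> represents \<open>f\<close>\<close>
  define J where "J = (\<lambda>x. (hnorm H x)\<^sup>2 - 2 * Re (f x))"
  have lower: "- C\<^sup>2 \<le> J x" if "x \<in> carrier H" for x
  proof -
    have "Re (f x) \<le> C * hnorm H x" using bound[OF that] complex_Re_le_cmod order_trans by blast
    moreover have "0 \<le> (hnorm H x - C)\<^sup>2" by simp
    ultimately show ?thesis unfolding J_def by (simp add: power2_diff algebra_simps)
  qed
  define m where "m = Inf (J ` carrier H)"
  have bdd: "bdd_below (J ` carrier H)" using lower by (auto intro!: bdd_belowI)
  have m: "m \<le> J x" if "x \<in> carrier H" for x
    unfolding m_def using that bdd by (auto intro: cInf_lower)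
  have "\<exists>x\<in>carrier H. J x < m + inverse (Suc n)" for n
  proof -
    have "Inf (J ` carrier H) < m + inverse (Suc n)" by (simp add: m_def)
    then show ?thesis using cInf_lessD[of "J ` carrier H"] M.zero_closed by blast
  qed
  then obtain s where s: "\<And>n. s n \<in> carrier H" "\<And>n. J (s n) < m + inverse (Suc n)" by metis
  have key: "(hnorm H (df x y))\<^sup>2 \<le> 2 * (J x - m) + 2 * (J y - m)"
    if xy: "x \<in> carrier H" "y \<in> carrier H" for x y
  proof -
    have "4 * J ((1/2) \<odot> (x \<oplus> y)) = (hnorm H (x \<oplus> y))\<^sup>2 - 4 * Re (f x + f y)"
      using xy by (simp add: J_def nm_smult smult add power_divide field_simps)
    then have "4 * m \<le> (hnorm H (x \<oplus> y))\<^sup>2 - 4 * Re (f x + f y)"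
      using m[of "(1/2) \<odot> (x \<oplus> y)"] xy by simp
    then show ?thesis using parallelogram[OF xy] by (simp add: J_def)
  qed
  have Cauchy: "\<exists>M. \<forall>k\<ge>M. \<forall>l\<ge>M. hnorm H (s k \<ominus> s l) < e" if e: "e > 0" for e
  proof -
    obtain M where M: "inverse (Suc M) < e\<^sup>2 / 4" using reals_Archimedean[of "e\<^sup>2 / 4"] e by auto
    have "hnorm H (s k \<ominus> s l) < e" if "k \<ge> M" "l \<ge> M" for k l
    proof -
      have "inverse (real (Suc k)) \<le> inverse (real (Suc M))" "inverse (real (Suc l)) \<le> inverse (real (Suc M))"
        using that by (auto intro!: le_imp_inverse_le)
      moreover have arith: "d < E"
        if "d \<le> 2 * (x - m) + 2 * (y - m)" "x < m + a" "y < m + b" "c < E / 4" "a \<le> c" "b \<le> c"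
        for d E x y a b c :: real
        using that by (simp add: field_simps)
      ultimately have "(hnorm H (df (s k) (s l)))\<^sup>2 < e\<^sup>2"
        using arith[OF key[OF s(1) s(1), of k l] s(2) s(2) M] by simp
      then show ?thesis using e s(1) by (simp add: df_eq power_less_imp_less_base)
    qed
    then show ?thesis by blast
  qed
  obtain u where u: "u \<in> carrier H" and lim: "(\<lambda>n. hnorm H (s n \<ominus> u)) \<longlonglongrightarrow> 0"
    using complete_underD[OF complete s(1) Cauchy] by blast
  have diff: "f (x \<ominus> y) = f x - f y" if "x \<in> carrier H" "y \<in> carrier H" for x y
    using that by (simp add: df_def add smult flip: df_eq)
  have "(\<lambda>n. f (s n)) \<longlonglongrightarrow> f u"
  proof (rule LIM_zero_cancel, rule null_comparison)
    show "norm (f (s n) - f u) \<le> C * hnorm H (s n \<ominus> u)" for n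
      using bound[OF M.minus_closed[OF s(1) u]] s(1) u by (simp add: diff)
    show "(\<lambda>n. C * hnorm H (s n \<ominus> u)) \<longlonglongrightarrow> 0"
      using tendsto_mult_right_zero[OF lim] .
  qed
  then have "(\<lambda>n. J (s n)) \<longlonglongrightarrow> J u"
    unfolding J_def by (intro tendsto_intros tendsto_hnorm s u lim)
  moreover have "(\<lambda>n. m + inverse (real (Suc n))) \<longlonglongrightarrow> m + 0"
    by (intro tendsto_intros LIMSEQ_inverse_real_of_nat)
  moreover have "\<exists>N. \<forall>n\<ge>N. J (s n) \<le> m + inverse (real (Suc n))" using s(2) less_imp_le by blast
  ultimately have "J u \<le> m + 0" by (rule LIMSEQ_le)
  then have min: "J u \<le> J x" if "x \<in> carrier H" for x using m that by force
  have "f y = cinner H u y" if y: "y \<in> carrier H" for y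
  proof -
    have "(cmod (cinner H u y - f y))\<^sup>2 \<le> 0 * (hnorm H y)\<^sup>2"
    proof (rule quadratic_nonneg_imp_bound)
      fix t
      have "J (u \<oplus> t \<odot> y) = J u + 2 * Re (t * (cinner H u y - f y)) + (cmod t)\<^sup>2 * (hnorm H y)\<^sup>2"
        using nm_squared_add_smult[OF u y, of t] u y by (simp add: J_def add smult algebra_simps)
      then show "0 \<le> 0 + 2 * Re (t * (cinner H u y - f y)) + (cmod t)\<^sup>2 * (hnorm H y)\<^sup>2"
        using min[of "u \<oplus> t \<odot> y"] u y by simp
    qed simp
    then show ?thesis by simp
  qed
  then show ?thesis using u by blast
qed

end

lemma bounded_ops_bound:
  assumes "hilbert_space H" and "T \<in> bounded_ops H K"
  obtains c where "0 \<le> c" "\<And>x. x \<in> carrier H \<Longrightarrow> hnorm K (T x) \<le> c * hnorm H x"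
proof -
  interpret H: hilbert_space H by fact
  obtain c where c: "\<And>x. x \<in> carrier H \<Longrightarrow> hnorm K (T x) \<le> c * hnorm H x"
    using assms by (auto simp: bounded_ops_def)
  have "hnorm K (T x) \<le> \<bar>c\<bar> * hnorm H x" if "x \<in> carrier H" for x
    using c[OF that] mult_right_mono[OF abs_ge_self H.hnorm_nonneg[OF that], of c] by linarith
  then show ?thesis using that[of "\<bar>c\<bar>"] by simp
qed

lemma bounded_ops_closed: "\<lbrakk>T \<in> bounded_ops H K; x \<in> carrier H\<rbrakk> \<Longrightarrow> T x \<in> carrier K"
  and bounded_ops_add: "\<lbrakk>T \<in> bounded_ops H K; x \<in> carrier H; y \<in> carrier H\<rbrakk> \<Longrightarrow> T (x \<oplus>\<^bsub>H\<^esub> y) = T x \<oplus>\<^bsub>K\<^esub> T y"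
  and bounded_ops_smult: "\<lbrakk>T \<in> bounded_ops H K; x \<in> carrier H\<rbrakk> \<Longrightarrow> T (c \<odot>\<^bsub>H\<^esub> x) = c \<odot>\<^bsub>K\<^esub> T x"
  by (auto simp: bounded_ops_def linear_maps_iff)

lemma bounded_ops_eqI:
  assumes "S \<in> bounded_ops H K" "T \<in> bounded_ops H K" "\<And>x. x \<in> carrier H \<Longrightarrow> S x = T x"
  shows "S = T"
  using assms by (auto simp: bounded_ops_def intro: extensionalityI)

lemma restrict_bounded_opsI:
  assumes "hilbert_space H"
    and "\<And>x. x \<in> carrier H \<Longrightarrow> f x \<in> carrier K"
    and "\<And>x y. \<lbrakk>x \<in> carrier H; y \<in> carrier H\<rbrakk> \<Longrightarrow> f (x \<oplus>\<^bsub>H\<^esub> y) = f x \<oplus>\<^bsub>K\<^esub> f y"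
    and "\<And>c x. x \<in> carrier H \<Longrightarrow> f (c \<odot>\<^bsub>H\<^esub> x) = c \<odot>\<^bsub>K\<^esub> f x"
    and "\<And>x. x \<in> carrier H \<Longrightarrow> hnorm K (f x) \<le> C * hnorm H x"
  shows "(\<lambda>x\<in>carrier H. f x) \<in> bounded_ops H K"
proof -
  interpret H: hilbert_space H by fact
  show ?thesis unfolding bounded_ops_def using assms by (auto simp: linear_maps_iff intro!: exI[of _ C])
qed

lemma adjoint_exists:
  assumes "hilbert_space H" "hilbert_space K" and T: "T \<in> bounded_ops H K"
  shows "\<exists>S\<in>bounded_ops K H. \<forall>x\<in>carrier H. \<forall>y\<in>carrier K. cinner K (T x) y = cinner H x (S y)"
proof -
  interpret H: hilbert_space H by fact
  interpret K: hilbert_space K by fact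
  note T_simps = bounded_ops_closed[OF T] bounded_ops_add[OF T] bounded_ops_smult[OF T]
  obtain c where c: "0 \<le> c" "\<And>x. x \<in> carrier H \<Longrightarrow> hnorm K (T x) \<le> c * hnorm H x"
    using bounded_ops_bound[OF assms(1) T] by blast
  have "\<exists>u\<in>carrier H. \<forall>x\<in>carrier H. cinner K y (T x) = cinner H u x" if y: "y \<in> carrier K" for y
  proof (rule H.Riesz_representation[where C = "hnorm K y * c"])
    fix x assume x: "x \<in> carrier H"
    have "cmod (cinner K y (T x)) \<le> hnorm K y * hnorm K (T x)"
      using K.Cauchy_Schwarz y x T_simps by blast
    also have "\<dots> \<le> hnorm K y * (c * hnorm H x)"
      using y c(2)[OF x] by (simp add: mult_left_mono)
    finally show "cmod (cinner K y (T x)) \<le> hnorm K y * c * hnorm H x" by (simp add: mult.assoc)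
  qed (use y in \<open>auto simp: T_simps K.cinner_add K.cinner_smult\<close>)
  then obtain S where S: "\<And>y. y \<in> carrier K \<Longrightarrow> S y \<in> carrier H"
      "\<And>x y. \<lbrakk>y \<in> carrier K; x \<in> carrier H\<rbrakk> \<Longrightarrow> cinner K y (T x) = cinner H (S y) x" by metis
  have eq: "cinner K (T x) y = cinner H x (S y)" if "x \<in> carrier H" "y \<in> carrier K" for x y
    using S that K.cinner_commute H.cinner_commute T_simps by metis
  have "(\<lambda>y\<in>carrier K. S y) \<in> bounded_ops K H"
  proof (rule restrict_bounded_opsI)
    fix y z assume "y \<in> carrier K" "z \<in> carrier K"
    then show "S (y \<oplus>\<^bsub>K\<^esub> z) = S y \<oplus>\<^bsub>H\<^esub> S z"
      using S(1) by (intro H.cinner_eqI) (auto simp: H.cinner_add K.cinner_add T_simps simp flip: eq)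
  next
    fix y d assume "y \<in> carrier K"
    then show "S (d \<odot>\<^bsub>K\<^esub> y) = d \<odot>\<^bsub>H\<^esub> S y"
      using S(1) by (intro H.cinner_eqI) (auto simp: H.cinner_smult K.cinner_smult T_simps simp flip: eq)
  next
    fix y assume y: "y \<in> carrier K"
    have "(hnorm H (S y))\<^sup>2 = cmod (cinner K (T (S y)) y)"
      using y by (simp add: eq S(1) H.ip_self norm_power)
    also have "\<dots> \<le> hnorm K (T (S y)) * hnorm K y"
      using y S(1) T_simps by (intro K.Cauchy_Schwarz) auto
    also have "\<dots> \<le> (c * hnorm H (S y)) * hnorm K y"
      using y S(1) c by (intro mult_right_mono) auto
    finally have *: "hnorm H (S y) * hnorm H (S y) \<le> hnorm H (S y) * (c * hnorm K y)"
      by (simp add: power2_eq_square mult.commute mult.left_commute)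
    show "hnorm H (S y) \<le> c * hnorm K y"
    proof (cases "hnorm H (S y) = 0")
      case True then show ?thesis using c y by simp
    next
      case False
      then have "0 < hnorm H (S y)" using H.hnorm_nonneg[OF S(1)[OF y]] by linarith
      then show ?thesis using * mult_le_cancel_left_pos by blast
    qed
  qed (use S assms in auto)
  then show ?thesis using eq by (intro bexI[of _ "\<lambda>y\<in>carrier K. S y"]) auto
qed

text \<open>
  Since \<^const>\<open>adj\<close> is a definite description, this rule is the way to identify it; \<open>adj_bounded\<close> and
  \<open>cinner_adj\<close> rest on the existence of adjoints.
\<close>
lemma adj_eqI:
  assumes "hilbert_space H" "S \<in> bounded_ops K H"
    and "\<And>x y. \<lbrakk>x \<in> carrier H; y \<in> carrier K\<rbrakk> \<Longrightarrow> cinner K (T x) y = cinner H x (S y)"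
  shows "adj H K T = S"
  unfolding adj_def
proof (rule the_equality)
  interpret H: hilbert_space H by fact
  fix S' assume S': "S' \<in> bounded_ops K H \<and> (\<forall>x\<in>carrier H. \<forall>y\<in>carrier K. cinner K (T x) y = cinner H x (S' y))"
  show "S' = S"
  proof (rule bounded_ops_eqI)
    fix y assume y: "y \<in> carrier K"
    have "cinner H z (S' y) = cinner H z (S y)" if "z \<in> carrier H" for z
      using S' assms(3)[OF that y] that y by simp
    then show "S' y = S y"
      using S' assms(2) y by (intro H.cinner_eqI) (auto intro: bounded_ops_closed)
  qed (use S' assms in auto)
qed (use assms in auto)

lemma
  assumes "hilbert_space H" "hilbert_space K" and "T \<in> bounded_ops H K"
  shows adj_bounded: "adj H K T \<in> bounded_ops K H"
    and cinner_adj: "\<lbrakk>x \<in> carrier H; y \<in> carrier K\<rbrakk> \<Longrightarrow> cinner H x (adj H K T y) = cinner K (T x) y"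
proof -
  obtain S where S: "S \<in> bounded_ops K H"
    "\<And>x y. \<lbrakk>x \<in> carrier H; y \<in> carrier K\<rbrakk> \<Longrightarrow> cinner K (T x) y = cinner H x (S y)"
    using adjoint_exists[OF assms] by blast
  then have "adj H K T = S" using assms by (intro adj_eqI)
  then show "adj H K T \<in> bounded_ops K H"
    "\<lbrakk>x \<in> carrier H; y \<in> carrier K\<rbrakk> \<Longrightarrow> cinner H x (adj H K T y) = cinner K (T x) y"
    using S by simp_all
qed

section \<open>Reproducing kernel Hilbert spaces\<close>

text \<open>
  A list of pairs (coefficient, point) stands for a formal linear combination, addition being \<open>@\<close>.
  The combination \<open>ds\<close> is turned by a kernel \<open>k\<close> into the function \<open>kfun k ds\<close>, the corresponding
  combination of the sections \<open>k(\<cdot>, y)\<close>.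
\<close>
definition kfun :: "('x \<Rightarrow> 'y \<Rightarrow> complex) \<Rightarrow> (complex \<times> 'y) list \<Rightarrow> 'x \<Rightarrow> complex" where
  "kfun k ds = (\<lambda>x. \<Sum>(d, y)\<leftarrow>ds. d * k x y)"

text \<open>
  Evaluation of a function at a formal combination, conjugate linear in the combination. In a
  reproducing kernel space it is the inner product with \<open>kfun k cs\<close>.
\<close>
definition ev :: "(complex \<times> 'x) list \<Rightarrow> ('x \<Rightarrow> complex) \<Rightarrow> complex" where
  "ev cs f = (\<Sum>(c, x)\<leftarrow>cs. cnj c * f x)"

text \<open>
  The sesquilinear form of a kernel on formal combinations, a finite double sum (see \<open>form_sum\<close>).
\<close>
definition form :: "('x \<Rightarrow> 'y \<Rightarrow> complex) \<Rightarrow> (complex \<times> 'x) list \<Rightarrow> (complex \<times> 'y) list \<Rightarrow> complex" where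
  "form k cs ds = ev cs (kfun k ds)"

text \<open>
  Scalar multiplication of formal combinations.
\<close>
definition smul :: "complex \<Rightarrow> (complex \<times> 'x) list \<Rightarrow> (complex \<times> 'x) list" where
  "smul c = map (\<lambda>(d, x). (c * d, x))"

lemma kfun_simps [simp]:
  "kfun k [] = (\<lambda>x. 0)"
  "kfun k ((d, y) # ds) = (\<lambda>x. d * k x y + kfun k ds x)"
  "kfun k (cs @ ds) = (\<lambda>x. kfun k cs x + kfun k ds x)"
  by (auto simp: kfun_def)

lemma kfun_smul [simp]: "kfun k (smul c ds) = (\<lambda>x. c * kfun k ds x)"
  by (induction ds) (auto simp: smul_def algebra_simps)

lemma ev_simps [simp]:
  "ev [] f = 0"
  "ev ((c, x) # cs) f = cnj c * f x + ev cs f"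
  "ev (cs @ ds) f = ev cs f + ev ds f"
  by (auto simp: ev_def)

lemma ev_smul [simp]: "ev (smul c cs) f = cnj c * ev cs f"
  by (induction cs) (auto simp: smul_def algebra_simps)

lemma ev_add [simp]: "ev cs (\<lambda>x. f x + g x) = ev cs f + ev cs g"
  by (induction cs) (auto simp: algebra_simps)

lemma ev_mult [simp]: "ev cs (\<lambda>x. c * f x) = c * ev cs f"
  by (induction cs) (auto simp: algebra_simps)

lemma ev_zero [simp]: "ev cs (\<lambda>x. 0) = 0"
  by (induction cs) auto

lemma ev_tendsto:
  assumes "\<And>x. (\<lambda>n. g n x) \<longlonglongrightarrow> f x" shows "(\<lambda>n. ev cs (g n)) \<longlonglongrightarrow> ev cs f"
  by (induction cs) (auto intro!: tendsto_intros assms)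

lemma form_simps:
  "form k [] ds = 0" "form k cs [] = 0"
  "form k (cs @ cs') ds = form k cs ds + form k cs' ds"
  "form k cs (ds @ ds') = form k cs ds + form k cs ds'"
  "form k (smul c cs) ds = cnj c * form k cs ds"
  "form k cs (smul c ds) = c * form k cs ds"
  by (simp_all add: form_def)

lemma form_commute:
  assumes "\<And>x y. k x y = cnj (k y x)" shows "form k cs ds = cnj (form k ds cs)"
proof -
  have *: "cnj (kfun k cs y) = ev cs (\<lambda>x. k x y)" for y cs
  proof (induction cs)
    case (Cons p cs)
    then show ?case by (cases p) (simp, metis assms)
  qed simp
  have "form k cs ds = cnj (form k ds cs)" for ds
  proof (induction ds)
    case (Cons p ds)
    then show ?case by (cases p) (simp add: form_def flip: *)
  qed (simp add: form_simps)
  then show ?thesis .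
qed

text \<open>
  The operations are prescribed on all functions and not only on the carrier, so that a subspace needs
  nothing but closure.
\<close>
lemma complex_space_functions:
  assumes "zero V \<in> carrier V"
    and "\<And>f g. \<lbrakk>f \<in> carrier V; g \<in> carrier V\<rbrakk> \<Longrightarrow> f \<oplus>\<^bsub>V\<^esub> g \<in> carrier V"
    and "\<And>c f. f \<in> carrier V \<Longrightarrow> c \<odot>\<^bsub>V\<^esub> f \<in> carrier V"
    and V: "zero V = (\<lambda>x. 0)" "add V = (\<lambda>f g x. f x + g x)" "smult V = (\<lambda>c f x. c * f x)"
  shows "complex_space (V :: (complex, 'x \<Rightarrow> complex, 'm) module_scheme)"
proof -
  have "abelian_group V"
  proof (rule abelian_groupI)
    fix f assume "f \<in> carrier V"
    then show "\<exists>g\<in>carrier V. g \<oplus>\<^bsub>V\<^esub> f = \<zero>\<^bsub>V\<^esub>"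
      using assms(3)[of f "- 1"] by (intro bexI[of _ "(- 1) \<odot>\<^bsub>V\<^esub> f"]) (auto simp: V)
  qed (use assms(1,2) in \<open>auto simp: V algebra_simps\<close>)
  then have "Module.module (class_ring :: complex ring) V"
    using assms(3) class_cring.cring_axioms by (intro Module.moduleI) (auto simp: V algebra_simps)
  then show ?thesis by (simp add: vectorspace_def class_field.field_axioms)
qed

text \<open>
  A positive semidefinite kernel on a whole type. Restriction to a subset of points is dealt with in
  \<open>Moore_Aronszajn\<close>.
\<close>
locale psd_kernel =
  fixes k :: "'x \<Rightarrow> 'x \<Rightarrow> complex"
  assumes hermitian: "k x y = cnj (k y x)"
    and psd: "0 \<le> Re (form k cs cs)"
begin

sublocale L: semi_inner UNIV append smul "form k"
  by unfold_locales (auto simp: form_simps psd intro: form_commute hermitian)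

lemma ev_df [simp]: "ev (L.df cs ds) f = ev cs f - ev ds f"
  by (simp add: L.df_def)

lemma kfun_df [simp]: "kfun k (L.df cs ds) = (\<lambda>x. kfun k cs x - kfun k ds x)"
  by (simp add: L.df_def)

text \<open>
  The completion of the space of formal combinations, realized by functions: \<open>f\<close> is approximated by
  \<open>s\<close> if \<open>s\<close> is Cauchy for the seminorm of the kernel and \<open>kfun k (s n)\<close> converges to \<open>f\<close> pointwise.
\<close>
definition approx :: "(nat \<Rightarrow> (complex \<times> 'x) list) \<Rightarrow> ('x \<Rightarrow> complex) \<Rightarrow> bool" where
  "approx s f \<longleftrightarrow> (\<forall>e>0. \<exists>M. \<forall>m\<ge>M. \<forall>n\<ge>M. L.nm (L.df (s m) (s n)) < e) \<and>
    (\<forall>x. (\<lambda>n. kfun k (s n) x) \<longlonglongrightarrow> f x)"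

lemma approxD:
  assumes "approx s f"
  shows approx_Cauchy: "e > 0 \<Longrightarrow> \<exists>M. \<forall>m\<ge>M. \<forall>n\<ge>M. L.nm (L.df (s m) (s n)) < e"
    and approx_tendsto: "(\<lambda>n. kfun k (s n) x) \<longlonglongrightarrow> f x"
  using assms by (auto simp: approx_def)

lemma approx_ev:
  assumes "approx s f" shows "(\<lambda>n. form k cs (s n)) \<longlonglongrightarrow> ev cs f"
  unfolding form_def by (rule ev_tendsto) (rule approx_tendsto[OF assms])

lemma approx_uniform:
  assumes "approx s f" "e > 0"
  shows "\<exists>M. \<forall>n\<ge>M. \<forall>cs. cmod (ev cs f - form k cs (s n)) \<le> e * L.nm cs"
proof -
  obtain M where M: "\<And>m n. \<lbrakk>m \<ge> M; n \<ge> M\<rbrakk> \<Longrightarrow> L.nm (L.df (s m) (s n)) < e"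
    using approx_Cauchy[OF assms] by blast
  have "cmod (ev cs f - form k cs (s n)) \<le> e * L.nm cs" if n: "n \<ge> M" for n cs
  proof (rule Lim_bounded)
    show "(\<lambda>m. cmod (form k cs (s m) - form k cs (s n))) \<longlonglongrightarrow> cmod (ev cs f - form k cs (s n))"
      by (intro tendsto_intros approx_ev assms)
    show "\<forall>m\<ge>M. cmod (form k cs (s m) - form k cs (s n)) \<le> e * L.nm cs"
    proof (intro allI impI)
      fix m assume m: "m \<ge> M"
      have "cmod (form k cs (s m) - form k cs (s n)) \<le> L.nm cs * L.nm (L.df (s m) (s n))"
        using L.Cauchy_Schwarz[of cs "L.df (s m) (s n)"] by (simp add: L.ip_diff)
      also have "\<dots> \<le> L.nm cs * e" using M[OF m n] L.nm_nonneg[of cs] by (intro mult_left_mono) auto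
      finally show "cmod (form k cs (s m) - form k cs (s n)) \<le> e * L.nm cs" by (simp add: mult.commute)
    qed
  qed
  then show ?thesis by blast
qed

lemma approx_bounded:
  assumes "approx s f"
  shows "\<exists>B\<ge>0. \<exists>M. \<forall>n\<ge>M. L.nm (s n) \<le> B"
proof -
  obtain M where M: "\<And>m n. \<lbrakk>m \<ge> M; n \<ge> M\<rbrakk> \<Longrightarrow> L.nm (L.df (s m) (s n)) < 1"
    using approx_Cauchy[OF assms, of 1] by auto
  have "L.nm (s n) \<le> 1 + L.nm (s M)" if "n \<ge> M" for n
    using L.nm_le_diff[of "s n" "s M"] M[OF that, of M] by simp
  then show ?thesis using L.nm_nonneg[of "s M"] by (intro exI[of _ "1 + L.nm (s M)"]) auto
qed

lemma approx_ev_bounded: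
  assumes "approx s f"
  shows "\<exists>B. \<forall>cs. cmod (ev cs f) \<le> B * L.nm cs"
proof -
  obtain M where M: "\<And>cs. cmod (ev cs f - form k cs (s M)) \<le> 1 * L.nm cs"
    using approx_uniform[OF assms, of 1] by auto
  have "cmod (ev cs f) \<le> (1 + L.nm (s M)) * L.nm cs" for cs
    using M[of cs] L.Cauchy_Schwarz[of cs "s M"]
      norm_triangle_sub[of "ev cs f" "form k cs (s M)"] by (simp add: algebra_simps)
  then show ?thesis by blast
qed

lemma approx_ev_convergent:
  assumes t: "approx t g" and s: "approx s f" shows "convergent (\<lambda>n. ev (t n) f)"
proof -
  obtain B where B: "\<And>cs. cmod (ev cs f) \<le> B * L.nm cs" using approx_ev_bounded[OF s] by blast
  have "Cauchy (\<lambda>n. ev (t n) f)"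
  proof (rule CauchyI)
    fix e :: real assume e: "e > 0"
    obtain M where M: "\<And>m n. \<lbrakk>m \<ge> M; n \<ge> M\<rbrakk> \<Longrightarrow> L.nm (L.df (t m) (t n)) < e / (\<bar>B\<bar> + 1)"
      using approx_Cauchy[OF t, of "e / (\<bar>B\<bar> + 1)"] e by auto
    have "norm (ev (t m) f - ev (t n) f) < e" if mn: "m \<ge> M" "n \<ge> M" for m n
    proof -
      have "norm (ev (t m) f - ev (t n) f) \<le> B * L.nm (L.df (t m) (t n))"
        using B[of "L.df (t m) (t n)"] by simp
      also have "\<dots> \<le> (\<bar>B\<bar> + 1) * L.nm (L.df (t m) (t n))"
        using L.nm_nonneg[of "L.df (t m) (t n)"] by (intro mult_right_mono) auto
      also have "\<dots> < e" using M[OF mn] by (simp add: field_simps)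
      finally show ?thesis .
    qed
    then show "\<exists>M. \<forall>m\<ge>M. \<forall>n\<ge>M. norm (ev (t m) f - ev (t n) f) < e" by blast
  qed
  then show ?thesis by (rule Cauchy_convergent)
qed

lemma approx_ev_form:
  assumes t: "approx t g" and s: "approx s f"
  shows "(\<lambda>n. ev (t n) f - form k (t n) (s n)) \<longlonglongrightarrow> 0"
proof (rule LIMSEQ_I)
  fix e :: real assume e: "e > 0"
  obtain B N where B: "B \<ge> 0" "\<And>n. n \<ge> N \<Longrightarrow> L.nm (t n) \<le> B" using approx_bounded[OF t] by blast
  obtain M where M: "\<And>n cs. n \<ge> M \<Longrightarrow> cmod (ev cs f - form k cs (s n)) \<le> e / (B + 1) * L.nm cs"
    using approx_uniform[OF s, of "e / (B + 1)"] e B by auto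
  have "norm (ev (t n) f - form k (t n) (s n) - 0) < e" if "n \<ge> max M N" for n
  proof -
    have "cmod (ev (t n) f - form k (t n) (s n)) \<le> e / (B + 1) * L.nm (t n)" using M that by simp
    also have "\<dots> \<le> e / (B + 1) * B" using B that e by (intro mult_left_mono) auto
    also have "\<dots> < e" using B e by (simp add: field_simps)
    finally show ?thesis by simp
  qed
  then show "\<exists>no. \<forall>n\<ge>no. norm (ev (t n) f - form k (t n) (s n) - 0) < e" by blast
qed

lemma approx_form_tendsto:
  assumes "approx t g" "approx s f" "(\<lambda>n. ev (t n) f) \<longlonglongrightarrow> l"
  shows "(\<lambda>n. form k (t n) (s n)) \<longlonglongrightarrow> l"
  using tendsto_diff[OF assms(3) approx_ev_form[OF assms(1,2)]] by simp

text \<open>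
  Both limits agree, up to conjugation, with that of \<open>form k (t n) (s n)\<close>. As \<open>ev (s n) g\<close> does not
  mention \<open>t\<close>, the limit of \<open>ev (t n) f\<close> depends on \<open>g\<close> only and not on the sequence approximating it.
\<close>
lemma approx_commute:
  assumes t: "approx t g" and s: "approx s f" and "(\<lambda>n. ev (t n) f) \<longlonglongrightarrow> l"
  shows "(\<lambda>n. ev (s n) g) \<longlonglongrightarrow> cnj l"
proof -
  have "(\<lambda>n. cnj (form k (t n) (s n))) \<longlonglongrightarrow> cnj l"
    by (intro tendsto_cnj approx_form_tendsto[OF assms])
  moreover have "cnj (form k (t n) (s n)) = form k (s n) (t n)" for n
    using L.ip_commute[of "s n" "t n"] by simp
  ultimately have "(\<lambda>n. form k (s n) (t n)) \<longlonglongrightarrow> cnj l" by simp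
  from tendsto_add[OF approx_ev_form[OF s t] this] show ?thesis by simp
qed

text \<open>
  The inner product of the completion. The choice of the approximating sequence is immaterial by
  \<open>rk_inner_tendsto\<close>; the expression is manifestly linear in \<open>f\<close>.
\<close>
definition rk_inner :: "('x \<Rightarrow> complex) \<Rightarrow> ('x \<Rightarrow> complex) \<Rightarrow> complex" where
  "rk_inner g f = lim (\<lambda>n. ev ((SOME t. approx t g) n) f)"

lemma rk_inner_tendsto:
  assumes t: "approx t g" and s: "approx s f"
  shows "(\<lambda>n. ev (t n) f) \<longlonglongrightarrow> rk_inner g f"
proof -
  define u where "u = (SOME t. approx t g)"
  have u: "approx u g" unfolding u_def using someI[of "\<lambda>t. approx t g", OF t] .
  have "(\<lambda>n. ev (u n) f) \<longlonglongrightarrow> rk_inner g f"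
    unfolding rk_inner_def u_def[symmetric]
    using approx_ev_convergent[OF u s] by (rule convergent_LIMSEQ_iff[THEN iffD1])
  then show ?thesis using approx_commute[OF s t approx_commute[OF u s]] by simp
qed

text \<open>
  The reproducing kernel Hilbert space of \<open>k\<close>, with pointwise operations.
\<close>
definition RK :: "('x \<Rightarrow> complex) inner_space" where
  "RK = \<lparr>carrier = {f. \<exists>s. approx s f}, mult = undefined, one = undefined, zero = (\<lambda>x. 0),
    add = (\<lambda>f g x. f x + g x), smult = (\<lambda>c f x. c * f x), cinner = rk_inner\<rparr>"

lemma RK_simps [simp]:
  "zero RK = (\<lambda>x. 0)" "add RK = (\<lambda>f g x. f x + g x)" "smult RK = (\<lambda>c f x. c * f x)" "cinner RK = rk_inner"
  by (simp_all add: RK_def)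

lemma RK_iff: "f \<in> carrier RK \<longleftrightarrow> (\<exists>s. approx s f)"
  by (simp add: RK_def)

lemma RK_I: "approx s f \<Longrightarrow> f \<in> carrier RK"
  unfolding RK_iff by (rule exI)

lemma nm_df_self [simp]: "L.nm (L.df cs cs) = 0"
  by (simp add: L.nm_def form_def)

lemma approx_kfun: "approx (\<lambda>n. cs) (kfun k cs)"
  by (simp add: approx_def)

lemma approx_add:
  assumes s: "approx s f" and t: "approx t g"
  shows "approx (\<lambda>n. s n @ t n) (\<lambda>x. f x + g x)"
  unfolding approx_def
proof (intro conjI allI impI)
  have le: "L.nm (L.df (a @ b) (c @ d)) \<le> L.nm (L.df a c) + L.nm (L.df b d)" for a b c d
  proof -
    have "L.nm (L.df (a @ b) (c @ d)) = L.nm (L.df a c @ L.df b d)"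
      by (simp add: L.nm_def form_def algebra_simps)
    then show ?thesis using L.nm_triangle[of "L.df a c" "L.df b d"] by simp
  qed
  fix e :: real assume e: "e > 0"
  obtain M where M: "\<And>m n. \<lbrakk>m \<ge> M; n \<ge> M\<rbrakk> \<Longrightarrow> L.nm (L.df (s m) (s n)) < e / 2"
    using approx_Cauchy[OF s, of "e/2"] e by auto
  obtain N where N: "\<And>m n. \<lbrakk>m \<ge> N; n \<ge> N\<rbrakk> \<Longrightarrow> L.nm (L.df (t m) (t n)) < e / 2"
    using approx_Cauchy[OF t, of "e/2"] e by auto
  have "L.nm (L.df (s m @ t m) (s n @ t n)) < e" if "m \<ge> max M N" "n \<ge> max M N" for m n
    using le[of "s m" "t m" "s n" "t n"] M[of m n] N[of m n] that by simp
  then show "\<exists>M. \<forall>m\<ge>M. \<forall>n\<ge>M. L.nm (L.df (s m @ t m) (s n @ t n)) < e" by blast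
qed (auto intro!: tendsto_intros approx_tendsto s t)

lemma approx_smult:
  assumes s: "approx s f" shows "approx (\<lambda>n. smul c (s n)) (\<lambda>x. c * f x)"
  unfolding approx_def
proof (intro conjI allI impI)
  have eq: "L.nm (L.df (smul c a) (smul c b)) = cmod c * L.nm (L.df a b)" for a b
  proof -
    have "L.nm (L.df (smul c a) (smul c b)) = L.nm (smul c (L.df a b))"
      by (simp add: L.nm_def form_def algebra_simps)
    then show ?thesis using L.nm_smult by simp
  qed
  fix e :: real assume e: "e > 0"
  obtain M where M: "\<And>m n. \<lbrakk>m \<ge> M; n \<ge> M\<rbrakk> \<Longrightarrow> L.nm (L.df (s m) (s n)) < e / (cmod c + 1)"
    using approx_Cauchy[OF s, of "e / (cmod c + 1)"] e by (auto simp: add_nonneg_pos)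
  have "L.nm (L.df (smul c (s m)) (smul c (s n))) < e" if mn: "m \<ge> M" "n \<ge> M" for m n
  proof -
    have "cmod c * L.nm (L.df (s m) (s n)) \<le> (cmod c + 1) * L.nm (L.df (s m) (s n))"
      using L.nm_nonneg[of "L.df (s m) (s n)"] by (intro mult_right_mono) auto
    also have "\<dots> < e" using M[OF mn] norm_ge_zero[of c] by (simp add: pos_less_divide_eq add_nonneg_pos mult.commute)
    finally show ?thesis by (simp add: eq)
  qed
  then show "\<exists>M. \<forall>m\<ge>M. \<forall>n\<ge>M. L.nm (L.df (smul c (s m)) (smul c (s n))) < e" by blast
qed (auto intro!: tendsto_intros approx_tendsto s)

lemma complex_space_RK: "complex_space RK"
proof (rule complex_space_functions)
  show "zero RK \<in> carrier RK" using approx_kfun[of "[]"] by (auto simp: RK_iff)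
qed (auto simp: RK_iff intro: approx_add approx_smult)

lemma kfun_RK [simp]: "kfun k cs \<in> carrier RK"
  using approx_kfun by (auto simp: RK_iff)

text \<open>
  The reproducing property.
\<close>
lemma rk_inner_kfun:
  assumes "f \<in> carrier RK" shows "rk_inner (kfun k cs) f = ev cs f"
proof -
  obtain s where "approx s f" using assms by (auto simp: RK_iff)
  from rk_inner_tendsto[OF approx_kfun this, of cs] show ?thesis
    by (simp add: LIMSEQ_const_iff)
qed

lemma rk_inner_commute:
  assumes "f \<in> carrier RK" "g \<in> carrier RK" shows "rk_inner f g = cnj (rk_inner g f)"
proof -
  obtain s t where st: "approx s f" "approx t g" using assms by (auto simp: RK_iff)
  show ?thesis
    using LIMSEQ_unique[OF rk_inner_tendsto[OF st]]
      approx_commute[OF st(2,1) rk_inner_tendsto[OF st(2,1)]] by blast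
qed

lemma form_tendsto_rk_inner: "approx s f \<Longrightarrow> (\<lambda>n. form k (s n) (s n)) \<longlonglongrightarrow> rk_inner f f"
  using approx_form_tendsto rk_inner_tendsto by blast

sublocale R: semi_inner "carrier RK" "\<lambda>f g x. f x + g x" "\<lambda>c f x. c * f x" rk_inner
  rewrites "semi_inner.nm rk_inner = hnorm RK"
proof -
  show *: "semi_inner (carrier RK) (\<lambda>f g x. f x + g x) (\<lambda>c f x. c * f x) rk_inner"
  proof
    fix f g h :: "'x \<Rightarrow> complex" and c assume f: "f \<in> carrier RK"
    show "(\<lambda>x. c * f x) \<in> carrier RK" using f by (auto simp: RK_iff intro: approx_smult)
    obtain s where s: "approx s f" using f by (auto simp: RK_iff)
    show "0 \<le> Re (rk_inner f f)"
      using LIMSEQ_le_const[OF tendsto_Re[OF form_tendsto_rk_inner[OF s]]] psd by blast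
    assume g: "g \<in> carrier RK"
    show "(\<lambda>x. f x + g x) \<in> carrier RK" using f g by (auto simp: RK_iff intro: approx_add)
    show "rk_inner f g = cnj (rk_inner g f)" using f g by (rule rk_inner_commute)
    obtain t where t: "approx t g" using g by (auto simp: RK_iff)
    have "(\<lambda>n. ev (s n) (\<lambda>x. c * g x)) \<longlonglongrightarrow> c * rk_inner f g"
      by (simp, intro tendsto_intros rk_inner_tendsto[OF s t])
    then show "rk_inner f (\<lambda>x. c * g x) = c * rk_inner f g"
      using LIMSEQ_unique[OF rk_inner_tendsto[OF s approx_smult[OF t]]] by simp
    assume h: "h \<in> carrier RK"
    obtain u where u: "approx u h" using h by (auto simp: RK_iff)
    have "(\<lambda>n. ev (s n) (\<lambda>x. g x + h x)) \<longlonglongrightarrow> rk_inner f g + rk_inner f h"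
      by (simp, intro tendsto_intros rk_inner_tendsto[OF s t] rk_inner_tendsto[OF s u])
    then show "rk_inner f (\<lambda>x. g x + h x) = rk_inner f g + rk_inner f h"
      using LIMSEQ_unique[OF rk_inner_tendsto[OF s approx_add[OF t u]]] by simp
  qed
  show "semi_inner.nm rk_inner = hnorm RK"
    by (rule ext) (simp add: semi_inner.nm_def[OF *] hnorm_def)
qed

lemma R_df_eq: "\<lbrakk>f \<in> carrier RK; g \<in> carrier RK\<rbrakk> \<Longrightarrow> f \<ominus>\<^bsub>RK\<^esub> g = R.df f g"
  by (simp add: R.df_def complex_space_minus[OF complex_space_RK])

lemma hnorm_kfun_df: "hnorm RK (R.df (kfun k cs) (kfun k ds)) = L.nm (L.df cs ds)"
proof -
  have "R.df (kfun k cs) (kfun k ds) = kfun k (L.df cs ds)" by (simp add: R.df_def)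
  then show ?thesis using rk_inner_kfun[OF kfun_RK, of "L.df cs ds" "L.df cs ds"]
    by (simp add: hnorm_def L.nm_def form_def)
qed

lemma approx_hnorm:
  assumes s: "approx s f" shows "(\<lambda>n. hnorm RK (R.df f (kfun k (s n)))) \<longlonglongrightarrow> 0"
proof -
  have f: "f \<in> carrier RK" using s by (rule RK_I)
  have "rk_inner (R.df f (kfun k (s n))) (R.df f (kfun k (s n)))
      = rk_inner f f - cnj (ev (s n) f) - ev (s n) f + form k (s n) (s n)" for n
    unfolding R.ip_diff[OF R.df_closed[OF f kfun_RK] f kfun_RK] R.ip_diff_left[OF f kfun_RK f]
      R.ip_diff_left[OF f kfun_RK kfun_RK] rk_inner_commute[OF f kfun_RK] rk_inner_kfun[OF f]
      rk_inner_kfun[OF kfun_RK] form_def by simp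
  moreover have "(\<lambda>n. rk_inner f f - cnj (ev (s n) f) - ev (s n) f + form k (s n) (s n))
      \<longlonglongrightarrow> rk_inner f f - cnj (rk_inner f f) - rk_inner f f + rk_inner f f"
    by (intro tendsto_intros tendsto_cnj rk_inner_tendsto[OF s s] form_tendsto_rk_inner[OF s])
  moreover have "rk_inner f f - cnj (rk_inner f f) - rk_inner f f + rk_inner f f = 0"
    using rk_inner_commute[OF f f] by simp
  ultimately have "(\<lambda>n. rk_inner (R.df f (kfun k (s n))) (R.df f (kfun k (s n)))) \<longlonglongrightarrow> 0" by simp
  from tendsto_real_sqrt[OF tendsto_Re[OF this]] show ?thesis by (simp add: hnorm_def)
qed

lemma rk_inner_definite:
  assumes f: "f \<in> carrier RK" and "rk_inner f f = 0" shows "f = (\<lambda>x. 0)"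
proof
  fix x
  have "cmod (f x) = cmod (rk_inner (kfun k [(1, x)]) f)" by (simp add: rk_inner_kfun f del: kfun_simps)
  also have "\<dots> \<le> hnorm RK (kfun k [(1, x)]) * hnorm RK f" using f kfun_RK by (intro R.Cauchy_Schwarz)
  also have "hnorm RK f = 0" using assms by (simp add: hnorm_def)
  finally show "f x = 0" by simp
qed

lemma RK_dense:
  assumes "f \<in> carrier RK" "e > 0" shows "\<exists>cs. hnorm RK (R.df f (kfun k cs)) < e"
proof -
  obtain s where s: "approx s f" using assms by (auto simp: RK_iff)
  obtain n where "norm (hnorm RK (R.df f (kfun k (s n))) - 0) < e"
    using LIMSEQ_D[OF approx_hnorm[OF s] assms(2)] by blast
  then have "hnorm RK (R.df f (kfun k (s n))) < e" by simp
  then show ?thesis by blast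
qed

text \<open>
  Each member of a Cauchy sequence is replaced by a nearby combination of sections. The resulting
  sequence of combinations is Cauchy, converges pointwise since evaluations are bounded, and so
  approximates its pointwise limit.
\<close>
lemma complete_RK: "complete_under RK (hnorm RK)"
  unfolding complete_under_def
proof (intro allI impI)
  fix F :: "nat \<Rightarrow> 'x \<Rightarrow> complex"
  assume "range F \<subseteq> carrier RK"
    and C: "\<forall>e>0. \<exists>M. \<forall>m\<ge>M. \<forall>n\<ge>M. hnorm RK (F m \<ominus>\<^bsub>RK\<^esub> F n) < e"
  then have F: "F n \<in> carrier RK" for n by blast
  have "\<exists>cs. hnorm RK (R.df (F n) (kfun k cs)) < inverse (Suc n)" for n
    using RK_dense[OF F] by simp
  then obtain c where c: "\<And>n. hnorm RK (R.df (F n) (kfun k (c n))) < inverse (Suc n)" by metis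
  have Cauchy: "\<exists>M. \<forall>m\<ge>M. \<forall>n\<ge>M. L.nm (L.df (c m) (c n)) < e" if e: "e > 0" for e
  proof -
    obtain M where M: "\<And>m n. \<lbrakk>m \<ge> M; n \<ge> M\<rbrakk> \<Longrightarrow> hnorm RK (R.df (F m) (F n)) < e / 3"
      using C[rule_format, of "e / 3"] e F by (auto simp: R_df_eq)
    obtain N where N: "inverse (real (Suc N)) < e / 3" using reals_Archimedean[of "e / 3"] e by auto
    have "L.nm (L.df (c m) (c n)) < e" if mn: "m \<ge> max M N" "n \<ge> max M N" for m n
    proof -
      have small: "hnorm RK (R.df (F j) (kfun k (c j))) < e / 3" if "j \<ge> max M N" for j
      proof -
        have "inverse (real (Suc j)) \<le> inverse (real (Suc N))" using that by (auto intro!: le_imp_inverse_le)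
        then show ?thesis using c[of j] N by linarith
      qed
      have "L.nm (L.df (c m) (c n)) \<le> hnorm RK (R.df (kfun k (c m)) (F m)) + hnorm RK (R.df (F m) (kfun k (c n)))"
        using R.nm_diff_triangle[OF kfun_RK F kfun_RK] by (simp flip: hnorm_kfun_df)
      moreover have "hnorm RK (R.df (F m) (kfun k (c n))) \<le> hnorm RK (R.df (F m) (F n)) + hnorm RK (R.df (F n) (kfun k (c n)))"
        using R.nm_diff_triangle[OF F F kfun_RK] by simp
      moreover have "hnorm RK (R.df (kfun k (c m)) (F m)) = hnorm RK (R.df (F m) (kfun k (c m)))"
        by (rule R.nm_diff_commute) (use F in auto)
      ultimately show ?thesis using small[of m] small[of n] M[of m n] mn by simp
    qed
    then show ?thesis by blast
  qed
  have "convergent (\<lambda>n. kfun k (c n) x)" for x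
  proof (rule Cauchy_convergent, rule CauchyI)
    fix e :: real assume e: "e > 0"
    let ?B = "L.nm [(1, x)]"
    have B: "?B + 1 > 0" using L.nm_nonneg[of "[(1, x)]"] by simp
    obtain M where M: "\<And>m n. \<lbrakk>m \<ge> M; n \<ge> M\<rbrakk> \<Longrightarrow> L.nm (L.df (c m) (c n)) < e / (?B + 1)"
      using Cauchy[of "e / (?B + 1)"] e B by auto
    have "norm (kfun k (c m) x - kfun k (c n) x) < e" if mn: "m \<ge> M" "n \<ge> M" for m n
    proof -
      have "norm (kfun k (c m) x - kfun k (c n) x) \<le> ?B * L.nm (L.df (c m) (c n))"
        using L.Cauchy_Schwarz[of "[(1, x)]" "L.df (c m) (c n)"] by (simp add: form_def)
      also have "\<dots> \<le> (?B + 1) * L.nm (L.df (c m) (c n))"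
        using L.nm_nonneg[of "L.df (c m) (c n)"] by (intro mult_right_mono) auto
      also have "\<dots> < e" using M[OF mn] B by (simp add: field_simps)
      finally show ?thesis .
    qed
    then show "\<exists>M. \<forall>m\<ge>M. \<forall>n\<ge>M. norm (kfun k (c m) x - kfun k (c n) x) < e" by blast
  qed
  then obtain f where "\<And>x. (\<lambda>n. kfun k (c n) x) \<longlonglongrightarrow> f x" unfolding convergent_def by metis
  then have f: "approx c f" using Cauchy by (simp add: approx_def)
  then have fR: "f \<in> carrier RK" by (rule RK_I)
  have lim: "(\<lambda>n. inverse (real (Suc n)) + hnorm RK (R.df f (kfun k (c n)))) \<longlonglongrightarrow> 0 + 0"
    by (intro tendsto_intros LIMSEQ_inverse_real_of_nat approx_hnorm[OF f])
  have "(\<lambda>n. hnorm RK (R.df (F n) f)) \<longlonglongrightarrow> 0"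
  proof (rule null_comparison)
    show "norm (hnorm RK (R.df (F n) f)) \<le> inverse (real (Suc n)) + hnorm RK (R.df f (kfun k (c n)))" for n
      using R.nm_diff_triangle[OF F kfun_RK fR, of n "c n"] R.nm_diff_commute[OF fR kfun_RK, of "c n"]
        c[of n] R.nm_nonneg[OF R.df_closed[OF F fR], of n] by simp
  qed (use lim in simp)
  then show "\<exists>f\<in>carrier RK. (\<lambda>n. hnorm RK (F n \<ominus>\<^bsub>RK\<^esub> f)) \<longlonglongrightarrow> 0"
    using fR F by (auto simp: R_df_eq)
qed

lemma hilbert_space_RK: "hilbert_space RK"
proof (rule hilbert_space.intro, unfold RK_simps)
  show "rk_inner f g = cnj (rk_inner g f)" if "f \<in> carrier RK" "g \<in> carrier RK" for f g
    using that by (rule rk_inner_commute)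
qed (fact complex_space_RK complete_RK R.ip_add R.ip_smult R.ip_nonneg rk_inner_definite)+

end

text \<open>
  The linear combination in \<open>V\<close> of the vectors \<open>v x\<close> described by a formal combination.
\<close>
definition comb :: "(complex, 'v, 'm) module_scheme \<Rightarrow> ('x \<Rightarrow> 'v) \<Rightarrow> (complex \<times> 'x) list \<Rightarrow> 'v" where
  "comb V v cs = foldr (\<lambda>(c, x) w. c \<odot>\<^bsub>V\<^esub> v x \<oplus>\<^bsub>V\<^esub> w) cs \<zero>\<^bsub>V\<^esub>"

lemma comb_simps [simp]:
  "comb V v [] = \<zero>\<^bsub>V\<^esub>"
  "comb V v ((c, x) # cs) = c \<odot>\<^bsub>V\<^esub> v x \<oplus>\<^bsub>V\<^esub> comb V v cs"
  by (simp_all add: comb_def)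

text \<open>
  A family of vectors, indexed by \<open>X\<close>, whose linear span is dense.
\<close>
definition spanning :: "'v inner_space \<Rightarrow> 'x set \<Rightarrow> ('x \<Rightarrow> 'v) \<Rightarrow> bool" where
  "spanning K X \<kappa> \<longleftrightarrow> (\<forall>x\<in>X. \<kappa> x \<in> carrier K) \<and>
    (\<forall>f\<in>carrier K. \<forall>e>0. \<exists>cs. snd ` set cs \<subseteq> X \<and> hnorm K (f \<ominus>\<^bsub>K\<^esub> comb K \<kappa> cs) < e)"

lemma form_cong:
  assumes "\<And>x y. \<lbrakk>x \<in> snd ` set cs; y \<in> snd ` set ds\<rbrakk> \<Longrightarrow> k x y = k' x y"
  shows "form k cs ds = form k' cs ds"
proof -
  have "kfun k ds x = kfun k' ds x" if "x \<in> snd ` set cs" for x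
    unfolding kfun_def using assms[OF that] by (intro arg_cong[of _ _ sum_list] map_cong) force+
  then show ?thesis unfolding form_def ev_def by (intro arg_cong[of _ _ sum_list] map_cong) force+
qed

lemma form_map: "form k (map (map_prod id r) cs) (map (map_prod id q) ds) = form (\<lambda>x y. k (r x) (q y)) cs ds"
  by (simp add: form_def ev_def kfun_def case_prod_unfold comp_def)

text \<open>
  A kernel whose form is real on the diagonal is Hermitian: test on the combinations of \<open>x\<close> and \<open>y\<close> with
  coefficients \<open>1, 1\<close> and \<open>1, \<i>\<close>.
\<close>
lemma real_form_hermitian:
  assumes real: "\<And>cs. snd ` set cs \<subseteq> X \<Longrightarrow> form k cs cs \<in> \<real>" and x: "x \<in> X" and y: "y \<in> X"
  shows "k x y = cnj (k y x)"
proof -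
  have Im0: "Im (form k cs cs) = 0" if "snd ` set cs \<subseteq> X" for cs
    using real[OF that] by (simp add: complex_is_Real_iff)
  have xx: "Im (k x x) = 0" and yy: "Im (k y y) = 0"
    using Im0[of "[(1, x)]"] Im0[of "[(1, y)]"] x y by (simp_all add: form_def)
  have "Im (k x y) + Im (k y x) = 0" and "Re (k x y) - Re (k y x) = 0"
    using Im0[of "[(1, x), (1, y)]"] Im0[of "[(1, x), (\<i>, y)]"] x y xx yy
    by (simp_all add: form_def algebra_simps)
  then show ?thesis by (simp add: complex_eq_iff)
qed

text \<open>
  The sections over the points of \<open>X\<close> span a dense subspace of the Hilbert space of the kernel.
\<close>
theorem Moore_Aronszajn:
  fixes X :: "'x set"
  assumes "X \<noteq> {}"
    and psd: "\<And>cs. snd ` set cs \<subseteq> X \<Longrightarrow> form k cs cs \<in> \<real> \<and> 0 \<le> Re (form k cs cs)"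
  shows "\<exists>(K :: ('x \<Rightarrow> complex) inner_space) \<kappa>. hilbert_space K \<and> spanning K X \<kappa> \<and>
    (\<forall>x\<in>X. \<forall>y\<in>X. cinner K (\<kappa> x) (\<kappa> y) = k x y)"
proof -
  obtain x0 where x0: "x0 \<in> X" using assms(1) by blast
  \<comment> \<open>extend the kernel to the whole type along a retraction onto \<open>X\<close>; no new sections arise\<close>
  define r where "r = (\<lambda>x. if x \<in> X then x else x0)"
  define k' where "k' = (\<lambda>x y. k (r x) (r y))"
  have r: "r x \<in> X" and r_idem: "r (r x) = r x" for x using x0 by (simp_all add: r_def)
  interpret psd_kernel k'
  proof
    show "k' x y = cnj (k' y x)" for x y
      unfolding k'_def using psd r by (intro real_form_hermitian) auto
    show "0 \<le> Re (form k' cs cs)" for cs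
      using psd[of "map (map_prod id r) cs"] r unfolding k'_def form_map[symmetric] by (force simp: image_image)
  qed
  define \<kappa> where "\<kappa> = (\<lambda>x. kfun k' [(1, x)])"
  have comb: "comb RK \<kappa> cs = kfun k' cs" for cs
    by (induction cs) (auto simp: \<kappa>_def)
  have "spanning RK X \<kappa>"
    unfolding spanning_def
  proof (intro conjI ballI allI impI)
    fix f and e :: real assume f: "f \<in> carrier RK" and e: "e > 0"
    obtain cs where cs: "hnorm RK (R.df f (kfun k' cs)) < e" using RK_dense[OF f e] by blast
    have "kfun k' (map (map_prod id r) cs) = kfun k' cs"
      by (simp add: kfun_def case_prod_unfold comp_def k'_def r_idem)
    then have "hnorm RK (f \<ominus>\<^bsub>RK\<^esub> comb RK \<kappa> (map (map_prod id r) cs)) < e"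
      using cs f by (simp add: comb R_df_eq)
    then show "\<exists>cs. snd ` set cs \<subseteq> X \<and> hnorm RK (f \<ominus>\<^bsub>RK\<^esub> comb RK \<kappa> cs) < e"
      using r by (intro exI[of _ "map (map_prod id r) cs"]) auto
  qed (simp add: \<kappa>_def del: kfun_simps)
  moreover have "cinner RK (\<kappa> x) (\<kappa> y) = k x y" if "x \<in> X" "y \<in> X" for x y
    unfolding RK_simps using rk_inner_kfun[OF kfun_RK, of "[(1, x)]" "[(1, y)]"] that
    by (simp add: \<kappa>_def k'_def r_def)
  ultimately show ?thesis using hilbert_space_RK by blast
qed

section \<open>Families with dense span and the operators they determine\<close>

context hilbert_space
begin

lemma hnorm_diff_commute: "\<lbrakk>x \<in> carrier H; y \<in> carrier H\<rbrakk> \<Longrightarrow> hnorm H (x \<ominus> y) = hnorm H (y \<ominus> x)"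
  using nm_diff_commute by (simp add: df_eq)

lemma hnorm_diff_triangle:
  "\<lbrakk>x \<in> carrier H; y \<in> carrier H; z \<in> carrier H\<rbrakk> \<Longrightarrow> hnorm H (x \<ominus> z) \<le> hnorm H (x \<ominus> y) + hnorm H (y \<ominus> z)"
  using nm_diff_triangle by (simp add: df_eq)

lemma diff_zero [simp]: "x \<in> carrier H \<Longrightarrow> x \<ominus> \<zero> = x"
  by (rule cinner_eqI) (simp_all add: cinner_diff)

lemma one_smult [simp]: "x \<in> carrier H \<Longrightarrow> 1 \<odot> x = x"
  using smult_one[of x] by simp

lemma eqI_hnorm:
  assumes "x \<in> carrier H" "y \<in> carrier H" and le: "\<And>e. e > 0 \<Longrightarrow> hnorm H (x \<ominus> y) \<le> e" shows "x = y"
proof (rule hnorm_diff_eq_0)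
  have "hnorm H (x \<ominus> y) \<le> 0" by (rule field_le_epsilon) (use le in simp)
  then show "hnorm H (x \<ominus> y) = 0" using hnorm_nonneg[OF M.minus_closed[OF assms(1,2)]] by linarith
qed (use assms in auto)

lemma cinner_eqI_left:
  assumes "x \<in> carrier H" "y \<in> carrier H" "\<And>z. z \<in> carrier H \<Longrightarrow> cinner H x z = cinner H y z"
  shows "x = y"
proof (rule cinner_eqI)
  fix z assume "z \<in> carrier H"
  then show "cinner H z x = cinner H z y" using assms cinner_commute[of z x] cinner_commute[of z y] by simp
qed (use assms in auto)

lemma comb_closed [simp]:
  "(\<And>x. x \<in> snd ` set cs \<Longrightarrow> v x \<in> carrier H) \<Longrightarrow> comb H v cs \<in> carrier H"
  by (induction cs) auto

lemma cinner_comb: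
  assumes "\<And>y. y \<in> snd ` set ds \<Longrightarrow> v y \<in> carrier H" and "u x \<in> carrier H"
  shows "cinner H (u x) (comb H v ds) = kfun (\<lambda>x y. cinner H (u x) (v y)) ds x"
  using assms(1)
proof (induction ds)
  case (Cons p ds)
  moreover have "comb H v ds \<in> carrier H" using Cons by (intro comb_closed) auto
  ultimately show ?case using assms(2) by (cases p) (auto simp: cinner_add cinner_smult)
qed (use assms(2) in simp)

lemma cinner_comb_comb:
  assumes "\<And>x. x \<in> snd ` set cs \<Longrightarrow> u x \<in> carrier H" and v: "\<And>y. y \<in> snd ` set ds \<Longrightarrow> v y \<in> carrier H"
  shows "cinner H (comb H u cs) (comb H v ds) = form (\<lambda>x y. cinner H (u x) (v y)) cs ds"
  using assms(1)
proof (induction cs)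
  case Nil
  then show ?case using v by (simp add: form_simps)
next
  case (Cons p cs)
  obtain c x where p: "p = (c, x)" by (cases p)
  have ux: "u x \<in> carrier H" and cl: "comb H u cs \<in> carrier H"
    using Cons by (auto simp: p intro!: comb_closed)
  have cld: "comb H v ds \<in> carrier H" using v by (intro comb_closed) auto
  have IH: "cinner H (comb H u cs) (comb H v ds) = form (\<lambda>x y. cinner H (u x) (v y)) cs ds"
    using Cons by (simp add: p)
  show ?case
    using ux cl cld cinner_comb[where u = u and x = x and v = v and ds = ds, OF v ux] IH by (simp add: p ip_add_left ip_smult_left form_def)
qed

lemma comb_append:
  assumes "\<And>x. x \<in> snd ` set (cs @ ds) \<Longrightarrow> v x \<in> carrier H"
  shows "comb H v (cs @ ds) = comb H v cs \<oplus> comb H v ds"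
  using assms
proof (induction cs)
  case (Cons p cs)
  obtain c x where p: "p = (c, x)" by (cases p)
  have "v x \<in> carrier H" "comb H v cs \<in> carrier H" "comb H v ds \<in> carrier H"
    using Cons.prems by (auto simp: p intro!: comb_closed)
  moreover have "comb H v (cs @ ds) = comb H v cs \<oplus> comb H v ds" using Cons by auto
  ultimately show ?case by (simp add: p M.a_assoc)
qed simp

lemma comb_smul:
  assumes "\<And>x. x \<in> snd ` set cs \<Longrightarrow> v x \<in> carrier H"
  shows "comb H v (smul c cs) = c \<odot> comb H v cs"
  using assms
proof (induction cs)
  case Nil
  then show ?case by (simp add: smul_def)
next
  case (Cons p cs)
  obtain d x where p: "p = (d, x)" by (cases p)
  have "v x \<in> carrier H" "comb H v cs \<in> carrier H"
    using Cons.prems by (auto simp: p intro!: comb_closed)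
  moreover have "comb H v (smul c cs) = c \<odot> comb H v cs" using Cons by auto
  ultimately show ?case using smult_assoc1[of c d "v x"] by (simp add: p smul_def smult_r_distr)
qed

lemma snd_smul [simp]: "snd ` set (smul c cs) = snd ` set cs"
  by (force simp: smul_def)

lemma comb_diff:
  assumes "\<And>x. x \<in> snd ` set (cs @ ds) \<Longrightarrow> v x \<in> carrier H"
  shows "comb H v (cs @ smul (- 1) ds) = comb H v cs \<ominus> comb H v ds"
proof -
  have "comb H v (cs @ smul (- 1) ds) = comb H v cs \<oplus> comb H v (smul (- 1) ds)"
    using assms by (intro comb_append) (simp add: image_Un)
  also have "\<dots> = comb H v cs \<oplus> (- 1) \<odot> comb H v ds"
    using assms by (subst comb_smul) (auto simp: image_Un)
  also have "\<dots> = comb H v cs \<ominus> comb H v ds"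
    using assms by (intro complex_space_minus[symmetric] complex_space comb_closed) auto
  finally show ?thesis .
qed

end

lemma spanning_closed: "\<lbrakk>spanning K X \<kappa>; x \<in> X\<rbrakk> \<Longrightarrow> \<kappa> x \<in> carrier K"
  by (simp add: spanning_def)

lemma spanning_approx:
  "\<lbrakk>spanning K X \<kappa>; f \<in> carrier K; e > 0\<rbrakk> \<Longrightarrow> \<exists>cs. snd ` set cs \<subseteq> X \<and> hnorm K (f \<ominus>\<^bsub>K\<^esub> comb K \<kappa> cs) < e"
  by (simp add: spanning_def)

lemma spanning_eqI:
  assumes "hilbert_space K" and span: "spanning K X \<kappa>"
    and u: "u \<in> carrier K" and w: "w \<in> carrier K"
    and eq: "\<And>x. x \<in> X \<Longrightarrow> cinner K (\<kappa> x) u = cinner K (\<kappa> x) w"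
  shows "u = w"
proof -
  interpret K: hilbert_space K by fact
  let ?d = "u \<ominus>\<^bsub>K\<^esub> w"
  have d: "?d \<in> carrier K" using u w by simp
  have orth: "cinner K (comb K \<kappa> cs) ?d = 0" if "snd ` set cs \<subseteq> X" for cs
    using that
  proof (induction cs)
    case (Cons p cs)
    obtain c x where p: "p = (c, x)" by (cases p)
    have "\<kappa> x \<in> carrier K" "comb K \<kappa> cs \<in> carrier K" "cinner K (\<kappa> x) ?d = 0"
      using Cons.prems spanning_closed[OF span] eq[of x] u w
      by (auto simp: p K.cinner_diff intro!: K.comb_closed)
    then show ?case using Cons d by (simp add: p K.ip_add_left K.ip_smult_left)
  qed (use d in simp)
  have "hnorm K ?d = 0"
  proof (rule ccontr)
    assume "hnorm K ?d \<noteq> 0"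
    then have pos: "0 < hnorm K ?d" using K.hnorm_nonneg[OF d] by linarith
    obtain cs where cs: "snd ` set cs \<subseteq> X" "hnorm K (?d \<ominus>\<^bsub>K\<^esub> comb K \<kappa> cs) < hnorm K ?d"
      using spanning_approx[OF span d pos] by blast
    have cl: "comb K \<kappa> cs \<in> carrier K"
      using cs(1) spanning_closed[OF span] by (intro K.comb_closed) auto
    have "cinner K (?d \<ominus>\<^bsub>K\<^esub> comb K \<kappa> cs) ?d = of_real ((hnorm K ?d)\<^sup>2)"
      using K.ip_diff_left[OF d cl d] orth[OF cs(1)] by (simp add: K.df_eq d cl K.ip_self)
    then have "(hnorm K ?d)\<^sup>2 \<le> hnorm K (?d \<ominus>\<^bsub>K\<^esub> comb K \<kappa> cs) * hnorm K ?d"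
      using K.Cauchy_Schwarz[OF K.M.minus_closed[OF d cl] d] by (simp add: norm_power)
    also have "\<dots> < hnorm K ?d * hnorm K ?d" using cs(2) pos by (rule mult_strict_right_mono)
    finally show False by (simp add: power2_eq_square)
  qed
  then show ?thesis by (rule K.hnorm_diff_eq_0[OF u w])
qed

lemma spanning_op_eqI:
  assumes "hilbert_space K" "hilbert_space L" and span: "spanning K X \<kappa>"
    and S: "S \<in> bounded_ops K L" and T: "T \<in> bounded_ops K L"
    and eq: "\<And>x. x \<in> X \<Longrightarrow> S (\<kappa> x) = T (\<kappa> x)"
  shows "S = T"
proof (rule bounded_ops_eqI[OF S T])
  interpret L: hilbert_space L by fact
  fix f assume f: "f \<in> carrier K"
  show "S f = T f"
  proof (rule L.cinner_eqI_left)
    fix z assume z: "z \<in> carrier L"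
    have "adj K L S z = adj K L T z"
    proof (rule spanning_eqI[OF assms(1) span])
      show "adj K L S z \<in> carrier K" "adj K L T z \<in> carrier K"
        using adj_bounded[OF assms(1,2)] S T z by (blast intro: bounded_ops_closed)+
      show "cinner K (\<kappa> x) (adj K L S z) = cinner K (\<kappa> x) (adj K L T z)" if "x \<in> X" for x
        using cinner_adj[OF assms(1,2) S spanning_closed[OF span that] z]
          cinner_adj[OF assms(1,2) T spanning_closed[OF span that] z] eq[OF that] by simp
    qed
    then show "cinner L (S f) z = cinner L (T f) z"
      using cinner_adj[OF assms(1,2) S f z] cinner_adj[OF assms(1,2) T f z] by simp
  qed (use f S T in \<open>auto intro: bounded_ops_closed\<close>)
qed

text \<open>
  Bounded operators are determined by their matrix entries with respect to families with dense span.
\<close>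
lemma spanning_weak_eqI:
  assumes "hilbert_space K" "hilbert_space L" and \<kappa>: "spanning K X \<kappa>" and \<mu>: "spanning L Y \<mu>"
    and S: "S \<in> bounded_ops K L" and T: "T \<in> bounded_ops K L"
    and eq: "\<And>x y. \<lbrakk>x \<in> X; y \<in> Y\<rbrakk> \<Longrightarrow> cinner L (\<mu> y) (S (\<kappa> x)) = cinner L (\<mu> y) (T (\<kappa> x))"
  shows "S = T"
proof (rule spanning_op_eqI[OF assms(1,2) \<kappa> S T])
  fix x assume "x \<in> X"
  then show "S (\<kappa> x) = T (\<kappa> x)"
    by (intro spanning_eqI[OF assms(2) \<mu>] bounded_ops_closed[OF S] bounded_ops_closed[OF T]
        spanning_closed[OF \<kappa>] eq)
qed

text \<open>
  A map defined on a family with dense span extends to a bounded operator as soon as the estimate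
  holds on all linear combinations. The value at \<open>f\<close> is characterized by the inequalities
  \<open>\<parallel>T f - comb L v cs\<parallel> \<le> C \<parallel>f - comb K \<kappa> cs\<parallel>\<close> for all \<open>cs\<close>, from which linearity is derived.
\<close>
theorem extend_operator:
  assumes "hilbert_space K" "hilbert_space L" and span: "spanning K X \<kappa>"
    and v: "\<And>x. x \<in> X \<Longrightarrow> v x \<in> carrier L" and C: "0 \<le> C"
    and bound: "\<And>cs. snd ` set cs \<subseteq> X \<Longrightarrow> hnorm L (comb L v cs) \<le> C * hnorm K (comb K \<kappa> cs)"
  shows "\<exists>T\<in>bounded_ops K L. \<forall>x\<in>X. T (\<kappa> x) = v x"
proof -
  interpret K: hilbert_space K by fact
  interpret L: hilbert_space L by fact
  note \<kappa> = spanning_closed[OF span]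
  define P where "P = {cs :: (complex \<times> 'c) list. snd ` set cs \<subseteq> X}"
  have inP: "x \<in> X" if "cs \<in> P" "(a, x) \<in> set cs" for x a cs using that by (auto simp: P_def)
  have cl: "comb K \<kappa> cs \<in> carrier K" "comb L v cs \<in> carrier L" if "cs \<in> P" for cs
    using that \<kappa> v by (auto simp: P_def intro!: K.comb_closed L.comb_closed)
  have P_op: "cs @ ds \<in> P" "smul c cs \<in> P" if "cs \<in> P" "ds \<in> P" for cs ds c
    using that by (auto simp: P_def K.snd_smul)
  have app: "comb K \<kappa> (cs @ ds) = comb K \<kappa> cs \<oplus>\<^bsub>K\<^esub> comb K \<kappa> ds"
    "comb L v (cs @ ds) = comb L v cs \<oplus>\<^bsub>L\<^esub> comb L v ds" if "cs \<in> P" "ds \<in> P" for cs ds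
    using that by (auto intro!: K.comb_append L.comb_append \<kappa> v intro: inP)
  have sm: "comb K \<kappa> (smul c cs) = c \<odot>\<^bsub>K\<^esub> comb K \<kappa> cs"
    "comb L v (smul c cs) = c \<odot>\<^bsub>L\<^esub> comb L v cs" if "cs \<in> P" for cs c
    using that by (auto intro!: K.comb_smul L.comb_smul \<kappa> v intro: inP)
  have bound_diff: "hnorm L (comb L v cs \<ominus>\<^bsub>L\<^esub> comb L v ds) \<le> C * hnorm K (comb K \<kappa> cs \<ominus>\<^bsub>K\<^esub> comb K \<kappa> ds)"
    if "cs \<in> P" "ds \<in> P" for cs ds
  proof -
    have *: "snd ` set (cs @ smul (- 1) ds) \<subseteq> X" "snd ` set (cs @ ds) \<subseteq> X"
      using that P_op by (auto simp: P_def image_Un K.snd_smul)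
    show ?thesis
      using bound[OF *(1)] K.comb_diff[of cs ds \<kappa>] L.comb_diff[of cs ds v] *(2) \<kappa> v by (auto simp: subset_iff)
  qed
  have near: "\<exists>cs\<in>P. hnorm K (f \<ominus>\<^bsub>K\<^esub> comb K \<kappa> cs) < e" if "f \<in> carrier K" "e > 0" for f e
    using spanning_approx[OF span that] by (auto simp: P_def)
  have "\<exists>w\<in>carrier L. \<forall>cs\<in>P. hnorm L (w \<ominus>\<^bsub>L\<^esub> comb L v cs) \<le> C * hnorm K (f \<ominus>\<^bsub>K\<^esub> comb K \<kappa> cs)"
    if f: "f \<in> carrier K" for f
  proof -
    have "\<exists>cs\<in>P. hnorm K (f \<ominus>\<^bsub>K\<^esub> comb K \<kappa> cs) < inverse (Suc n)" for n
      using near[OF f] by simp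
    then obtain c where c: "\<And>n. c n \<in> P" "\<And>n. hnorm K (f \<ominus>\<^bsub>K\<^esub> comb K \<kappa> (c n)) < inverse (Suc n)"
      by metis
    have two: "hnorm L (comb L v (c n) \<ominus>\<^bsub>L\<^esub> comb L v cs)
        \<le> C * (hnorm K (f \<ominus>\<^bsub>K\<^esub> comb K \<kappa> (c n)) + hnorm K (f \<ominus>\<^bsub>K\<^esub> comb K \<kappa> cs))" if cs: "cs \<in> P" for n cs
    proof -
      have "hnorm K (comb K \<kappa> (c n) \<ominus>\<^bsub>K\<^esub> comb K \<kappa> cs)
          \<le> hnorm K (f \<ominus>\<^bsub>K\<^esub> comb K \<kappa> (c n)) + hnorm K (f \<ominus>\<^bsub>K\<^esub> comb K \<kappa> cs)"
        using K.hnorm_diff_triangle[OF cl(1)[OF c(1)] f cl(1)[OF cs], of n]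
          K.hnorm_diff_commute[OF cl(1)[OF c(1)] f, of n] by simp
      from mult_left_mono[OF this C] show ?thesis using bound_diff[OF c(1) cs, of n] by simp
    qed
    have Cauchy: "\<exists>M. \<forall>m\<ge>M. \<forall>n\<ge>M. hnorm L (comb L v (c m) \<ominus>\<^bsub>L\<^esub> comb L v (c n)) < e" if e: "e > 0" for e
    proof -
      obtain M where M: "inverse (real (Suc M)) < e / (2 * C + 1)"
        using reals_Archimedean[of "e / (2 * C + 1)"] e C by auto
      have "hnorm L (comb L v (c m) \<ominus>\<^bsub>L\<^esub> comb L v (c n)) < e" if "m \<ge> M" "n \<ge> M" for m n
      proof -
        have le: "inverse (real (Suc j)) \<le> inverse (real (Suc M))" if "j \<ge> M" for j
          using that by (auto intro!: le_imp_inverse_le)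
        have "hnorm K (f \<ominus>\<^bsub>K\<^esub> comb K \<kappa> (c m)) + hnorm K (f \<ominus>\<^bsub>K\<^esub> comb K \<kappa> (c n)) \<le> 2 * inverse (real (Suc M))"
          using c(2)[of m] c(2)[of n] le[of m] le[of n] that by linarith
        from mult_left_mono[OF this C]
        have "hnorm L (comb L v (c m) \<ominus>\<^bsub>L\<^esub> comb L v (c n)) \<le> C * (2 * inverse (real (Suc M)))"
          using two[OF c(1), of m n] by simp
        also have "\<dots> \<le> (2 * C + 1) * inverse (real (Suc M))" by (simp add: algebra_simps)
        also have "\<dots> < e" using M C by (simp add: pos_less_divide_eq mult.commute)
        finally show ?thesis .
      qed
      then show ?thesis by blast
    qed
    obtain w where w: "w \<in> carrier L" "(\<lambda>n. hnorm L (comb L v (c n) \<ominus>\<^bsub>L\<^esub> w)) \<longlonglongrightarrow> 0"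
      using complete_underD[OF L.complete cl(2)[OF c(1)] Cauchy] by blast
    have lim0: "(\<lambda>n. hnorm K (f \<ominus>\<^bsub>K\<^esub> comb K \<kappa> (c n))) \<longlonglongrightarrow> 0"
      by (rule null_comparison[OF _ LIMSEQ_inverse_real_of_nat])
        (use c cl f in \<open>simp add: less_imp_le\<close>)
    have "hnorm L (w \<ominus>\<^bsub>L\<^esub> comb L v cs) \<le> C * hnorm K (f \<ominus>\<^bsub>K\<^esub> comb K \<kappa> cs)" if cs: "cs \<in> P" for cs
    proof (rule LIMSEQ_le_const)
      show "(\<lambda>n. hnorm L (comb L v (c n) \<ominus>\<^bsub>L\<^esub> w)
          + C * (hnorm K (f \<ominus>\<^bsub>K\<^esub> comb K \<kappa> (c n)) + hnorm K (f \<ominus>\<^bsub>K\<^esub> comb K \<kappa> cs)))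
          \<longlonglongrightarrow> C * hnorm K (f \<ominus>\<^bsub>K\<^esub> comb K \<kappa> cs)"
        using tendsto_add[OF w(2) tendsto_mult[OF tendsto_const[of C] tendsto_add[OF lim0 tendsto_const]]] by simp
      show "\<exists>N. \<forall>n\<ge>N. hnorm L (w \<ominus>\<^bsub>L\<^esub> comb L v cs) \<le> hnorm L (comb L v (c n) \<ominus>\<^bsub>L\<^esub> w)
          + C * (hnorm K (f \<ominus>\<^bsub>K\<^esub> comb K \<kappa> (c n)) + hnorm K (f \<ominus>\<^bsub>K\<^esub> comb K \<kappa> cs))"
      proof (intro exI allI impI)
        fix n
        show "hnorm L (w \<ominus>\<^bsub>L\<^esub> comb L v cs) \<le> hnorm L (comb L v (c n) \<ominus>\<^bsub>L\<^esub> w)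
          + C * (hnorm K (f \<ominus>\<^bsub>K\<^esub> comb K \<kappa> (c n)) + hnorm K (f \<ominus>\<^bsub>K\<^esub> comb K \<kappa> cs))"
          using L.hnorm_diff_triangle[OF w(1) cl(2)[OF c(1)] cl(2)[OF cs], of n]
            L.hnorm_diff_commute[OF w(1) cl(2)[OF c(1)], of n] two[OF cs, of n] by linarith
      qed
    qed
    then show ?thesis using w(1) by blast
  qed
  then obtain T where T: "\<And>f. f \<in> carrier K \<Longrightarrow> T f \<in> carrier L"
    and T_le: "\<And>f cs. \<lbrakk>f \<in> carrier K; cs \<in> P\<rbrakk> \<Longrightarrow> hnorm L (T f \<ominus>\<^bsub>L\<^esub> comb L v cs) \<le> C * hnorm K (f \<ominus>\<^bsub>K\<^esub> comb K \<kappa> cs)"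
    by metis
  have T_le': "hnorm L (comb L v cs \<ominus>\<^bsub>L\<^esub> T f) \<le> C * hnorm K (f \<ominus>\<^bsub>K\<^esub> comb K \<kappa> cs)" if "f \<in> carrier K" "cs \<in> P" for f cs
    using T_le[OF that] L.hnorm_diff_commute[OF T cl(2)] that by simp
  have "(\<lambda>f\<in>carrier K. T f) \<in> bounded_ops K L"
  proof (rule restrict_bounded_opsI)
    fix f g assume fg: "f \<in> carrier K" "g \<in> carrier K"
    show "T (f \<oplus>\<^bsub>K\<^esub> g) = T f \<oplus>\<^bsub>L\<^esub> T g"
    proof (rule L.eqI_hnorm)
      fix e :: real assume e: "e > 0"
      define \<delta> where "\<delta> = e / (4 * (C + 1))"
      have \<delta>: "\<delta> > 0" using e C by (simp add: \<delta>_def)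
      obtain cs ds where cs: "cs \<in> P" "hnorm K (f \<ominus>\<^bsub>K\<^esub> comb K \<kappa> cs) < \<delta>"
        and ds: "ds \<in> P" "hnorm K (g \<ominus>\<^bsub>K\<^esub> comb K \<kappa> ds) < \<delta>"
        using near[OF fg(1) \<delta>] near[OF fg(2) \<delta>] by blast
      have "(f \<oplus>\<^bsub>K\<^esub> g) \<ominus>\<^bsub>K\<^esub> comb K \<kappa> (cs @ ds) = (f \<ominus>\<^bsub>K\<^esub> comb K \<kappa> cs) \<oplus>\<^bsub>K\<^esub> (g \<ominus>\<^bsub>K\<^esub> comb K \<kappa> ds)"
        unfolding app[OF cs(1) ds(1)]
        using fg cl cs ds by (intro K.cinner_eqI) (simp_all add: K.cinner_add K.cinner_diff)
      then have 1: "hnorm K ((f \<oplus>\<^bsub>K\<^esub> g) \<ominus>\<^bsub>K\<^esub> comb K \<kappa> (cs @ ds)) \<le> 2 * \<delta>"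
        using K.nm_triangle[of "f \<ominus>\<^bsub>K\<^esub> comb K \<kappa> cs" "g \<ominus>\<^bsub>K\<^esub> comb K \<kappa> ds"] fg cl cs ds by simp
      have "comb L v (cs @ ds) \<ominus>\<^bsub>L\<^esub> (T f \<oplus>\<^bsub>L\<^esub> T g) = (comb L v cs \<ominus>\<^bsub>L\<^esub> T f) \<oplus>\<^bsub>L\<^esub> (comb L v ds \<ominus>\<^bsub>L\<^esub> T g)"
        unfolding app[OF cs(1) ds(1)]
        using fg T cl cs ds by (intro L.cinner_eqI) (simp_all add: L.cinner_add L.cinner_diff)
      then have "hnorm L (comb L v (cs @ ds) \<ominus>\<^bsub>L\<^esub> (T f \<oplus>\<^bsub>L\<^esub> T g))
          \<le> C * hnorm K (f \<ominus>\<^bsub>K\<^esub> comb K \<kappa> cs) + C * hnorm K (g \<ominus>\<^bsub>K\<^esub> comb K \<kappa> ds)"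
        using L.nm_triangle[of "comb L v cs \<ominus>\<^bsub>L\<^esub> T f" "comb L v ds \<ominus>\<^bsub>L\<^esub> T g"] fg T cl cs ds
          T_le'[OF fg(1) cs(1)] T_le'[OF fg(2) ds(1)] by simp
      also have "\<dots> \<le> C * \<delta> + C * \<delta>" using cs ds C by (intro add_mono mult_left_mono) auto
      finally have 2: "hnorm L (comb L v (cs @ ds) \<ominus>\<^bsub>L\<^esub> (T f \<oplus>\<^bsub>L\<^esub> T g)) \<le> 2 * (C * \<delta>)" by simp
      have "hnorm L (T (f \<oplus>\<^bsub>K\<^esub> g) \<ominus>\<^bsub>L\<^esub> (T f \<oplus>\<^bsub>L\<^esub> T g)) \<le> C * (2 * \<delta>) + 2 * (C * \<delta>)"
        using L.hnorm_diff_triangle[of "T (f \<oplus>\<^bsub>K\<^esub> g)" "comb L v (cs @ ds)" "T f \<oplus>\<^bsub>L\<^esub> T g"]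
          fg T cl P_op[OF cs(1) ds(1)] T_le[of "f \<oplus>\<^bsub>K\<^esub> g" "cs @ ds"] mult_left_mono[OF 1 C] 2 by simp
      also have "\<dots> \<le> 4 * (C + 1) * \<delta>" using \<delta> by (simp add: algebra_simps)
      also have "\<dots> = e" using C by (simp add: \<delta>_def)
      finally show "hnorm L (T (f \<oplus>\<^bsub>K\<^esub> g) \<ominus>\<^bsub>L\<^esub> (T f \<oplus>\<^bsub>L\<^esub> T g)) \<le> e" .
    qed (use T fg in auto)
  next
    fix f c assume f: "f \<in> carrier K"
    show "T (c \<odot>\<^bsub>K\<^esub> f) = c \<odot>\<^bsub>L\<^esub> T f"
    proof (rule L.eqI_hnorm)
      fix e :: real assume e: "e > 0"
      define \<delta> where "\<delta> = e / (2 * (C + 1) * (cmod c + 1))"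
      have pos: "2 * (C + 1) * (cmod c + 1) > 0" using C by (simp add: add_nonneg_pos)
      have \<delta>: "\<delta> > 0" using e pos by (simp add: \<delta>_def)
      obtain cs where cs: "cs \<in> P" "hnorm K (f \<ominus>\<^bsub>K\<^esub> comb K \<kappa> cs) < \<delta>"
        using near[OF f \<delta>] by blast
      have "(c \<odot>\<^bsub>K\<^esub> f) \<ominus>\<^bsub>K\<^esub> comb K \<kappa> (smul c cs) = c \<odot>\<^bsub>K\<^esub> (f \<ominus>\<^bsub>K\<^esub> comb K \<kappa> cs)"
        unfolding sm[OF cs(1)]
        using f cl cs by (intro K.cinner_eqI) (simp_all add: K.cinner_smult K.cinner_diff algebra_simps)
      then have 1: "hnorm K ((c \<odot>\<^bsub>K\<^esub> f) \<ominus>\<^bsub>K\<^esub> comb K \<kappa> (smul c cs)) \<le> cmod c * \<delta>"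
        using K.nm_smult[of "f \<ominus>\<^bsub>K\<^esub> comb K \<kappa> cs" c] f cl cs by (simp add: mult_left_mono)
      have "comb L v (smul c cs) \<ominus>\<^bsub>L\<^esub> (c \<odot>\<^bsub>L\<^esub> T f) = c \<odot>\<^bsub>L\<^esub> (comb L v cs \<ominus>\<^bsub>L\<^esub> T f)"
        unfolding sm[OF cs(1)]
        using f T cl cs by (intro L.cinner_eqI) (simp_all add: L.cinner_smult L.cinner_diff algebra_simps)
      then have "hnorm L (comb L v (smul c cs) \<ominus>\<^bsub>L\<^esub> (c \<odot>\<^bsub>L\<^esub> T f)) \<le> cmod c * (C * hnorm K (f \<ominus>\<^bsub>K\<^esub> comb K \<kappa> cs))"
        using L.nm_smult[of "comb L v cs \<ominus>\<^bsub>L\<^esub> T f" c] f T cl cs T_le'[OF f cs(1)] by (simp add: mult_left_mono)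
      also have "\<dots> \<le> cmod c * (C * \<delta>)" using cs C by (intro mult_left_mono) auto
      finally have 2: "hnorm L (comb L v (smul c cs) \<ominus>\<^bsub>L\<^esub> (c \<odot>\<^bsub>L\<^esub> T f)) \<le> C * (cmod c * \<delta>)" by (simp add: mult.left_commute)
      have "hnorm L (T (c \<odot>\<^bsub>K\<^esub> f) \<ominus>\<^bsub>L\<^esub> (c \<odot>\<^bsub>L\<^esub> T f))
          \<le> C * hnorm K ((c \<odot>\<^bsub>K\<^esub> f) \<ominus>\<^bsub>K\<^esub> comb K \<kappa> (smul c cs))
            + hnorm L (comb L v (smul c cs) \<ominus>\<^bsub>L\<^esub> (c \<odot>\<^bsub>L\<^esub> T f))"
        using L.hnorm_diff_triangle[of "T (c \<odot>\<^bsub>K\<^esub> f)" "comb L v (smul c cs)" "c \<odot>\<^bsub>L\<^esub> T f"]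
          f T cl P_op(2)[OF cs(1) cs(1)] T_le[of "c \<odot>\<^bsub>K\<^esub> f" "smul c cs"] by simp
      also have "\<dots> \<le> C * (cmod c * \<delta>) + C * (cmod c * \<delta>)"
        using mult_left_mono[OF 1 C] 2 by (rule add_mono)
      also have "\<dots> \<le> 2 * (C + 1) * (cmod c + 1) * \<delta>" using \<delta> C by (simp add: algebra_simps)
      also have "\<dots> = e" unfolding \<delta>_def using pos by (metis less_irrefl nonzero_mult_div_cancel_left times_divide_eq_right)
      finally show "hnorm L (T (c \<odot>\<^bsub>K\<^esub> f) \<ominus>\<^bsub>L\<^esub> (c \<odot>\<^bsub>L\<^esub> T f)) \<le> e" .
    qed (use T f in auto)
  next
    fix f assume f: "f \<in> carrier K"
    have "[] \<in> P" by (simp add: P_def)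
    then show "hnorm L (T f) \<le> C * hnorm K f"
      using T_le[OF f, of "[]"] T f by simp
  qed (use T assms in auto)
  moreover have "T (\<kappa> x) = v x" if x: "x \<in> X" for x
  proof (rule L.hnorm_diff_eq_0)
    have "[(1, x)] \<in> P" using x by (simp add: P_def)
    then have "hnorm L (T (\<kappa> x) \<ominus>\<^bsub>L\<^esub> v x) \<le> C * hnorm K (\<kappa> x \<ominus>\<^bsub>K\<^esub> \<kappa> x)"
      using T_le[OF \<kappa>[OF x], of "[(1, x)]"] v[OF x] \<kappa>[OF x] by simp
    also have "\<kappa> x \<ominus>\<^bsub>K\<^esub> \<kappa> x = \<zero>\<^bsub>K\<^esub>" using \<kappa>[OF x] by (simp add: a_minus_def K.M.r_neg)
    finally show "hnorm L (T (\<kappa> x) \<ominus>\<^bsub>L\<^esub> v x) = 0"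
      using L.hnorm_nonneg[OF L.M.minus_closed[OF T[OF \<kappa>[OF x]] v[OF x]]] by simp
  qed (use x v \<kappa> T in auto)
  ultimately show ?thesis using \<kappa> by (intro bexI[of _ "\<lambda>f\<in>carrier K. T f"]) auto
qed

lemma bounded_op_comb:
  assumes "hilbert_space K" "hilbert_space L" and T: "T \<in> bounded_ops K L"
    and "\<And>x. x \<in> snd ` set cs \<Longrightarrow> v x \<in> carrier K"
  shows "T (comb K v cs) = comb L (\<lambda>x. T (v x)) cs"
proof -
  interpret K: hilbert_space K by fact
  interpret L: hilbert_space L by fact
  note [simp] = bounded_ops_closed[OF T]
  show ?thesis
    using assms(4)
  proof (induction cs)
    case Nil
    then show ?case
      using bounded_ops_smult[OF T K.M.zero_closed, of 0] K.smult_l_null[of "\<zero>\<^bsub>K\<^esub>"] L.smult_l_null[of "T \<zero>\<^bsub>K\<^esub>"]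
      by simp
  next
    case (Cons p cs)
    obtain c x where p: "p = (c, x)" by (cases p)
    have "v x \<in> carrier K" "comb K v cs \<in> carrier K"
      using Cons.prems by (auto simp: p intro!: K.comb_closed)
    moreover have "T (comb K v cs) = comb L (\<lambda>x. T (v x)) cs" using Cons by auto
    ultimately show ?case by (simp add: p bounded_ops_add[OF T] bounded_ops_smult[OF T])
  qed
qed

text \<open>
  The same in terms of Gram matrices.
\<close>
lemma extend_kernel:
  assumes K: "hilbert_space K" and L: "hilbert_space L" and span: "spanning K X \<kappa>"
    and v: "\<And>x. x \<in> X \<Longrightarrow> v x \<in> carrier L" and M: "0 \<le> M"
    and bound: "\<And>cs. snd ` set cs \<subseteq> X \<Longrightarrow>
      Re (form (\<lambda>x y. cinner L (v x) (v y)) cs cs) \<le> M * (hnorm K (comb K \<kappa> cs))\<^sup>2"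
  shows "\<exists>T\<in>bounded_ops K L. \<forall>x\<in>X. T (\<kappa> x) = v x"
proof (rule extend_operator[OF K L span v])
  interpret K: hilbert_space K by fact
  interpret L: hilbert_space L by fact
  fix cs :: "(complex \<times> 'c) list" assume cs: "snd ` set cs \<subseteq> X"
  have cl: "comb K \<kappa> cs \<in> carrier K" "comb L v cs \<in> carrier L"
    using cs v spanning_closed[OF span] by (auto intro!: K.comb_closed L.comb_closed)
  have "(hnorm L (comb L v cs))\<^sup>2 = Re (form (\<lambda>x y. cinner L (v x) (v y)) cs cs)"
    using cl cs v by (subst L.cinner_comb_comb[symmetric]) (auto simp: L.nm_squared)
  also have "\<dots> \<le> (sqrt M * hnorm K (comb K \<kappa> cs))\<^sup>2"
    using bound[OF cs] M by (simp add: power_mult_distrib)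
  finally show "hnorm L (comb L v cs) \<le> sqrt M * hnorm K (comb K \<kappa> cs)"
    by (rule power2_le_imp_le) (use M cl in simp)
qed (use M in simp_all)

section \<open>Positivity of matrices of operators\<close>

lemma add_bounded_ops:
  assumes "hilbert_space H" "hilbert_space K" and S: "S \<in> bounded_ops H K" and T: "T \<in> bounded_ops H K"
  shows "(\<lambda>x\<in>carrier H. S x \<oplus>\<^bsub>K\<^esub> T x) \<in> bounded_ops H K"
proof -
  interpret H: hilbert_space H by fact
  interpret K: hilbert_space K by fact
  obtain c where c: "\<And>x. x \<in> carrier H \<Longrightarrow> hnorm K (S x) \<le> c * hnorm H x"
    using bounded_ops_bound[OF assms(1) S] by blast
  obtain d where d: "\<And>x. x \<in> carrier H \<Longrightarrow> hnorm K (T x) \<le> d * hnorm H x"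
    using bounded_ops_bound[OF assms(1) T] by blast
  note cl = bounded_ops_closed[OF S] bounded_ops_closed[OF T]
  show ?thesis
  proof (rule restrict_bounded_opsI[where C = "c + d"])
    fix x y assume xy: "x \<in> carrier H" "y \<in> carrier H"
    show "S (x \<oplus>\<^bsub>H\<^esub> y) \<oplus>\<^bsub>K\<^esub> T (x \<oplus>\<^bsub>H\<^esub> y) = S x \<oplus>\<^bsub>K\<^esub> T x \<oplus>\<^bsub>K\<^esub> (S y \<oplus>\<^bsub>K\<^esub> T y)"
      using xy cl by (simp add: bounded_ops_add[OF S] bounded_ops_add[OF T] K.M.a_ac)
  next
    fix e x assume "x \<in> carrier H"
    then show "S (e \<odot>\<^bsub>H\<^esub> x) \<oplus>\<^bsub>K\<^esub> T (e \<odot>\<^bsub>H\<^esub> x) = e \<odot>\<^bsub>K\<^esub> (S x \<oplus>\<^bsub>K\<^esub> T x)"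
      using cl by (simp add: bounded_ops_smult[OF S] bounded_ops_smult[OF T] K.smult_r_distr)
  next
    fix x assume x: "x \<in> carrier H"
    show "hnorm K (S x \<oplus>\<^bsub>K\<^esub> T x) \<le> (c + d) * hnorm H x"
      using K.nm_triangle[OF cl(1)[OF x] cl(2)[OF x]] c[OF x] d[OF x] by (simp add: algebra_simps)
  qed (use cl assms in auto)
qed

lemma smult_bounded_ops:
  assumes "hilbert_space H" "hilbert_space K" and T: "T \<in> bounded_ops H K"
  shows "(\<lambda>x\<in>carrier H. a \<odot>\<^bsub>K\<^esub> T x) \<in> bounded_ops H K"
proof -
  interpret H: hilbert_space H by fact
  interpret K: hilbert_space K by fact
  obtain c where c: "\<And>x. x \<in> carrier H \<Longrightarrow> hnorm K (T x) \<le> c * hnorm H x"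
    using bounded_ops_bound[OF assms(1) T] by blast
  note cl = bounded_ops_closed[OF T]
  show ?thesis
  proof (rule restrict_bounded_opsI[where C = "cmod a * c"])
    fix e x assume x: "x \<in> carrier H"
    show "a \<odot>\<^bsub>K\<^esub> T (e \<odot>\<^bsub>H\<^esub> x) = e \<odot>\<^bsub>K\<^esub> (a \<odot>\<^bsub>K\<^esub> T x)"
      using K.smult_assoc1[of a e "T x"] K.smult_assoc1[of e a "T x"] cl[OF x] x
      by (simp add: bounded_ops_smult[OF T] mult.commute)
  next
    fix x assume x: "x \<in> carrier H"
    show "hnorm K (a \<odot>\<^bsub>K\<^esub> T x) \<le> cmod a * c * hnorm H x"
      using K.nm_smult[OF cl[OF x], of a] c[OF x] by (simp add: mult_left_mono mult.assoc)
  qed (use cl assms in \<open>auto simp: bounded_ops_add[OF T] K.smult_r_distr\<close>)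
qed

lemma zero_bounded_ops:
  assumes "hilbert_space H" "hilbert_space K"
  shows "(\<lambda>x\<in>carrier H. \<zero>\<^bsub>K\<^esub>) \<in> bounded_ops H K"
proof -
  interpret H: hilbert_space H by fact
  interpret K: hilbert_space K by fact
  show ?thesis by (rule restrict_bounded_opsI[where C = 0]) (use assms in auto)
qed

lemma compose_bounded_ops:
  assumes "hilbert_space H" "hilbert_space K" "hilbert_space L"
    and T: "T \<in> bounded_ops H K" and S: "S \<in> bounded_ops K L"
  shows "compose (carrier H) S T \<in> bounded_ops H L"
proof -
  interpret H: hilbert_space H by fact
  interpret K: hilbert_space K by fact
  obtain c where c: "0 \<le> c" "\<And>x. x \<in> carrier K \<Longrightarrow> hnorm L (S x) \<le> c * hnorm K x"
    using bounded_ops_bound[OF assms(2) S] by blast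
  obtain d where d: "\<And>x. x \<in> carrier H \<Longrightarrow> hnorm K (T x) \<le> d * hnorm H x"
    using bounded_ops_bound[OF assms(1) T] by blast
  note cl = bounded_ops_closed[OF T] bounded_ops_closed[OF S]
  have "(\<lambda>x\<in>carrier H. S (T x)) \<in> bounded_ops H L"
  proof (rule restrict_bounded_opsI[where C = "c * d"])
    fix x assume x: "x \<in> carrier H"
    show "hnorm L (S (T x)) \<le> c * d * hnorm H x"
      using c(2)[OF cl(1)[OF x]] mult_left_mono[OF d[OF x] c(1)] by simp
  qed (use cl assms in \<open>auto simp: bounded_ops_add[OF T] bounded_ops_add[OF S] bounded_ops_smult[OF T] bounded_ops_smult[OF S]\<close>)
  then show ?thesis by (simp add: compose_def)
qed

lemma op_algebra_simps [simp]:
  "carrier (op_algebra H) = bounded_ops H H"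
  "mult (op_algebra H) = compose (carrier H)"
  "one (op_algebra H) = (\<lambda>x\<in>carrier H. x)"
  "zero (op_algebra H) = (\<lambda>x\<in>carrier H. \<zero>\<^bsub>H\<^esub>)"
  "add (op_algebra H) = (\<lambda>S T. \<lambda>x\<in>carrier H. S x \<oplus>\<^bsub>H\<^esub> T x)"
  "smult (op_algebra H) = (\<lambda>c T. \<lambda>x\<in>carrier H. c \<odot>\<^bsub>H\<^esub> T x)"
  "star (op_algebra H) = adj H H"
  by (simp_all add: op_algebra_def)

lemma abelian_group_op_algebra:
  assumes "hilbert_space H" shows "abelian_group (op_algebra H)"
proof -
  interpret H: hilbert_space H by fact
  note cl = bounded_ops_closed
  show ?thesis
  proof (rule abelian_groupI, unfold op_algebra_simps)
    fix S T U assume ST: "S \<in> bounded_ops H H" "T \<in> bounded_ops H H"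
    show "(\<lambda>x\<in>carrier H. S x \<oplus>\<^bsub>H\<^esub> T x) \<in> bounded_ops H H" by (intro add_bounded_ops assms ST)
    show "(\<lambda>x\<in>carrier H. S x \<oplus>\<^bsub>H\<^esub> T x) = (\<lambda>x\<in>carrier H. T x \<oplus>\<^bsub>H\<^esub> S x)"
      using cl[OF ST(1)] cl[OF ST(2)] by (auto intro!: restrict_ext H.M.a_comm)
    assume U: "U \<in> bounded_ops H H"
    show "(\<lambda>x\<in>carrier H. (\<lambda>x\<in>carrier H. S x \<oplus>\<^bsub>H\<^esub> T x) x \<oplus>\<^bsub>H\<^esub> U x) =
        (\<lambda>x\<in>carrier H. S x \<oplus>\<^bsub>H\<^esub> (\<lambda>x\<in>carrier H. T x \<oplus>\<^bsub>H\<^esub> U x) x)"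
      using cl[OF ST(1)] cl[OF ST(2)] cl[OF U] by (auto intro!: restrict_ext H.M.a_assoc)
  next
    show "(\<lambda>x\<in>carrier H. \<zero>\<^bsub>H\<^esub>) \<in> bounded_ops H H" by (intro zero_bounded_ops assms)
    fix T assume T: "T \<in> bounded_ops H H"
    show "(\<lambda>x\<in>carrier H. (\<lambda>x\<in>carrier H. \<zero>\<^bsub>H\<^esub>) x \<oplus>\<^bsub>H\<^esub> T x) = T"
      by (rule bounded_ops_eqI[OF add_bounded_ops[OF assms assms zero_bounded_ops[OF assms assms] T] T])
        (simp add: cl[OF T])
    show "\<exists>S\<in>bounded_ops H H. (\<lambda>x\<in>carrier H. S x \<oplus>\<^bsub>H\<^esub> T x) = (\<lambda>x\<in>carrier H. \<zero>\<^bsub>H\<^esub>)"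
    proof (rule bexI[OF _ smult_bounded_ops[OF assms assms T, of "- 1"]], rule restrict_ext)
      fix x assume x: "x \<in> carrier H"
      show "(\<lambda>x\<in>carrier H. (- 1) \<odot>\<^bsub>H\<^esub> T x) x \<oplus>\<^bsub>H\<^esub> T x = \<zero>\<^bsub>H\<^esub>"
        using x cl[OF T x] by (intro H.cinner_eqI) (simp_all add: H.cinner_add H.cinner_smult)
    qed
  qed
qed

text \<open>
  Matrix entries of a finite sum in \<open>B(H)\<close>; this reduces products of operator matrices to sums of numbers.
\<close>
lemma cinner_finsum_op:
  assumes "hilbert_space H" and "finite I" and "\<And>i. i \<in> I \<Longrightarrow> T i \<in> bounded_ops H H"
    and g: "g \<in> carrier H" and h: "h \<in> carrier H"
  shows "cinner H g (finsum (op_algebra H) T I h) = (\<Sum>i\<in>I. cinner H g (T i h))"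
proof -
  interpret H: hilbert_space H by fact
  interpret O: abelian_group "op_algebra H" by (rule abelian_group_op_algebra) fact
  show ?thesis
    using assms(2,3)
  proof (induction I rule: finite_induct)
    case empty
    then show ?case using g h by simp
  next
    case (insert i I)
    have cl: "finsum (op_algebra H) T I \<in> bounded_ops H H"
      using O.finsum_closed[of T I] insert by (auto simp: Pi_def)
    have "finsum (op_algebra H) T (insert i I) = (\<lambda>x\<in>carrier H. T i x \<oplus>\<^bsub>H\<^esub> finsum (op_algebra H) T I x)"
      using O.finsum_insert[of I i T] insert by (auto simp: Pi_def)
    then show ?case
      using insert g h bounded_ops_closed[OF cl h] bounded_ops_closed[of "T i" H H h]
      by (simp add: H.cinner_add)
  qed
qed

lemma mat_carrier_iff:
  "X \<in> carrier (mat_algebra n A) \<longleftrightarrow> X \<in> carrier_mat n n \<and> (\<forall>i<n. \<forall>j<n. X $$ (i, j) \<in> carrier A)"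
  by (force simp: mat_algebra_def elements_mat_def)

lemma mat_module_carrier_iff:
  "X \<in> carrier (mat_module n A E) \<longleftrightarrow> X \<in> carrier_mat n n \<and> (\<forall>i<n. \<forall>j<n. X $$ (i, j) \<in> carrier E)"
  by (force simp: mat_module_def elements_mat_def)

lemma abelian_group_mat_algebra:
  assumes "abelian_group B" shows "abelian_group (mat_algebra n B)"
proof -
  interpret B: abelian_group B by fact
  have simps: "add (mat_algebra n B) = (\<lambda>X Y. mat n n (\<lambda>ij. X $$ ij \<oplus>\<^bsub>B\<^esub> Y $$ ij))"
    "zero (mat_algebra n B) = mat n n (\<lambda>_. \<zero>\<^bsub>B\<^esub>)"
    by (simp_all add: mat_algebra_def)
  show ?thesis
  proof (rule abelian_groupI, unfold simps)
    fix X assume X: "X \<in> carrier (mat_algebra n B)"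
    show "\<exists>Y\<in>carrier (mat_algebra n B). mat n n (\<lambda>ij. Y $$ ij \<oplus>\<^bsub>B\<^esub> X $$ ij) = mat n n (\<lambda>_. \<zero>\<^bsub>B\<^esub>)"
      using X by (intro bexI[of _ "mat n n (\<lambda>ij. \<ominus>\<^bsub>B\<^esub> X $$ ij)"])
        (auto simp: mat_carrier_iff B.l_neg intro!: eq_matI)
  qed (auto simp: mat_carrier_iff B.a_assoc intro!: eq_matI B.a_comm)
qed

context hilbert_space
begin

lemma sum_cinner_nonneg:
  assumes "\<And>i :: nat. i < n \<Longrightarrow> u i \<in> carrier H"
  shows "(\<Sum>i<n. \<Sum>j<n. cinner H (u i) (u j)) \<in> \<real> \<and> 0 \<le> Re (\<Sum>i<n. \<Sum>j<n. cinner H (u i) (u j))"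
proof -
  let ?cs = "map (\<lambda>i. (1, i)) [0..<n]"
  have "form (\<lambda>i j. cinner H (u i) (u j)) ?cs ?cs = (\<Sum>i<n. \<Sum>j<n. cinner H (u i) (u j))"
    by (simp add: form_def ev_def kfun_def comp_def interv_sum_list_conv_sum_set_nat atLeast0LessThan)
  moreover have "form (\<lambda>i j. cinner H (u i) (u j)) ?cs ?cs = cinner H (comb H u ?cs) (comb H u ?cs)"
    using assms by (intro cinner_comb_comb[symmetric]) auto
  moreover have "comb H u ?cs \<in> carrier H" using assms by (intro comb_closed) auto
  ultimately show ?thesis by (metis cinner_nonneg ip_self Reals_of_real)
qed

end

text \<open>
  For \<open>P = B\<^sup>* B\<close> the sum equals \<open>\<Sum>\<^sub>k \<parallel>\<Sum>\<^sub>i B\<^sub>k\<^sub>i h\<^sub>i\<parallel>\<^sup>2\<close>.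
\<close>
lemma positive_mat_op_nonneg:
  assumes "hilbert_space H" and "positive (mat_algebra n (op_algebra H)) P"
    and h: "\<And>i. i < n \<Longrightarrow> h i \<in> carrier H"
  shows "(\<Sum>i<n. \<Sum>j<n. cinner H (h i) ((P $$ (i, j)) (h j))) \<in> \<real> \<and>
    0 \<le> Re (\<Sum>i<n. \<Sum>j<n. cinner H (h i) ((P $$ (i, j)) (h j)))"
proof -
  interpret H: hilbert_space H by fact
  obtain B where B: "B \<in> carrier (mat_algebra n (op_algebra H))"
    and P: "P = star (mat_algebra n (op_algebra H)) B \<otimes>\<^bsub>mat_algebra n (op_algebra H)\<^esub> B"
    using assms(2) by (auto simp: positive_def)
  have Bc: "B $$ (i, j) \<in> bounded_ops H H" if "i < n" "j < n" for i j
    using B that by (simp add: mat_carrier_iff)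
  define u where "u = (\<lambda>k i. (B $$ (k, i)) (h i))"
  have u: "u k i \<in> carrier H" if "k < n" "i < n" for k i
    using bounded_ops_closed[OF Bc[OF that] h[OF that(2)]] by (simp add: u_def)
  have "cinner H (h i) ((P $$ (i, j)) (h j)) = (\<Sum>k<n. cinner H (u k i) (u k j))" if ij: "i < n" "j < n" for i j
  proof -
    have "P $$ (i, j) = finsum (op_algebra H) (\<lambda>k. star (mat_algebra n (op_algebra H)) B $$ (i, k) \<otimes>\<^bsub>op_algebra H\<^esub> B $$ (k, j)) {..<n}"
      using ij by (simp add: P mat_algebra_def)
    also have "\<dots> = finsum (op_algebra H) (\<lambda>k. compose (carrier H) (adj H H (B $$ (k, i))) (B $$ (k, j))) {..<n}"
      using ij Bc by (intro abelian_monoid.finsum_cong' abelian_group.axioms(1) abelian_group_op_algebra assms(1))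
        (auto simp: mat_algebra_def Pi_def intro!: compose_bounded_ops adj_bounded assms(1))
    finally have Pij: "P $$ (i, j) = \<dots>" .
    have "cinner H (h i) ((P $$ (i, j)) (h j))
        = (\<Sum>k<n. cinner H (h i) (compose (carrier H) (adj H H (B $$ (k, i))) (B $$ (k, j)) (h j)))"
      unfolding Pij using ij Bc h
      by (intro cinner_finsum_op assms(1) compose_bounded_ops[OF assms(1) assms(1) assms(1)]
          adj_bounded[OF assms(1) assms(1)]) auto
    also have "\<dots> = (\<Sum>k<n. cinner H (u k i) (u k j))"
      using ij h u Bc assms(1) by (intro sum.cong) (auto simp: compose_eq cinner_adj u_def)
    finally show ?thesis .
  qed
  then have "(\<Sum>i<n. \<Sum>j<n. cinner H (h i) ((P $$ (i, j)) (h j))) = (\<Sum>i<n. \<Sum>j<n. \<Sum>k<n. cinner H (u k i) (u k j))"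
    by simp
  also have "\<dots> = (\<Sum>i<n. \<Sum>k<n. \<Sum>j<n. cinner H (u k i) (u k j))"
    by (intro sum.cong refl sum.swap)
  also have "\<dots> = (\<Sum>k<n. \<Sum>i<n. \<Sum>j<n. cinner H (u k i) (u k j))"
    by (rule sum.swap)
  finally have eq: "(\<Sum>i<n. \<Sum>j<n. cinner H (h i) ((P $$ (i, j)) (h j)))
      = (\<Sum>k<n. \<Sum>i<n. \<Sum>j<n. cinner H (u k i) (u k j))" .
  have S: "(\<Sum>i<n. \<Sum>j<n. cinner H (u k i) (u k j)) \<in> \<real> \<and> 0 \<le> Re (\<Sum>i<n. \<Sum>j<n. cinner H (u k i) (u k j))"
    if "k < n" for k using H.sum_cinner_nonneg[of n "u k"] u that by blast
  have "0 \<le> (\<Sum>k<n. Re (\<Sum>i<n. \<Sum>j<n. cinner H (u k i) (u k j)))"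
    by (rule sum_nonneg) (simp only: lessThan_iff S)
  moreover have "(\<Sum>k<n. \<Sum>i<n. \<Sum>j<n. cinner H (u k i) (u k j)) \<in> \<real>"
    by (rule sum_in_Reals) (simp only: lessThan_iff S)
  ultimately show ?thesis unfolding eq by (simp only: Re_sum[of _ "{..<n}"])
qed

lemma form_sum:
  "form k cs ds = (\<Sum>i<length cs. \<Sum>j<length ds. cnj (fst (cs ! i)) * fst (ds ! j) * k (snd (cs ! i)) (snd (ds ! j)))"
  by (simp add: form_def ev_def kfun_def sum_list_sum_nth case_prod_beta sum_distrib_left atLeast0LessThan mult.assoc)

text \<open>
  The sums that arise from matrices with a single nonzero row.
\<close>
lemma (in abelian_monoid) finsum_first:
  assumes "0 < n" "g 0 \<in> carrier G" "\<And>k. \<lbrakk>0 < k; k < n\<rbrakk> \<Longrightarrow> g k = \<zero>"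
  shows "(\<Oplus>k\<in>{..<n}. g k) = g (0 :: nat)"
proof -
  have "(\<Oplus>k\<in>{..<n}. g k) = (\<Oplus>k\<in>{..<n}. if 0 = k then g 0 else \<zero>)"
    using assms by (intro finsum_cong') auto
  also have "\<dots> = g 0" using assms by (intro finsum_singleton) auto
  finally show ?thesis .
qed

lemma (in unital_cstar_algebra) cstar_zero [simp]: "star A \<zero> = \<zero>"
proof -
  interpret A: ring A by (rule ring)
  interpret V: vectorspace "class_ring :: complex ring" A by (rule complex_space)
  show ?thesis using star_smult[of \<zero> 0] V.smult_l_null[of "star A \<zero>"] V.smult_l_null[of \<zero>] star_closed by simp
qed

text \<open>
  The matrix \<open>(a\<^sub>i\<^sup>* a\<^sub>j)\<close> is \<open>Y\<^sup>* Y\<close>, where \<open>Y\<close> has first row \<open>(a\<^sub>j)\<close> and zeros elsewhere.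
\<close>
lemma completely_positive_psd:
  assumes "unital_cstar_algebra A" and "hilbert_space H" and cp: "completely_positive A (op_algebra H) \<phi>"
    and cs: "snd ` set cs \<subseteq> carrier A \<times> carrier H"
  defines "S \<equiv> form (\<lambda>(a, h) (b, g). cinner H h (\<phi> (star A a \<otimes>\<^bsub>A\<^esub> b) g)) cs cs"
  shows "S \<in> \<real> \<and> 0 \<le> Re S"
proof (cases "cs = []")
  case False
  interpret A: unital_cstar_algebra A by fact
  interpret AR: ring A by (rule A.ring)
  interpret H: hilbert_space H by fact
  let ?n = "length cs"
  define a where "a = (\<lambda>i. fst (snd (cs ! i)))"
  define h where "h = (\<lambda>i. fst (cs ! i) \<odot>\<^bsub>H\<^esub> snd (snd (cs ! i)))"
  have mem: "snd (cs ! i) \<in> carrier A \<times> carrier H" if "i < ?n" for i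
    using cs nth_mem[OF that] by blast
  have a: "a i \<in> carrier A" and h': "snd (snd (cs ! i)) \<in> carrier H" if "i < ?n" for i
    using mem[OF that] by (auto simp: a_def mem_Times_iff)
  have h: "h i \<in> carrier H" if "i < ?n" for i using h'[OF that] by (simp add: h_def)
  define X where "X = mat ?n ?n (\<lambda>(i, j). star A (a i) \<otimes>\<^bsub>A\<^esub> a j)"
  define Y where "Y = mat ?n ?n (\<lambda>(i, j). if i = 0 then a j else \<zero>\<^bsub>A\<^esub>)"
  have X: "X \<in> carrier (mat_algebra ?n A)" and Y: "Y \<in> carrier (mat_algebra ?n A)"
    using a A.star_closed by (auto simp: mat_carrier_iff X_def Y_def)
  have "X = star (mat_algebra ?n A) Y \<otimes>\<^bsub>mat_algebra ?n A\<^esub> Y"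
  proof (rule eq_matI)
    fix i j assume "i < dim_row (star (mat_algebra ?n A) Y \<otimes>\<^bsub>mat_algebra ?n A\<^esub> Y)"
      "j < dim_col (star (mat_algebra ?n A) Y \<otimes>\<^bsub>mat_algebra ?n A\<^esub> Y)"
    then have ij: "i < ?n" "j < ?n" by (auto simp: mat_algebra_def)
    have "(star (mat_algebra ?n A) Y \<otimes>\<^bsub>mat_algebra ?n A\<^esub> Y) $$ (i, j)
        = (\<Oplus>\<^bsub>A\<^esub>k\<in>{..<?n}. star (mat_algebra ?n A) Y $$ (i, k) \<otimes>\<^bsub>A\<^esub> Y $$ (k, j))"
      using ij by (simp add: mat_algebra_def)
    also have "\<dots> = star A (a i) \<otimes>\<^bsub>A\<^esub> a j"
      using AR.finsum_first[of ?n "\<lambda>k. star (mat_algebra ?n A) Y $$ (i, k) \<otimes>\<^bsub>A\<^esub> Y $$ (k, j)"] ij a A.star_closed False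
      by (simp add: mat_algebra_def Y_def)
    finally show "X $$ (i, j) = (star (mat_algebra ?n A) Y \<otimes>\<^bsub>mat_algebra ?n A\<^esub> Y) $$ (i, j)"
      using ij by (simp add: X_def)
  qed (simp_all add: X_def mat_algebra_def)
  then have "positive (mat_algebra ?n A) X" using Y by (auto simp: positive_def)
  then have pos: "positive (mat_algebra ?n (op_algebra H)) (map_mat \<phi> X)"
    using cp X False unfolding completely_positive_def by (simp add: Suc_le_eq)
  have \<phi>: "\<phi> b \<in> bounded_ops H H" if "b \<in> carrier A" for b
    using cp that by (auto simp: completely_positive_def linear_maps_iff)
  have "form (\<lambda>(a, h) (b, g). cinner H h (\<phi> (star A a \<otimes>\<^bsub>A\<^esub> b) g)) cs cs
      = (\<Sum>i<?n. \<Sum>j<?n. cinner H (h i) ((map_mat \<phi> X $$ (i, j)) (h j)))"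
    unfolding form_sum
  proof (intro sum.cong refl)
    fix i j assume "i \<in> {..<?n}" "j \<in> {..<?n}"
    then have ij: "i < ?n" "j < ?n" by auto
    have op: "\<phi> (star A (a i) \<otimes>\<^bsub>A\<^esub> a j) \<in> bounded_ops H H" using a[OF ij(1)] a[OF ij(2)] A.star_closed by (intro \<phi>) simp
    show "cnj (fst (cs ! i)) * fst (cs ! j) * (case snd (cs ! i) of (a, h) \<Rightarrow> \<lambda>(b, g). cinner H h (\<phi> (star A a \<otimes>\<^bsub>A\<^esub> b) g)) (snd (cs ! j))
        = cinner H (h i) ((map_mat \<phi> X $$ (i, j)) (h j))"
      using ij h' bounded_ops_closed[OF op h'[OF ij(2)]] bounded_ops_smult[OF op h'[OF ij(2)]]
      by (simp add: X_def case_prod_beta h_def a_def H.cinner_smult H.ip_smult_left)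
  qed
  then show ?thesis using positive_mat_op_nonneg[OF assms(2) pos h] by (simp add: S_def)
qed (simp add: form_simps S_def)

lemma op_module_simps [simp]:
  "carrier (op_module H K) = bounded_ops H K"
  "zero (op_module H K) = (\<lambda>x\<in>carrier H. \<zero>\<^bsub>K\<^esub>)"
  "add (op_module H K) = (\<lambda>S T. \<lambda>x\<in>carrier H. S x \<oplus>\<^bsub>K\<^esub> T x)"
  "smult (op_module H K) = (\<lambda>c T. \<lambda>x\<in>carrier H. c \<odot>\<^bsub>K\<^esub> T x)"
  "ainner (op_module H K) = (\<lambda>S T. compose (carrier H) (adj H K S) T)"
  by (simp_all add: op_module_def)

lemma (in hilbert_module) ainner_zero: "ainner E \<zero>\<^bsub>E\<^esub> \<zero>\<^bsub>E\<^esub> = \<zero>\<^bsub>A\<^esub>"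
proof -
  interpret A: unital_cstar_algebra A by (rule algebra)
  interpret V: vectorspace "class_ring :: complex ring" A by (rule A.complex_space)
  interpret E: vectorspace "class_ring :: complex ring" E by (rule complex_space)
  show ?thesis
    using ainner_smult[of "\<zero>\<^bsub>E\<^esub>" "\<zero>\<^bsub>E\<^esub>" 0] E.smult_l_null[of "\<zero>\<^bsub>E\<^esub>"]
      V.smult_l_null[of "ainner E \<zero>\<^bsub>E\<^esub> \<zero>\<^bsub>E\<^esub>"] ainner_closed by simp
qed

lemma linear_map_zero:
  assumes "complex_space V" "hilbert_space K" "\<Phi> \<in> linear_maps V (op_module H K)" "h \<in> carrier H"
  shows "\<Phi> \<zero>\<^bsub>V\<^esub> h = \<zero>\<^bsub>K\<^esub>"
proof -
  interpret V: vectorspace "class_ring :: complex ring" V by fact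
  interpret K: hilbert_space K by fact
  have smult: "\<Phi> (c \<odot>\<^bsub>V\<^esub> x) = (\<lambda>z\<in>carrier H. c \<odot>\<^bsub>K\<^esub> \<Phi> x z)" if "x \<in> carrier V" for c x
    using assms(3) that by (simp add: linear_maps_iff)
  have "\<Phi> (0 \<odot>\<^bsub>V\<^esub> \<zero>\<^bsub>V\<^esub>) h = 0 \<odot>\<^bsub>K\<^esub> \<Phi> \<zero>\<^bsub>V\<^esub> h"
    unfolding smult[OF V.M.zero_closed] using assms(4) by simp
  moreover have "\<Phi> \<zero>\<^bsub>V\<^esub> h \<in> carrier K"
    using assms(3,4) by (auto simp: linear_maps_iff Pi_def intro: bounded_ops_closed)
  ultimately show ?thesis
    using V.smult_l_null[of "\<zero>\<^bsub>V\<^esub>"] K.smult_l_null[of "\<Phi> \<zero>\<^bsub>V\<^esub> h"] by simp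
qed

text \<open>
  The hypothesis on \<open>\<Phi>\<close> is applied to the square matrix with first row \<open>(x\<^sub>j)\<close> and zeros elsewhere, whose
  inner square is \<open>(\<langle>x\<^sub>i, x\<^sub>j\<rangle>)\<close>.
\<close>
lemma completely_semi_psd:
  assumes "hilbert_module A E" and H1: "hilbert_space H\<^sub>1" and H2: "hilbert_space H\<^sub>2"
    and \<phi>: "\<phi> \<in> linear_maps A (op_algebra H\<^sub>1)" and semi: "completely_semi A E H\<^sub>1 H\<^sub>2 \<phi> \<Phi>"
    and cs: "snd ` set cs \<subseteq> carrier E \<times> carrier H\<^sub>1"
  defines "S \<equiv> form (\<lambda>(x, h) (y, g). cinner H\<^sub>1 h (\<phi> (ainner E x y) g) - cinner H\<^sub>2 (\<Phi> x h) (\<Phi> y g)) cs cs"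
  shows "S \<in> \<real> \<and> 0 \<le> Re S"
proof (cases "cs = []")
  case False
  interpret E: hilbert_module A E by fact
  interpret EV: vectorspace "class_ring :: complex ring" E by (rule E.complex_space)
  interpret A: unital_cstar_algebra A by (rule E.algebra)
  interpret AR: ring A by (rule A.ring)
  interpret H1: hilbert_space H\<^sub>1 by fact
  interpret H2: hilbert_space H\<^sub>2 by fact
  let ?n = "length cs"
  let ?M = "mat_algebra ?n (op_algebra H\<^sub>1)"
  interpret M: abelian_group ?M by (intro abelian_group_mat_algebra abelian_group_op_algebra H1)
  define x where "x = (\<lambda>i. fst (snd (cs ! i)))"
  define h where "h = (\<lambda>i. fst (cs ! i) \<odot>\<^bsub>H\<^sub>1\<^esub> snd (snd (cs ! i)))"
  have mem: "snd (cs ! i) \<in> carrier E \<times> carrier H\<^sub>1" if "i < ?n" for i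
    using cs nth_mem[OF that] by blast
  have x: "x i \<in> carrier E" and h': "snd (snd (cs ! i)) \<in> carrier H\<^sub>1" if "i < ?n" for i
    using mem[OF that] by (auto simp: x_def mem_Times_iff)
  have h: "h i \<in> carrier H\<^sub>1" if "i < ?n" for i using h'[OF that] by (simp add: h_def)
  have \<phi>op: "\<phi> a \<in> bounded_ops H\<^sub>1 H\<^sub>1" if "a \<in> carrier A" for a
    using \<phi> that by (auto simp: linear_maps_iff)
  have \<Phi>: "\<Phi> \<in> linear_maps E (op_module H\<^sub>1 H\<^sub>2)" using semi by (simp add: completely_semi_def)
  have \<Phi>op: "\<Phi> y \<in> bounded_ops H\<^sub>1 H\<^sub>2" if "y \<in> carrier E" for y
    using \<Phi> that by (auto simp: linear_maps_iff)
  define X where "X = mat ?n ?n (\<lambda>(i, j). if i = 0 then x j else \<zero>\<^bsub>E\<^esub>)"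
  have X: "X \<in> carrier (mat_module ?n A E)" using x by (auto simp: mat_module_carrier_iff X_def)
  have Xc: "X $$ (i, j) \<in> carrier E" if "i < ?n" "j < ?n" for i j
    using X that by (simp add: mat_module_carrier_iff)
  define G where "G = map_mat \<phi> (ainner (mat_module ?n A E) X X)"
  define F where "F = ainner (mat_module ?n (op_algebra H\<^sub>1) (op_module H\<^sub>1 H\<^sub>2)) (map_mat \<Phi> X) (map_mat \<Phi> X)"
  have G_entry: "G $$ (i, j) = \<phi> (ainner E (x i) (x j))" if ij: "i < ?n" "j < ?n" for i j
  proof -
    have "G $$ (i, j) = \<phi> (\<Oplus>\<^bsub>A\<^esub>k\<in>{..<?n}. ainner E (X $$ (k, i)) (X $$ (k, j)))"
      using ij by (simp add: G_def mat_module_def)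
    also have "\<dots> = \<phi> (ainner E (x i) (x j))"
      using AR.finsum_first[of ?n "\<lambda>k. ainner E (X $$ (k, i)) (X $$ (k, j))"] ij x E.ainner_closed E.ainner_zero False
      by (simp add: X_def)
    finally show ?thesis .
  qed
  have F_entry: "cinner H\<^sub>1 (h i) ((F $$ (i, j)) (h j)) = cinner H\<^sub>2 (\<Phi> (x i) (h i)) (\<Phi> (x j) (h j))"
    if ij: "i < ?n" "j < ?n" for i j
  proof -
    let ?T = "\<lambda>k. compose (carrier H\<^sub>1) (adj H\<^sub>1 H\<^sub>2 (\<Phi> (X $$ (k, i)))) (\<Phi> (X $$ (k, j)))"
    have T: "?T k \<in> bounded_ops H\<^sub>1 H\<^sub>1" if "k < ?n" for k
      using that ij Xc by (intro compose_bounded_ops[OF H1 H2 H1] adj_bounded[OF H1 H2] \<Phi>op) auto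
    have "F $$ (i, j) = finsum (op_algebra H\<^sub>1) (\<lambda>k. ainner (op_module H\<^sub>1 H\<^sub>2) (map_mat \<Phi> X $$ (k, i)) (map_mat \<Phi> X $$ (k, j))) {..<?n}"
      using ij by (simp add: F_def mat_module_def)
    also have "\<dots> = finsum (op_algebra H\<^sub>1) ?T {..<?n}"
      using ij T by (intro abelian_monoid.finsum_cong' abelian_group.axioms(1) abelian_group_op_algebra H1)
        (auto simp: X_def)
    finally have "cinner H\<^sub>1 (h i) ((F $$ (i, j)) (h j)) = (\<Sum>k<?n. cinner H\<^sub>1 (h i) (?T k (h j)))"
      using T h ij by (simp only:) (intro cinner_finsum_op H1; simp)
    also have "\<dots> = (\<Sum>k<?n. cinner H\<^sub>2 (\<Phi> (X $$ (k, i)) (h i)) (\<Phi> (X $$ (k, j)) (h j)))"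
      using ij h Xc by (intro sum.cong) (auto simp: compose_eq cinner_adj[OF H1 H2 \<Phi>op] bounded_ops_closed[OF \<Phi>op])
    also have "\<dots> = (\<Sum>k<?n. if k = 0 then cinner H\<^sub>2 (\<Phi> (x i) (h i)) (\<Phi> (x j) (h j)) else 0)"
      using ij h x by (intro sum.cong refl) (auto simp: X_def linear_map_zero[OF E.complex_space H2 \<Phi>])
    also have "\<dots> = cinner H\<^sub>2 (\<Phi> (x i) (h i)) (\<Phi> (x j) (h j))" using False by simp
    finally show ?thesis .
  qed
  have "star_le ?M F G"
    using semi X False unfolding completely_semi_def F_def G_def by (simp add: Suc_le_eq)
  then have FM: "F \<in> carrier ?M" and GM: "G \<in> carrier ?M" and pos: "positive ?M (G \<ominus>\<^bsub>?M\<^esub> F)"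
    by (auto simp: star_le_def)
  define P where "P = G \<ominus>\<^bsub>?M\<^esub> F"
  have PM: "P \<in> carrier ?M" using FM GM by (simp add: P_def)
  have "G = P \<oplus>\<^bsub>?M\<^esub> F" using FM GM by (simp add: P_def a_minus_def M.a_assoc M.l_neg)
  then have G_eq: "G $$ (i, j) = (\<lambda>z\<in>carrier H\<^sub>1. (P $$ (i, j)) z \<oplus>\<^bsub>H\<^sub>1\<^esub> (F $$ (i, j)) z)" if "i < ?n" "j < ?n" for i j
    using that by (simp add: mat_algebra_def)
  have "form (\<lambda>(x, h) (y, g). cinner H\<^sub>1 h (\<phi> (ainner E x y) g) - cinner H\<^sub>2 (\<Phi> x h) (\<Phi> y g)) cs cs
      = (\<Sum>i<?n. \<Sum>j<?n. cinner H\<^sub>1 (h i) ((P $$ (i, j)) (h j)))"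
    unfolding form_sum
  proof (intro sum.cong refl)
    fix i j assume "i \<in> {..<?n}" "j \<in> {..<?n}"
    then have ij: "i < ?n" "j < ?n" by auto
    have op: "\<phi> (ainner E (x i) (x j)) \<in> bounded_ops H\<^sub>1 H\<^sub>1"
      "\<Phi> (x i) \<in> bounded_ops H\<^sub>1 H\<^sub>2" "\<Phi> (x j) \<in> bounded_ops H\<^sub>1 H\<^sub>2"
      using x[OF ij(1)] x[OF ij(2)] by (auto intro: \<phi>op \<Phi>op E.ainner_closed)
    have PF: "P $$ (i, j) \<in> bounded_ops H\<^sub>1 H\<^sub>1" "F $$ (i, j) \<in> bounded_ops H\<^sub>1 H\<^sub>1"
      using PM FM ij by (auto simp: mat_carrier_iff)
    have "cinner H\<^sub>1 (h i) ((P $$ (i, j)) (h j))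
        = cinner H\<^sub>1 (h i) (\<phi> (ainner E (x i) (x j)) (h j)) - cinner H\<^sub>2 (\<Phi> (x i) (h i)) (\<Phi> (x j) (h j))"
      unfolding G_entry[OF ij, symmetric] G_eq[OF ij] F_entry[OF ij, symmetric]
      using h ij bounded_ops_closed[OF PF(1)] bounded_ops_closed[OF PF(2)] by (simp add: H1.cinner_add)
    also have "\<dots> = cnj (fst (cs ! i)) * fst (cs ! j) *
        (cinner H\<^sub>1 (snd (snd (cs ! i))) (\<phi> (ainner E (x i) (x j)) (snd (snd (cs ! j))))
          - cinner H\<^sub>2 (\<Phi> (x i) (snd (snd (cs ! i)))) (\<Phi> (x j) (snd (snd (cs ! j)))))"
      using h' ij bounded_ops_closed[OF op(1)] bounded_ops_closed[OF op(2)] bounded_ops_closed[OF op(3)]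
      by (simp add: h_def bounded_ops_smult[OF op(1)] bounded_ops_smult[OF op(2)] bounded_ops_smult[OF op(3)]
          H1.cinner_smult H1.ip_smult_left H2.cinner_smult H2.ip_smult_left right_diff_distrib)
    finally show "cnj (fst (cs ! i)) * fst (cs ! j) * (case snd (cs ! i) of (x, h) \<Rightarrow>
          \<lambda>(y, g). cinner H\<^sub>1 h (\<phi> (ainner E x y) g) - cinner H\<^sub>2 (\<Phi> x h) (\<Phi> y g)) (snd (cs ! j))
        = cinner H\<^sub>1 (h i) ((P $$ (i, j)) (h j))"
      by (simp add: case_prod_beta x_def)
  qed
  then show ?thesis using positive_mat_op_nonneg[OF H1 pos h] by (simp add: P_def S_def)
qed (simp add: form_simps S_def)

section \<open>Bounds by scalars in a unital C*-algebra\<close>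

context unital_cstar_algebra
begin

lemma anorm_zero [simp]: "anorm A \<zero> = 0"
proof -
  interpret A: ring A by (rule ring)
  show ?thesis using anorm_eq_0[of \<zero>] by simp
qed

lemma anorm_uminus: assumes "a \<in> carrier A" shows "anorm A (\<ominus> a) = anorm A a"
proof -
  interpret ring A by (rule ring)
  interpret V: vectorspace "class_ring :: complex ring" A by (rule complex_space)
  have "\<ominus> a = \<zero> \<ominus> a" using assms by (simp add: a_minus_def)
  also have "\<dots> = (- 1) \<odot> a" using assms by (simp add: complex_space_minus[OF complex_space])
  finally show ?thesis using anorm_smult[OF assms, of "- 1"] by simp
qed

lemma anorm_diff_commute: "\<lbrakk>a \<in> carrier A; b \<in> carrier A\<rbrakk> \<Longrightarrow> anorm A (a \<ominus> b) = anorm A (b \<ominus> a)"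
proof -
  interpret ring A by (rule ring)
  assume ab: "a \<in> carrier A" "b \<in> carrier A"
  then have "\<ominus> (a \<ominus> b) = b \<ominus> a" by (simp add: a_minus_def minus_add a_comm)
  then show ?thesis using anorm_uminus[of "a \<ominus> b"] ab by simp
qed

lemma anorm_diff_triangle:
  assumes "a \<in> carrier A" "b \<in> carrier A" "c \<in> carrier A"
  shows "anorm A (a \<ominus> c) \<le> anorm A (a \<ominus> b) + anorm A (b \<ominus> c)"
proof -
  interpret ring A by (rule ring)
  have "a \<ominus> c = (a \<ominus> b) \<oplus> (b \<ominus> c)" using assms by (simp add: a_minus_def a_assoc r_neg1)
  then show ?thesis using anorm_add[of "a \<ominus> b" "b \<ominus> c"] assms by simp
qed

lemma anorm_star: assumes a: "a \<in> carrier A" shows "anorm A (star A a) = anorm A a"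
proof -
  have le: "anorm A b \<le> anorm A (star A b)" if b: "b \<in> carrier A" for b
  proof (cases "anorm A b = 0")
    case True
    then show ?thesis using anorm_nonneg[OF star_closed[OF b]] by simp
  next
    case False
    then have pos: "0 < anorm A b" using anorm_nonneg[OF b] by linarith
    have "anorm A b * anorm A b \<le> anorm A (star A b) * anorm A b"
      using cstar_identity[OF b] anorm_mult[OF star_closed[OF b] b] by (simp add: power2_eq_square)
    then show ?thesis using pos by (rule mult_right_le_imp_le)
  qed
  show ?thesis using le[OF a] le[OF star_closed[OF a]] star_star[OF a] by simp
qed

lemma star_one: "star A \<one> = \<one>"
proof -
  interpret ring A by (rule ring)
  show ?thesis using star_mult[of "star A \<one>" \<one>] star_star[of \<one>] star_closed[of \<one>] by simp
qed

lemma star_minus: "\<lbrakk>a \<in> carrier A; b \<in> carrier A\<rbrakk> \<Longrightarrow> star A (a \<ominus> b) = star A a \<ominus> star A b"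
proof -
  interpret ring A by (rule ring)
  interpret V: vectorspace "class_ring :: complex ring" A by (rule complex_space)
  assume "a \<in> carrier A" "b \<in> carrier A"
  then show ?thesis
    using V.smult_closed[of "- 1" b] by (simp add: complex_space_minus[OF complex_space] star_add star_smult star_closed)
qed

lemma eqI_anorm:
  assumes "a \<in> carrier A" "b \<in> carrier A" "(\<lambda>n. f n) \<longlonglongrightarrow> 0" "\<And>n :: nat. anorm A (a \<ominus> b) \<le> f n"
  shows "a = b"
proof -
  interpret ring A by (rule ring)
  have "anorm A (a \<ominus> b) \<le> 0"
    using assms(3,4) by (intro LIMSEQ_le_const[of f 0]) auto
  moreover have "0 \<le> anorm A (a \<ominus> b)" using assms(1,2) by (intro anorm_nonneg) simp
  ultimately have "anorm A (a \<ominus> b) = 0" by linarith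
  then show ?thesis using anorm_eq_0[of "a \<ominus> b"] assms(1,2) by simp
qed

text \<open>
  A fixed point \<open>z\<close> of \<open>F a = (x + a\<^sup>2) / 2\<close> satisfies \<open>(1 - z)\<^sup>2 = 1 - x\<close>. On elements of norm at most \<open>1/2\<close> the map
  \<open>F\<close> contracts by the factor \<open>1/2\<close>, so the iterates from \<open>0\<close> converge; they are self-adjoint because \<open>x\<close> is.
\<close>
lemma sqrt_one_minus:
  assumes x: "x \<in> carrier A" and x_star: "star A x = x" and x_le: "anorm A x \<le> 1 / 2"
  shows "\<exists>b\<in>carrier A. star A b = b \<and> b \<otimes> b = \<one> \<ominus> x"
proof -
  interpret ring A by (rule ring)
  interpret V: vectorspace "class_ring :: complex ring" A by (rule complex_space)
  have sm [simp]: "c \<odot> a \<in> carrier A" if "a \<in> carrier A" for c a using that V.smult_closed[of c a] by simp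
  define F where "F = (\<lambda>a. (1/2) \<odot> (x \<oplus> a \<otimes> a))"
  have F [simp]: "F a \<in> carrier A" if "a \<in> carrier A" for a using that x by (simp add: F_def)
  have F_star: "star A (F a) = F a" if "a \<in> carrier A" "star A a = a" for a
    using that x x_star by (simp add: F_def star_smult star_add star_mult)
  have F_diff: "anorm A (F a \<ominus> F b) \<le> 1/2 * (anorm A a + anorm A b) * anorm A (a \<ominus> b)"
    if a: "a \<in> carrier A" and b: "b \<in> carrier A" for a b
  proof -
    have 1: "(x \<oplus> a \<otimes> a) \<ominus> (x \<oplus> b \<otimes> b) = a \<otimes> (a \<ominus> b) \<oplus> (a \<ominus> b) \<otimes> b"
      using a b x by algebra
    have "F a \<ominus> F b = (1/2) \<odot> (x \<oplus> a \<otimes> a) \<oplus> (- 1) \<odot> ((1/2) \<odot> (x \<oplus> b \<otimes> b))"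
      using a b x by (simp add: F_def complex_space_minus[OF complex_space])
    also have "\<dots> = (1/2) \<odot> ((x \<oplus> a \<otimes> a) \<oplus> (- 1) \<odot> (x \<oplus> b \<otimes> b))"
      using a b x V.smult_assoc1[of "- 1" "1/2" "x \<oplus> b \<otimes> b"] V.smult_assoc1[of "1/2" "- 1" "x \<oplus> b \<otimes> b"]
      by (simp add: V.smult_r_distr)
    also have "\<dots> = (1/2) \<odot> (a \<otimes> (a \<ominus> b) \<oplus> (a \<ominus> b) \<otimes> b)"
      using a b x by (simp add: 1 flip: complex_space_minus[OF complex_space])
    finally have "anorm A (F a \<ominus> F b) = 1/2 * anorm A (a \<otimes> (a \<ominus> b) \<oplus> (a \<ominus> b) \<otimes> b)"
      using a b by (simp add: anorm_smult)
    also have "\<dots> \<le> 1/2 * (anorm A a * anorm A (a \<ominus> b) + anorm A (a \<ominus> b) * anorm A b)"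
      using anorm_add[of "a \<otimes> (a \<ominus> b)" "(a \<ominus> b) \<otimes> b"] anorm_mult[of a "a \<ominus> b"] anorm_mult[of "a \<ominus> b" b] a b
      by simp
    finally show ?thesis by (simp add: algebra_simps)
  qed
  define y where "y = rec_nat \<zero> (\<lambda>_. F)"
  have y_simps: "y 0 = \<zero>" "\<And>n. y (Suc n) = F (y n)" by (simp_all add: y_def)
  have y [simp]: "y n \<in> carrier A" for n by (induction n) (simp_all add: y_simps)
  have y_star: "star A (y n) = y n" for n
    by (induction n) (simp_all add: y_simps F_star cstar_zero)
  have y_le: "anorm A (y n) \<le> 1/2" for n
  proof (induction n)
    case (Suc n)
    have "anorm A (y n) * anorm A (y n) \<le> 1/2 * (1/2)"
      using Suc anorm_nonneg[OF y[of n]] by (intro mult_mono) auto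
    then have "anorm A (x \<oplus> y n \<otimes> y n) \<le> 1"
      using anorm_add[OF x, of "y n \<otimes> y n"] anorm_mult[of "y n" "y n"] x_le by simp
    then show ?case using x by (simp add: y_simps F_def anorm_smult)
  qed (simp add: y_simps)
  have step: "anorm A (y (Suc n) \<ominus> y n) \<le> (1/2) ^ n" for n
  proof (induction n)
    case 0
    have "y (Suc 0) \<ominus> y 0 = y (Suc 0)" by (simp add: y_simps(1) a_minus_def)
    then show ?case using y_le[of "Suc 0"] by simp
  next
    case (Suc n)
    have "anorm A (y (Suc (Suc n)) \<ominus> y (Suc n)) \<le> 1/2 * (anorm A (y (Suc n)) + anorm A (y n)) * anorm A (y (Suc n) \<ominus> y n)"
      using F_diff[OF y[of "Suc n"] y[of n]] by (simp add: y_simps)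
    also have "\<dots> \<le> 1/2 * 1 * (1/2) ^ n"
      using Suc y_le[of n] y_le[of "Suc n"] anorm_nonneg[of "y (Suc n) \<ominus> y n"] anorm_nonneg[of "y n"] anorm_nonneg[of "y (Suc n)"]
      by (intro mult_mono) auto
    finally show ?case by simp
  qed
  have far: "anorm A (y (n + k) \<ominus> y n) \<le> 2 * (1/2) ^ n - 2 * (1/2) ^ (n + k)" for n k
  proof (induction k)
    case 0
    then show ?case by (simp add: a_minus_def r_neg)
  next
    case (Suc k)
    then show ?case using anorm_diff_triangle[OF y[of "n + Suc k"] y[of "n + k"] y[of n]] step[of "n + k"] by simp
  qed
  have Cauchy: "\<exists>M. \<forall>m\<ge>M. \<forall>n\<ge>M. anorm A (y m \<ominus> y n) < e" if e: "e > 0" for e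
  proof -
    obtain M where M: "(1/2) ^ M < e / 4" using real_arch_pow_inv[of "e / 4" "1/2"] e by auto
    have near: "anorm A (y m \<ominus> y M) \<le> 2 * (1/2) ^ M" if "m \<ge> M" for m
    proof -
      have "0 \<le> 2 * (1/2 :: real) ^ (M + (m - M))" by simp
      then have "anorm A (y (M + (m - M)) \<ominus> y M) \<le> 2 * (1/2) ^ M" using far[of M "m - M"] by linarith
      then show ?thesis using that by simp
    qed
    have "anorm A (y m \<ominus> y n) < e" if "m \<ge> M" "n \<ge> M" for m n
      using anorm_diff_triangle[OF y[of m] y[of M] y[of n]] near[OF that(1)] near[OF that(2)]
        anorm_diff_commute[OF y[of M] y[of n]] M by simp
    then show ?thesis by blast
  qed
  obtain z where z: "z \<in> carrier A" and lim: "(\<lambda>n. anorm A (y n \<ominus> z)) \<longlonglongrightarrow> 0"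
    using complete_underD[OF complete y Cauchy] by blast
  have z_star: "star A z = z"
  proof (rule eqI_anorm)
    show "(\<lambda>n. anorm A (y n \<ominus> z) + anorm A (y n \<ominus> z)) \<longlonglongrightarrow> 0"
      using tendsto_add[OF lim lim] by simp
    show "anorm A (star A z \<ominus> z) \<le> anorm A (y n \<ominus> z) + anorm A (y n \<ominus> z)" for n
      using anorm_diff_triangle[OF star_closed[OF z] y[of n] z] anorm_star[of "z \<ominus> y n"]
        anorm_diff_commute[OF z y[of n]] z by (simp add: star_minus y_star)
  qed (use z star_closed in auto)
  have z_fix: "z = F z"
  proof (rule eqI_anorm)
    let ?f = "\<lambda>n. anorm A (y (Suc n) \<ominus> z) + 1/2 * (1/2 + anorm A z) * anorm A (y n \<ominus> z)"
    show "?f \<longlonglongrightarrow> 0"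
      using tendsto_add[OF LIMSEQ_Suc[OF lim] tendsto_mult[OF tendsto_const[of "1/2 * (1/2 + anorm A z)"] lim]]
      unfolding mult_zero_right add_0_right .
    show "anorm A (z \<ominus> F z) \<le> ?f n" for n
    proof -
      have "1/2 * (anorm A (y n) + anorm A z) * anorm A (y n \<ominus> z) \<le> 1/2 * (1/2 + anorm A z) * anorm A (y n \<ominus> z)"
        using y_le[of n] anorm_nonneg[of "y n \<ominus> z"] z by (intro mult_right_mono) auto
      then show ?thesis
        using anorm_diff_triangle[OF z y[of "Suc n"] F[OF z]] F_diff[OF y[of n] z] anorm_diff_commute[OF z y[of "Suc n"]]
        by (simp add: y_simps)
    qed
  qed (use z in auto)
  have "z \<oplus> z = 2 \<odot> z"
    using V.smult_l_distr[of 1 1 z] V.smult_one[of z] z by simp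
  also have "\<dots> = 2 \<odot> F z" using z_fix by simp
  also have "\<dots> = x \<oplus> z \<otimes> z"
    using V.smult_assoc1[of 2 "1/2" "x \<oplus> z \<otimes> z"] V.smult_one[of "x \<oplus> z \<otimes> z"] x z by (simp add: F_def)
  finally have zz: "z \<oplus> z = x \<oplus> z \<otimes> z" .
  have "x = (z \<oplus> z) \<ominus> z \<otimes> z" unfolding zz using x z by algebra
  then have "(\<one> \<ominus> z) \<otimes> (\<one> \<ominus> z) = \<one> \<ominus> x"
    using z by (simp add: ring_simprules)
  moreover have "star A (\<one> \<ominus> z) = \<one> \<ominus> z" using z z_star by (simp add: star_minus star_one)
  ultimately show ?thesis using z by (intro bexI[of _ "\<one> \<ominus> z"]) auto
qed

text \<open>
  The element \<open>c\<^sup>* c\<close> is dominated by a multiple of the unit, with the difference in the form \<open>b\<^sup>* b\<close>.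
\<close>
theorem star_mult_self_bounded:
  assumes c: "c \<in> carrier A"
  shows "\<exists>M\<ge>0. \<exists>b\<in>carrier A. star A c \<otimes> c \<oplus> star A b \<otimes> b = complex_of_real M \<odot> \<one>"
proof -
  interpret ring A by (rule ring)
  interpret V: vectorspace "class_ring :: complex ring" A by (rule complex_space)
  have sm [simp]: "c \<odot> a \<in> carrier A" if "a \<in> carrier A" for c a using that V.smult_closed[of c a] by simp
  let ?s = "star A c \<otimes> c"
  have s [simp]: "?s \<in> carrier A" using c star_closed by simp
  \<comment> \<open>the factor \<open>2\<close> makes \<open>\<parallel>c\<^sup>* c / M\<parallel> \<le> 1/2\<close>; adding \<open>1\<close> keeps \<open>M\<close> positive\<close>
  define M where "M = 2 * anorm A ?s + 1"
  have M: "M > 0" "anorm A ?s \<le> M / 2" using anorm_nonneg[OF s] by (simp_all add: M_def)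
  define x where "x = complex_of_real (1 / M) \<odot> ?s"
  have "anorm A x \<le> 1 / 2" using M by (simp add: x_def anorm_smult norm_divide field_simps del: of_real_divide)
  moreover have "star A x = x" using c star_closed by (simp add: x_def star_smult star_mult star_star)
  ultimately obtain b where b: "b \<in> carrier A" "star A b = b" "b \<otimes> b = \<one> \<ominus> x"
    using sqrt_one_minus[of x] by (auto simp: x_def)
  define r where "r = complex_of_real (sqrt M)"
  have r: "cnj r = r" "r * r = complex_of_real M" using M by (simp_all add: r_def flip: of_real_mult)
  define d where "d = r \<odot> b"
  have x: "x \<in> carrier A" by (simp add: x_def)
  have "star A d \<otimes> d = (r * r) \<odot> (b \<otimes> b)"
    using b(1,2) V.smult_assoc1[of r r "b \<otimes> b"]
    by (simp add: d_def star_smult smult_mult_left smult_mult_right r(1))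
  also have "\<dots> = complex_of_real M \<odot> (\<one> \<oplus> (- 1) \<odot> x)"
    using x by (simp add: b(3) r(2) complex_space_minus[OF complex_space])
  also have "\<dots> = complex_of_real M \<odot> \<one> \<oplus> (- 1) \<odot> ?s"
    using M V.smult_r_distr[of "complex_of_real M" "\<one>" "(- 1) \<odot> x"]
      V.smult_assoc1[of "complex_of_real M" "- 1" x] V.smult_assoc1[of "- complex_of_real M" "complex_of_real (1 / M)" ?s] x
    by (simp add: x_def)
  also have "\<dots> = complex_of_real M \<odot> \<one> \<ominus> ?s" by (simp add: complex_space_minus[OF complex_space])
  finally have d: "star A d \<otimes> d = complex_of_real M \<odot> \<one> \<ominus> ?s" .
  have "?s \<oplus> (complex_of_real M \<odot> \<one> \<ominus> ?s) = complex_of_real M \<odot> \<one>"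
    using a_comm[of ?s "complex_of_real M \<odot> \<one> \<ominus> ?s"] by (simp add: a_minus_def a_assoc l_neg)
  then show ?thesis using M b by (intro exI[of _ M]) (auto simp: d intro!: bexI[of _ d] simp flip: d simp: d_def)
qed

end

section \<open>The Stinespring space of a completely positive map\<close>

lemma form_add: "form (\<lambda>x y. k x y + l x y) cs ds = form k cs ds + form l cs ds"
  by (simp add: form_sum sum.distrib algebra_simps)

lemma form_scale: "form (\<lambda>x y. c * k x y) cs ds = c * form k cs ds"
  by (simp add: form_sum sum_distrib_left algebra_simps)

lemma bounded_op_zero:
  assumes "hilbert_space H" "hilbert_space K" and T: "T \<in> bounded_ops H K"
  shows "T \<zero>\<^bsub>H\<^esub> = \<zero>\<^bsub>K\<^esub>"
  using bounded_op_comb[OF assms, of "[]"] by simp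

text \<open>
  A completely positive map on a unital C*-algebra with values in \<open>B(H)\<close>.
\<close>

locale cp_map =
  fixes A :: "'a normed_star_algebra" and H :: "'h inner_space" and \<phi> :: "'a \<Rightarrow> 'h \<Rightarrow> 'h"
  assumes algebra: "unital_cstar_algebra A" and hilbert: "hilbert_space H"
    and cp: "completely_positive A (op_algebra H) \<phi>"
begin

sublocale A: unital_cstar_algebra A by (rule algebra)
sublocale H: hilbert_space H by (rule hilbert)
sublocale R: ring A by (rule A.ring)
sublocale V: vectorspace "class_ring :: complex ring" A by (rule A.complex_space)

lemma \<phi>_linear: "\<phi> \<in> linear_maps A (op_algebra H)"
  using cp by (simp add: completely_positive_def)

lemma \<phi>_op: "a \<in> carrier A \<Longrightarrow> \<phi> a \<in> bounded_ops H H"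
  using \<phi>_linear by (auto simp: linear_maps_iff)

lemma \<phi>_closed [simp]: "\<lbrakk>a \<in> carrier A; h \<in> carrier H\<rbrakk> \<Longrightarrow> \<phi> a h \<in> carrier H"
  by (rule bounded_ops_closed[OF \<phi>_op])

lemma \<phi>_add: "\<lbrakk>a \<in> carrier A; b \<in> carrier A; h \<in> carrier H\<rbrakk> \<Longrightarrow> \<phi> (a \<oplus>\<^bsub>A\<^esub> b) h = \<phi> a h \<oplus>\<^bsub>H\<^esub> \<phi> b h"
  using \<phi>_linear by (simp add: linear_maps_iff)

lemma \<phi>_smult: "\<lbrakk>a \<in> carrier A; h \<in> carrier H\<rbrakk> \<Longrightarrow> \<phi> (c \<odot>\<^bsub>A\<^esub> a) h = c \<odot>\<^bsub>H\<^esub> \<phi> a h"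
  using \<phi>_linear by (simp add: linear_maps_iff)

lemma A_smult_closed [simp]: "a \<in> carrier A \<Longrightarrow> c \<odot>\<^bsub>A\<^esub> a \<in> carrier A"
  using V.smult_closed[of c a] by simp

lemma A_star_closed [simp]: "a \<in> carrier A \<Longrightarrow> star A a \<in> carrier A"
  by (rule A.star_closed)

text \<open>
  The inner product of the elementary tensors \<open>a \<otimes> h\<close> and \<open>b \<otimes> g\<close>.
\<close>
definition cp_kernel :: "'a \<times> 'h \<Rightarrow> 'a \<times> 'h \<Rightarrow> complex" where
  "cp_kernel = (\<lambda>(a, h) (b, g). cinner H h (\<phi> (star A a \<otimes>\<^bsub>A\<^esub> b) g))"

abbreviation X :: "('a \<times> 'h) set" where "X \<equiv> carrier A \<times> carrier H"

lemma cp_kernel_simp [simp]: "cp_kernel (a, h) (b, g) = cinner H h (\<phi> (star A a \<otimes>\<^bsub>A\<^esub> b) g)"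
  by (simp add: cp_kernel_def)

lemma cp_kernel_psd: "snd ` set cs \<subseteq> X \<Longrightarrow> form cp_kernel cs cs \<in> \<real> \<and> 0 \<le> Re (form cp_kernel cs cs)"
  unfolding cp_kernel_def by (rule completely_positive_psd[OF algebra hilbert cp])

text \<open>
  Left multiplication by \<open>c\<close> on elementary tensors.
\<close>
definition act :: "'a \<Rightarrow> 'a \<times> 'h \<Rightarrow> 'a \<times> 'h" where
  "act c = (\<lambda>(a, h). (c \<otimes>\<^bsub>A\<^esub> a, h))"

lemma act_simp [simp]: "act c (a, h) = (c \<otimes>\<^bsub>A\<^esub> a, h)"
  by (simp add: act_def)

lemma act_closed: "\<lbrakk>c \<in> carrier A; p \<in> X\<rbrakk> \<Longrightarrow> act c p \<in> X"
  by (cases p) auto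

text \<open>
  If \<open>c\<^sup>* c + b\<^sup>* b = M \<cdot> 1\<close>, the forms of the kernel translated by \<open>c\<close> and by \<open>b\<close> add up to \<open>M\<close> times the form of
  the kernel, and the second of them is nonnegative.
\<close>
lemma act_bounded:
  assumes c: "c \<in> carrier A"
  shows "\<exists>M\<ge>0. \<forall>cs. snd ` set cs \<subseteq> X \<longrightarrow>
    Re (form (\<lambda>p q. cp_kernel (act c p) (act c q)) cs cs) \<le> M * Re (form cp_kernel cs cs)"
proof -
  obtain M b where M: "0 \<le> M" and b: "b \<in> carrier A"
    and eq: "star A c \<otimes>\<^bsub>A\<^esub> c \<oplus>\<^bsub>A\<^esub> star A b \<otimes>\<^bsub>A\<^esub> b = complex_of_real M \<odot>\<^bsub>A\<^esub> \<one>\<^bsub>A\<^esub>"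
    using A.star_mult_self_bounded[OF c] by blast
  have sum: "cp_kernel (act c p) (act c q) + cp_kernel (act b p) (act b q) = complex_of_real M * cp_kernel p q"
    if p: "p \<in> X" and q: "q \<in> X" for p q
  proof -
    obtain a h a' g where pq: "p = (a, h)" "q = (a', g)" by (cases p, cases q)
    have cl: "a \<in> carrier A" "h \<in> carrier H" "a' \<in> carrier A" "g \<in> carrier H" using p q by (auto simp: pq)
    have "star A (c \<otimes>\<^bsub>A\<^esub> a) \<otimes>\<^bsub>A\<^esub> (c \<otimes>\<^bsub>A\<^esub> a') \<oplus>\<^bsub>A\<^esub> star A (b \<otimes>\<^bsub>A\<^esub> a) \<otimes>\<^bsub>A\<^esub> (b \<otimes>\<^bsub>A\<^esub> a')
        = star A a \<otimes>\<^bsub>A\<^esub> (star A c \<otimes>\<^bsub>A\<^esub> c \<oplus>\<^bsub>A\<^esub> star A b \<otimes>\<^bsub>A\<^esub> b) \<otimes>\<^bsub>A\<^esub> a'"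
      using cl b c by (simp add: A.star_mult R.m_assoc R.l_distr R.r_distr)
    also have "\<dots> = complex_of_real M \<odot>\<^bsub>A\<^esub> (star A a \<otimes>\<^bsub>A\<^esub> a')"
      using cl by (simp add: eq A.smult_mult_left A.smult_mult_right)
    finally have "\<phi> (star A (c \<otimes>\<^bsub>A\<^esub> a) \<otimes>\<^bsub>A\<^esub> (c \<otimes>\<^bsub>A\<^esub> a')) g \<oplus>\<^bsub>H\<^esub> \<phi> (star A (b \<otimes>\<^bsub>A\<^esub> a) \<otimes>\<^bsub>A\<^esub> (b \<otimes>\<^bsub>A\<^esub> a')) g
        = complex_of_real M \<odot>\<^bsub>H\<^esub> \<phi> (star A a \<otimes>\<^bsub>A\<^esub> a') g"
      using cl b c by (simp flip: \<phi>_add \<phi>_smult)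
    then show ?thesis using cl b c by (simp add: pq flip: H.cinner_add H.cinner_smult)
  qed
  have "Re (form (\<lambda>p q. cp_kernel (act c p) (act c q)) cs cs) \<le> M * Re (form cp_kernel cs cs)"
    if cs: "snd ` set cs \<subseteq> X" for cs
  proof -
    have "form (\<lambda>p q. cp_kernel (act c p) (act c q)) cs cs + form (\<lambda>p q. cp_kernel (act b p) (act b q)) cs cs
        = complex_of_real M * form cp_kernel cs cs"
      unfolding form_add[symmetric] form_scale[symmetric] by (rule form_cong) (use cs sum in blast)
    from arg_cong[OF this, of Re] have "Re (form (\<lambda>p q. cp_kernel (act c p) (act c q)) cs cs)
        + Re (form (\<lambda>p q. cp_kernel (act b p) (act b q)) cs cs) = M * Re (form cp_kernel cs cs)"
      by simp
    moreover have "0 \<le> Re (form (\<lambda>p q. cp_kernel (act b p) (act b q)) cs cs)"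
      using cp_kernel_psd[of "map (map_prod id (act b)) cs"] act_closed[OF b] cs
      unfolding form_map by (auto simp: image_subset_iff)
    ultimately show ?thesis by linarith
  qed
  then show ?thesis using M by blast
qed

text \<open>
  Stinespring's theorem with \<open>\<rho>\<close> described on the elementary tensors. The dilating operator sends \<open>h\<close> to
  \<open>\<kappa> (1, h)\<close>, see \<open>embedding_V\<close>.
\<close>
theorem Stinespring:
  "\<exists>(K :: ('a \<times> 'h \<Rightarrow> complex) inner_space) \<kappa> \<rho>. hilbert_space K \<and> spanning K X \<kappa> \<and>
    (\<forall>p\<in>X. \<forall>q\<in>X. cinner K (\<kappa> p) (\<kappa> q) = cp_kernel p q) \<and>
    star_hom A (op_algebra K) \<rho> \<and> (\<forall>c\<in>carrier A. \<forall>p\<in>X. \<rho> c (\<kappa> p) = \<kappa> (act c p))"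
proof -
  have "X \<noteq> {}" using R.zero_closed H.M.zero_closed by blast
  then obtain K :: "('a \<times> 'h \<Rightarrow> complex) inner_space" and \<kappa>
    where K: "hilbert_space K" and span: "spanning K X \<kappa>"
      and inner: "\<And>p q. \<lbrakk>p \<in> X; q \<in> X\<rbrakk> \<Longrightarrow> cinner K (\<kappa> p) (\<kappa> q) = cp_kernel p q"
    using Moore_Aronszajn[of X cp_kernel] cp_kernel_psd by blast
  interpret K: hilbert_space K by (rule K)
  note \<kappa> = spanning_closed[OF span]
  have "\<exists>T\<in>bounded_ops K K. \<forall>p\<in>X. T (\<kappa> p) = \<kappa> (act c p)" if c: "c \<in> carrier A" for c
  proof -
    obtain M where M: "0 \<le> M" "\<And>cs. snd ` set cs \<subseteq> X \<Longrightarrow>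
        Re (form (\<lambda>p q. cp_kernel (act c p) (act c q)) cs cs) \<le> M * Re (form cp_kernel cs cs)"
      using act_bounded[OF c] by blast
    show ?thesis
    proof (rule extend_kernel[OF K K span _ M(1)])
      fix cs :: "(complex \<times> 'a \<times> 'h) list" assume cs: "snd ` set cs \<subseteq> X"
      have "form (\<lambda>p q. cinner K (\<kappa> (act c p)) (\<kappa> (act c q))) cs cs = form (\<lambda>p q. cp_kernel (act c p) (act c q)) cs cs"
        using cs act_closed[OF c] by (intro form_cong inner) blast+
      moreover have "cinner K (comb K \<kappa> cs) (comb K \<kappa> cs) = form (\<lambda>p q. cinner K (\<kappa> p) (\<kappa> q)) cs cs"
        using cs \<kappa> by (intro K.cinner_comb_comb) blast+
      moreover have "form (\<lambda>p q. cinner K (\<kappa> p) (\<kappa> q)) cs cs = form cp_kernel cs cs"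
        using cs by (intro form_cong inner) blast+
      moreover have "comb K \<kappa> cs \<in> carrier K" using cs \<kappa> by (intro K.comb_closed) blast
      ultimately show "Re (form (\<lambda>p q. cinner K (\<kappa> (act c p)) (\<kappa> (act c q))) cs cs) \<le> M * (hnorm K (comb K \<kappa> cs))\<^sup>2"
        using M(2)[OF cs] by (simp add: K.nm_squared)
    qed (intro \<kappa> act_closed[OF c])
  qed
  then obtain \<rho> where \<rho>: "\<And>c. c \<in> carrier A \<Longrightarrow> \<rho> c \<in> bounded_ops K K"
    and \<rho>_\<kappa>: "\<And>c p. \<lbrakk>c \<in> carrier A; p \<in> X\<rbrakk> \<Longrightarrow> \<rho> c (\<kappa> p) = \<kappa> (act c p)"
    by metis
  have entry: "cinner K (\<kappa> q) (\<rho> c (\<kappa> p)) = cp_kernel q (act c p)" if "c \<in> carrier A" "p \<in> X" "q \<in> X" for c p q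
    using that by (simp only: \<rho>_\<kappa>) (intro inner act_closed)
  have "star_hom A (op_algebra K) \<rho>"
    unfolding star_hom_def linear_maps_iff op_algebra_simps
  proof (intro conjI ballI allI)
    show "\<rho> \<in> carrier A \<rightarrow> bounded_ops K K" using \<rho> by blast
  next
    fix c d assume cd: "c \<in> carrier A" "d \<in> carrier A"
    show "\<rho> (c \<oplus>\<^bsub>A\<^esub> d) = (\<lambda>x\<in>carrier K. \<rho> c x \<oplus>\<^bsub>K\<^esub> \<rho> d x)"
    proof (rule spanning_weak_eqI[OF K K span span \<rho> add_bounded_ops[OF K K \<rho> \<rho>]])
      fix p q assume p: "p \<in> X" and q: "q \<in> X"
      obtain a h b g where pq: "p = (a, h)" "q = (b, g)" by (cases p, cases q)
      have "cp_kernel q (act (c \<oplus>\<^bsub>A\<^esub> d) p) = cp_kernel q (act c p) + cp_kernel q (act d p)"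
        using p q cd by (simp add: pq R.l_distr R.r_distr \<phi>_add H.cinner_add)
      then show "cinner K (\<kappa> q) (\<rho> (c \<oplus>\<^bsub>A\<^esub> d) (\<kappa> p)) = cinner K (\<kappa> q) ((\<lambda>x\<in>carrier K. \<rho> c x \<oplus>\<^bsub>K\<^esub> \<rho> d x) (\<kappa> p))"
        using p q cd \<kappa>[OF p] \<kappa>[OF q] bounded_ops_closed[OF \<rho>[OF cd(1)] \<kappa>[OF p]] bounded_ops_closed[OF \<rho>[OF cd(2)] \<kappa>[OF p]]
        by (simp add: entry K.cinner_add del: mem_Sigma_iff)
    qed (use cd in auto)
    show "\<rho> (c \<otimes>\<^bsub>A\<^esub> d) = compose (carrier K) (\<rho> c) (\<rho> d)"
    proof (rule spanning_op_eqI[OF K K span \<rho> compose_bounded_ops[OF K K K \<rho> \<rho>]])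
      fix p assume p: "p \<in> X"
      have "act (c \<otimes>\<^bsub>A\<^esub> d) p = act c (act d p)" using p cd by (cases p) (simp add: R.m_assoc)
      then show "\<rho> (c \<otimes>\<^bsub>A\<^esub> d) (\<kappa> p) = compose (carrier K) (\<rho> c) (\<rho> d) (\<kappa> p)"
        using \<rho>_\<kappa>[OF cd(1) act_closed[OF cd(2) p]] \<rho>_\<kappa>[OF cd(2) p] \<rho>_\<kappa>[OF R.m_closed[OF cd] p] \<kappa>[OF p] by (simp add: compose_eq)
    qed (use cd in auto)
  next
    fix c z assume c: "c \<in> carrier A"
    show "\<rho> (z \<odot>\<^bsub>A\<^esub> c) = (\<lambda>x\<in>carrier K. z \<odot>\<^bsub>K\<^esub> \<rho> c x)"
    proof (rule spanning_weak_eqI[OF K K span span \<rho> smult_bounded_ops[OF K K \<rho>]])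
      fix p q assume p: "p \<in> X" and q: "q \<in> X"
      obtain a h b g where pq: "p = (a, h)" "q = (b, g)" by (cases p, cases q)
      have "cp_kernel q (act (z \<odot>\<^bsub>A\<^esub> c) p) = z * cp_kernel q (act c p)"
        using p q c by (simp add: pq A.smult_mult_left A.smult_mult_right \<phi>_smult H.cinner_smult)
      then show "cinner K (\<kappa> q) (\<rho> (z \<odot>\<^bsub>A\<^esub> c) (\<kappa> p)) = cinner K (\<kappa> q) ((\<lambda>x\<in>carrier K. z \<odot>\<^bsub>K\<^esub> \<rho> c x) (\<kappa> p))"
        using p q c \<kappa>[OF p] \<kappa>[OF q] bounded_ops_closed[OF \<rho>[OF c] \<kappa>[OF p]]
        by (simp add: entry K.cinner_smult del: mem_Sigma_iff)
    qed (use c in auto)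
  next
    fix c assume c: "c \<in> carrier A"
    show "\<rho> (star A c) = adj K K (\<rho> c)"
    proof (rule spanning_weak_eqI[OF K K span span \<rho> adj_bounded[OF K K \<rho>]])
      fix p q assume p: "p \<in> X" and q: "q \<in> X"
      obtain a h b g where pq: "p = (a, h)" "q = (b, g)" by (cases p, cases q)
      have "cp_kernel q (act (star A c) p) = cp_kernel (act c q) p"
        using p q c by (simp add: pq A.star_mult R.m_assoc)
      then show "cinner K (\<kappa> q) (\<rho> (star A c) (\<kappa> p)) = cinner K (\<kappa> q) (adj K K (\<rho> c) (\<kappa> p))"
        using cinner_adj[OF K K \<rho>[OF c] \<kappa>[OF q] \<kappa>[OF p]] \<rho>_\<kappa>[OF c q] inner[OF act_closed[OF c q] p]
          entry[OF A_star_closed[OF c] p q] by simp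
    qed (use c in auto)
  qed
  then show ?thesis using K span inner \<rho>_\<kappa> by blast
qed

end

section \<open>The dilation of a completely semi-\<open>\<phi>\<close>-map\<close>

text \<open>
  A completely semi-\<open>\<phi>\<close>-map on a Hilbert module.
\<close>

locale semi_map = cp_map A H\<^sub>1 \<phi> for A :: "'a normed_star_algebra" and H\<^sub>1 :: "'h inner_space" and \<phi> +
  fixes E :: "('a, 'e) inner_module" and H\<^sub>2 :: "'k inner_space" and \<Phi> :: "'e \<Rightarrow> 'h \<Rightarrow> 'k"
  assumes hmodule: "hilbert_module A E" and hilbert2: "hilbert_space H\<^sub>2"
    and semi: "completely_semi A E H\<^sub>1 H\<^sub>2 \<phi> \<Phi>"
begin

sublocale E: hilbert_module A E by (rule hmodule)
sublocale EV: vectorspace "class_ring :: complex ring" E by (rule E.complex_space)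
sublocale H2: hilbert_space H\<^sub>2 by (rule hilbert2)

lemma \<Phi>_linear: "\<Phi> \<in> linear_maps E (op_module H\<^sub>1 H\<^sub>2)"
  using semi by (simp add: completely_semi_def)

lemma \<Phi>_op: "x \<in> carrier E \<Longrightarrow> \<Phi> x \<in> bounded_ops H\<^sub>1 H\<^sub>2"
  using \<Phi>_linear by (auto simp: linear_maps_iff)

lemma \<Phi>_closed [simp]: "\<lbrakk>x \<in> carrier E; h \<in> carrier H\<^sub>1\<rbrakk> \<Longrightarrow> \<Phi> x h \<in> carrier H\<^sub>2"
  by (rule bounded_ops_closed[OF \<Phi>_op])

lemma \<Phi>_add: "\<lbrakk>x \<in> carrier E; y \<in> carrier E; h \<in> carrier H\<^sub>1\<rbrakk> \<Longrightarrow> \<Phi> (x \<oplus>\<^bsub>E\<^esub> y) h = \<Phi> x h \<oplus>\<^bsub>H\<^sub>2\<^esub> \<Phi> y h"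
  using \<Phi>_linear by (simp add: linear_maps_iff)

lemma \<Phi>_smult: "\<lbrakk>x \<in> carrier E; h \<in> carrier H\<^sub>1\<rbrakk> \<Longrightarrow> \<Phi> (c \<odot>\<^bsub>E\<^esub> x) h = c \<odot>\<^bsub>H\<^sub>2\<^esub> \<Phi> x h"
  using \<Phi>_linear by (simp add: linear_maps_iff)

lemma E_smult_closed [simp]: "x \<in> carrier E \<Longrightarrow> c \<odot>\<^bsub>E\<^esub> x \<in> carrier E"
  using EV.smult_closed[of c x] by simp

lemma E_ainner_closed [simp]: "\<lbrakk>x \<in> carrier E; y \<in> carrier E\<rbrakk> \<Longrightarrow> ainner E x y \<in> carrier A"
  by (rule E.ainner_closed)

lemma E_ract_closed [simp]: "\<lbrakk>x \<in> carrier E; a \<in> carrier A\<rbrakk> \<Longrightarrow> ract E x a \<in> carrier E"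
  by (rule E.ract_closed)

lemma ainner_ract_left:
  assumes "x \<in> carrier E" "y \<in> carrier E" "a \<in> carrier A"
  shows "ainner E (ract E x a) y = star A a \<otimes>\<^bsub>A\<^esub> ainner E x y"
proof -
  have "ainner E (ract E x a) y = star A (ainner E y (ract E x a))" using assms by (simp add: E.ainner_star)
  also have "\<dots> = star A a \<otimes>\<^bsub>A\<^esub> ainner E x y" using assms by (simp add: E.ainner_ract A.star_mult E.ainner_star)
  finally show ?thesis .
qed

abbreviation Y :: "('e \<times> 'h + 'k) set" where "Y \<equiv> (carrier E \<times> carrier H\<^sub>1) <+> carrier H\<^sub>2"

text \<open>
  The points \<open>Inl (x, h)\<close> stand for elementary tensors \<open>x \<otimes> h\<close> and the points \<open>Inr w\<close> for the vectors of \<open>H\<^sub>2\<close>. The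
  mixed entries make \<open>\<Phi>\<close> the compression of the canonical map \<open>h \<mapsto> x \<otimes> h\<close>.
\<close>
definition dilation_kernel :: "'e \<times> 'h + 'k \<Rightarrow> 'e \<times> 'h + 'k \<Rightarrow> complex" where
  "dilation_kernel p q = (case p of
      Inl (x, h) \<Rightarrow> (case q of Inl (y, g) \<Rightarrow> cinner H\<^sub>1 h (\<phi> (ainner E x y) g) | Inr w \<Rightarrow> cinner H\<^sub>2 (\<Phi> x h) w)
    | Inr v \<Rightarrow> (case q of Inl (y, g) \<Rightarrow> cinner H\<^sub>2 v (\<Phi> y g) | Inr w \<Rightarrow> cinner H\<^sub>2 v w))"

lemma dilation_kernel_simps [simp]:
  "dilation_kernel (Inl (x, h)) (Inl (y, g)) = cinner H\<^sub>1 h (\<phi> (ainner E x y) g)"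
  "dilation_kernel (Inl (x, h)) (Inr w) = cinner H\<^sub>2 (\<Phi> x h) w"
  "dilation_kernel (Inr v) (Inl (y, g)) = cinner H\<^sub>2 v (\<Phi> y g)"
  "dilation_kernel (Inr v) (Inr w) = cinner H\<^sub>2 v w"
  by (simp_all add: dilation_kernel_def)

lemma dilation_kernel_psd:
  assumes cs: "snd ` set cs \<subseteq> Y"
  shows "form dilation_kernel cs cs \<in> \<real> \<and> 0 \<le> Re (form dilation_kernel cs cs)"
proof -
  \<comment> \<open>the kernel is a sum of the kernel \<open>m\<close>, transported by \<open>z\<close>, and the Gram kernel of \<open>\<theta>\<close>;
    points of \<open>H\<^sub>2\<close> are sent by \<open>z\<close> to zero, where \<open>m\<close> vanishes\<close>
  define m where "m = (\<lambda>(x, h) (y, g). cinner H\<^sub>1 h (\<phi> (ainner E x y) g) - cinner H\<^sub>2 (\<Phi> x h) (\<Phi> y g))"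
  define z :: "'e \<times> 'h + 'k \<Rightarrow> 'e \<times> 'h" where "z = case_sum id (\<lambda>_. (\<zero>\<^bsub>E\<^esub>, \<zero>\<^bsub>H\<^sub>1\<^esub>))"
  define \<theta> :: "'e \<times> 'h + 'k \<Rightarrow> 'k" where "\<theta> = case_sum (\<lambda>(x, h). \<Phi> x h) id"
  have \<phi>0: "\<phi> a \<zero>\<^bsub>H\<^sub>1\<^esub> = \<zero>\<^bsub>H\<^sub>1\<^esub>" if "a \<in> carrier A" for a by (rule bounded_op_zero[OF hilbert hilbert \<phi>_op[OF that]])
  have \<Phi>0: "\<Phi> x \<zero>\<^bsub>H\<^sub>1\<^esub> = \<zero>\<^bsub>H\<^sub>2\<^esub>" if "x \<in> carrier E" for x by (rule bounded_op_zero[OF hilbert hilbert2 \<Phi>_op[OF that]])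
  have split: "dilation_kernel p q = m (z p) (z q) + cinner H\<^sub>2 (\<theta> p) (\<theta> q)" if "p \<in> Y" "q \<in> Y" for p q
    using that by (auto simp: m_def z_def \<theta>_def \<phi>0 \<Phi>0)
  have z: "z p \<in> carrier E \<times> carrier H\<^sub>1" and \<theta>: "\<theta> p \<in> carrier H\<^sub>2" if "p \<in> Y" for p
    using that by (auto simp: z_def \<theta>_def)
  have "form dilation_kernel cs cs = form (\<lambda>p q. m (z p) (z q) + cinner H\<^sub>2 (\<theta> p) (\<theta> q)) cs cs"
    using cs by (intro form_cong split) blast+
  also have "\<dots> = form m (map (map_prod id z) cs) (map (map_prod id z) cs) + cinner H\<^sub>2 (comb H\<^sub>2 \<theta> cs) (comb H\<^sub>2 \<theta> cs)"
    unfolding form_add form_map using cs \<theta> by (subst H2.cinner_comb_comb) blast+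
  finally have eq: "form dilation_kernel cs cs = \<dots>" .
  have cl: "comb H\<^sub>2 \<theta> cs \<in> carrier H\<^sub>2" using cs \<theta> by (intro H2.comb_closed) blast
  have "snd ` set (map (map_prod id z) cs) \<subseteq> carrier E \<times> carrier H\<^sub>1"
    using cs z by (auto simp: image_subset_iff)
  from completely_semi_psd[OF hmodule hilbert hilbert2 \<phi>_linear semi this]
  show ?thesis unfolding eq m_def using H2.ip_self[OF cl] H2.cinner_nonneg[OF cl] by simp
qed

lemma dilation_kernel_space:
  "\<exists>(K :: ('e \<times> 'h + 'k \<Rightarrow> complex) inner_space) \<mu>. hilbert_space K \<and> spanning K Y \<mu> \<and>
    (\<forall>p\<in>Y. \<forall>q\<in>Y. cinner K (\<mu> p) (\<mu> q) = dilation_kernel p q)"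
proof (rule Moore_Aronszajn)
  show "Y \<noteq> {}" using H2.M.zero_closed by blast
qed (rule dilation_kernel_psd)

end

context semi_map
begin

lemma embedding_V:
  fixes K :: "('a \<times> 'h \<Rightarrow> complex) inner_space"
  assumes K: "hilbert_space K" and span: "spanning K X \<kappa>"
    and inner: "\<And>p q. \<lbrakk>p \<in> X; q \<in> X\<rbrakk> \<Longrightarrow> cinner K (\<kappa> p) (\<kappa> q) = cp_kernel p q"
  shows "(\<lambda>h\<in>carrier H\<^sub>1. \<kappa> (\<one>\<^bsub>A\<^esub>, h)) \<in> bounded_ops H\<^sub>1 K"
proof -
  interpret K: hilbert_space K by fact
  note \<kappa> = spanning_closed[OF span]
  obtain c where c: "0 \<le> c" "\<And>h. h \<in> carrier H\<^sub>1 \<Longrightarrow> hnorm H\<^sub>1 (\<phi> \<one>\<^bsub>A\<^esub> h) \<le> c * hnorm H\<^sub>1 h"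
    using bounded_ops_bound[OF hilbert \<phi>_op[OF R.one_closed]] by blast
  show ?thesis
  proof (rule restrict_bounded_opsI[where C = "sqrt c"])
    fix g h assume gh: "g \<in> carrier H\<^sub>1" "h \<in> carrier H\<^sub>1"
    show "\<kappa> (\<one>\<^bsub>A\<^esub>, g \<oplus>\<^bsub>H\<^sub>1\<^esub> h) = \<kappa> (\<one>\<^bsub>A\<^esub>, g) \<oplus>\<^bsub>K\<^esub> \<kappa> (\<one>\<^bsub>A\<^esub>, h)"
    proof (rule spanning_eqI[OF K span])
      fix p assume "p \<in> X"
      then show "cinner K (\<kappa> p) (\<kappa> (\<one>\<^bsub>A\<^esub>, g \<oplus>\<^bsub>H\<^sub>1\<^esub> h)) = cinner K (\<kappa> p) (\<kappa> (\<one>\<^bsub>A\<^esub>, g) \<oplus>\<^bsub>K\<^esub> \<kappa> (\<one>\<^bsub>A\<^esub>, h))"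
        using gh \<kappa> by (cases p) (simp add: K.cinner_add inner bounded_ops_add[OF \<phi>_op] H.cinner_add)
    qed (use gh \<kappa> in auto)
  next
    fix c h assume h: "h \<in> carrier H\<^sub>1"
    show "\<kappa> (\<one>\<^bsub>A\<^esub>, c \<odot>\<^bsub>H\<^sub>1\<^esub> h) = c \<odot>\<^bsub>K\<^esub> \<kappa> (\<one>\<^bsub>A\<^esub>, h)"
    proof (rule spanning_eqI[OF K span])
      fix p assume "p \<in> X"
      then show "cinner K (\<kappa> p) (\<kappa> (\<one>\<^bsub>A\<^esub>, c \<odot>\<^bsub>H\<^sub>1\<^esub> h)) = cinner K (\<kappa> p) (c \<odot>\<^bsub>K\<^esub> \<kappa> (\<one>\<^bsub>A\<^esub>, h))"
        using h \<kappa> by (cases p) (simp add: K.cinner_smult inner bounded_ops_smult[OF \<phi>_op] H.cinner_smult)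
    qed (use h \<kappa> in auto)
  next
    fix h assume h: "h \<in> carrier H\<^sub>1"
    have "(hnorm K (\<kappa> (\<one>\<^bsub>A\<^esub>, h)))\<^sup>2 = Re (cinner H\<^sub>1 h (\<phi> \<one>\<^bsub>A\<^esub> h))"
      using h \<kappa> by (simp add: K.nm_squared inner A.star_one)
    also have "\<dots> \<le> hnorm H\<^sub>1 h * hnorm H\<^sub>1 (\<phi> \<one>\<^bsub>A\<^esub> h)"
      using H.Cauchy_Schwarz[of h "\<phi> \<one>\<^bsub>A\<^esub> h"] complex_Re_le_cmod[of "cinner H\<^sub>1 h (\<phi> \<one>\<^bsub>A\<^esub> h)"] h by simp
    also have "\<dots> \<le> hnorm H\<^sub>1 h * (c * hnorm H\<^sub>1 h)" using c h by (intro mult_left_mono) auto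
    also have "\<dots> = (sqrt c * hnorm H\<^sub>1 h)\<^sup>2" using c(1) by (simp add: power_mult_distrib power2_eq_square)
    finally show "hnorm K (\<kappa> (\<one>\<^bsub>A\<^esub>, h)) \<le> sqrt c * hnorm H\<^sub>1 h"
      by (rule power2_le_imp_le) (use c h in simp)
  qed (use \<kappa> hilbert in auto)
qed

lemma embedding_W:
  fixes K :: "('e \<times> 'h + 'k \<Rightarrow> complex) inner_space"
  assumes K: "hilbert_space K" and span: "spanning K Y \<mu>"
    and inner: "\<And>p q. \<lbrakk>p \<in> Y; q \<in> Y\<rbrakk> \<Longrightarrow> cinner K (\<mu> p) (\<mu> q) = dilation_kernel p q"
  shows "isometry H\<^sub>2 K (\<lambda>w\<in>carrier H\<^sub>2. \<mu> (Inr w))"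
proof -
  interpret K: hilbert_space K by fact
  note \<mu> = spanning_closed[OF span]
  have \<mu>_Inr: "\<mu> (Inr w) \<in> carrier K" if "w \<in> carrier H\<^sub>2" for w using that by (intro \<mu> InrI)
  have iso: "hnorm K (\<mu> (Inr w)) = hnorm H\<^sub>2 w" if "w \<in> carrier H\<^sub>2" for w
    using that by (simp add: hnorm_def inner InrI)
  have "(\<lambda>w\<in>carrier H\<^sub>2. \<mu> (Inr w)) \<in> bounded_ops H\<^sub>2 K"
  proof (rule restrict_bounded_opsI[where C = 1])
    fix v w assume vw: "v \<in> carrier H\<^sub>2" "w \<in> carrier H\<^sub>2"
    show "\<mu> (Inr (v \<oplus>\<^bsub>H\<^sub>2\<^esub> w)) = \<mu> (Inr v) \<oplus>\<^bsub>K\<^esub> \<mu> (Inr w)"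
    proof (rule spanning_eqI[OF K span])
      fix p assume p: "p \<in> Y"
      have "dilation_kernel p (Inr (v \<oplus>\<^bsub>H\<^sub>2\<^esub> w)) = dilation_kernel p (Inr v) + dilation_kernel p (Inr w)"
        using p vw by (auto simp: H2.cinner_add)
      then show "cinner K (\<mu> p) (\<mu> (Inr (v \<oplus>\<^bsub>H\<^sub>2\<^esub> w))) = cinner K (\<mu> p) (\<mu> (Inr v) \<oplus>\<^bsub>K\<^esub> \<mu> (Inr w))"
        using p vw \<mu> \<mu>_Inr by (simp add: K.cinner_add inner InrI)
    qed (use vw \<mu>_Inr in auto)
  next
    fix c w assume w: "w \<in> carrier H\<^sub>2"
    show "\<mu> (Inr (c \<odot>\<^bsub>H\<^sub>2\<^esub> w)) = c \<odot>\<^bsub>K\<^esub> \<mu> (Inr w)"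
    proof (rule spanning_eqI[OF K span])
      fix p assume p: "p \<in> Y"
      have "dilation_kernel p (Inr (c \<odot>\<^bsub>H\<^sub>2\<^esub> w)) = c * dilation_kernel p (Inr w)"
        using p w by (auto simp: H2.cinner_smult)
      then show "cinner K (\<mu> p) (\<mu> (Inr (c \<odot>\<^bsub>H\<^sub>2\<^esub> w))) = cinner K (\<mu> p) (c \<odot>\<^bsub>K\<^esub> \<mu> (Inr w))"
        using p w \<mu> \<mu>_Inr by (simp add: K.cinner_smult inner InrI)
    qed (use w \<mu>_Inr in auto)
  qed (use \<mu>_Inr iso hilbert2 in auto)
  then show ?thesis using iso by (simp add: isometry_def)
qed

text \<open>
  The map \<open>a \<otimes> h \<mapsto> x a \<otimes> h\<close> on elementary tensors.
\<close>
definition tens :: "'e \<Rightarrow> 'a \<times> 'h \<Rightarrow> 'e \<times> 'h + 'k" where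
  "tens x = (\<lambda>(a, h). Inl (ract E x a, h))"

lemma tens_closed: "\<lbrakk>x \<in> carrier E; p \<in> X\<rbrakk> \<Longrightarrow> tens x p \<in> Y"
  by (auto simp: tens_def)

lemma dilation_kernel_tens:
  assumes "x \<in> carrier E" "y \<in> carrier E" "p \<in> X" "q \<in> X"
  shows "dilation_kernel (tens x p) (tens y q) = cp_kernel p (act (ainner E x y) q)"
  using assms by (auto simp: tens_def ainner_ract_left E.ainner_ract R.m_assoc)

lemma dilation_kernel_tens_add:
  assumes "x \<in> carrier E" "y \<in> carrier E" "p \<in> X" "q \<in> Y"
  shows "dilation_kernel q (tens (x \<oplus>\<^bsub>E\<^esub> y) p) = dilation_kernel q (tens x p) + dilation_kernel q (tens y p)"
  using assms by (auto simp: tens_def E.ract_add_left E.ainner_add \<phi>_add \<Phi>_add H.cinner_add H2.cinner_add)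

lemma dilation_kernel_tens_smult:
  assumes "x \<in> carrier E" "p \<in> X" "q \<in> Y"
  shows "dilation_kernel q (tens (c \<odot>\<^bsub>E\<^esub> x) p) = c * dilation_kernel q (tens x p)"
  using assms by (auto simp: tens_def E.ract_smult_left E.ainner_smult \<phi>_smult \<Phi>_smult H.cinner_smult H2.cinner_smult)

text \<open>
  The squared norm of a combination of the vectors \<open>\<mu> (tens x p)\<close> is \<open>\<langle>f, \<rho>(\<langle>x, x\<rangle>) f\<rangle>\<close>, where \<open>f\<close> is the
  same combination of the \<open>\<kappa> p\<close>; hence boundedness of \<open>\<rho>(\<langle>x, x\<rangle>)\<close> suffices.
\<close>
lemma tens_operator:
  fixes K :: "('a \<times> 'h \<Rightarrow> complex) inner_space" and L :: "('e \<times> 'h + 'k \<Rightarrow> complex) inner_space"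
  assumes K: "hilbert_space K" and span: "spanning K X \<kappa>"
    and inner: "\<And>p q. \<lbrakk>p \<in> X; q \<in> X\<rbrakk> \<Longrightarrow> cinner K (\<kappa> p) (\<kappa> q) = cp_kernel p q"
    and \<rho>: "\<And>c. c \<in> carrier A \<Longrightarrow> \<rho> c \<in> bounded_ops K K"
    and \<rho>_\<kappa>: "\<And>c p. \<lbrakk>c \<in> carrier A; p \<in> X\<rbrakk> \<Longrightarrow> \<rho> c (\<kappa> p) = \<kappa> (act c p)"
    and L: "hilbert_space L" and span2: "spanning L Y \<mu>"
    and inner2: "\<And>p q. \<lbrakk>p \<in> Y; q \<in> Y\<rbrakk> \<Longrightarrow> cinner L (\<mu> p) (\<mu> q) = dilation_kernel p q"
    and x: "x \<in> carrier E"
  shows "\<exists>T\<in>bounded_ops K L. \<forall>p\<in>X. T (\<kappa> p) = \<mu> (tens x p)"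
proof -
  interpret K: hilbert_space K by fact
  interpret L: hilbert_space L by fact
  note \<kappa> = spanning_closed[OF span] and \<mu> = spanning_closed[OF span2]
  let ?T = "\<rho> (ainner E x x)"
  have T: "?T \<in> bounded_ops K K" using x by (intro \<rho>) simp
  obtain c where c: "0 \<le> c" "\<And>f. f \<in> carrier K \<Longrightarrow> hnorm K (?T f) \<le> c * hnorm K f"
    using bounded_ops_bound[OF K T] by blast
  show ?thesis
  proof (rule extend_kernel[OF K L span _ c(1)])
    fix cs :: "(complex \<times> 'a \<times> 'h) list" assume cs: "snd ` set cs \<subseteq> X"
    let ?f = "comb K \<kappa> cs"
    have f: "?f \<in> carrier K" using cs \<kappa> by (intro K.comb_closed) blast
    have "form (\<lambda>p q. cinner L (\<mu> (tens x p)) (\<mu> (tens x q))) cs cs = form (\<lambda>p q. cinner K (\<kappa> p) (?T (\<kappa> q))) cs cs"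
    proof (rule form_cong)
      fix p q assume "p \<in> snd ` set cs" "q \<in> snd ` set cs"
      then have pq: "p \<in> X" "q \<in> X" using cs by blast+
      show "cinner L (\<mu> (tens x p)) (\<mu> (tens x q)) = cinner K (\<kappa> p) (?T (\<kappa> q))"
        using inner2[OF tens_closed[OF x pq(1)] tens_closed[OF x pq(2)]] dilation_kernel_tens[OF x x pq]
          \<rho>_\<kappa>[OF E_ainner_closed[OF x x] pq(2)] inner[OF pq(1) act_closed[OF E_ainner_closed[OF x x] pq(2)]]
        by simp
    qed
    also have "\<dots> = cinner K ?f (comb K (\<lambda>q. ?T (\<kappa> q)) cs)"
      using cs \<kappa> bounded_ops_closed[OF T] by (intro K.cinner_comb_comb[symmetric]) blast+
    also have "comb K (\<lambda>q. ?T (\<kappa> q)) cs = ?T ?f"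
      using cs \<kappa> by (intro bounded_op_comb[OF K K T, symmetric]) blast
    finally have eq: "form (\<lambda>p q. cinner L (\<mu> (tens x p)) (\<mu> (tens x q))) cs cs = cinner K ?f (?T ?f)" .
    have "Re (cinner K ?f (?T ?f)) \<le> hnorm K ?f * hnorm K (?T ?f)"
      by (rule order_trans[OF complex_Re_le_cmod K.Cauchy_Schwarz[OF f bounded_ops_closed[OF T f]]])
    also have "\<dots> \<le> hnorm K ?f * (c * hnorm K ?f)" using c f by (intro mult_left_mono) auto
    finally show "Re (form (\<lambda>p q. cinner L (\<mu> (tens x p)) (\<mu> (tens x q))) cs cs) \<le> c * (hnorm K ?f)\<^sup>2"
      unfolding eq by (simp add: power2_eq_square mult.left_commute)
  qed (intro \<mu> tens_closed[OF x])
qed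

theorem dilation:
  "\<exists>(K\<^sub>1 :: ('a \<times> 'h \<Rightarrow> complex) inner_space) (K\<^sub>2 :: (('e \<times> 'h) + 'k \<Rightarrow> complex) inner_space)
      V W \<rho> \<Psi>.
    hilbert_space K\<^sub>1 \<and> hilbert_space K\<^sub>2 \<and>
    V \<in> bounded_ops H\<^sub>1 K\<^sub>1 \<and> isometry H\<^sub>2 K\<^sub>2 W \<and>
    star_hom A (op_algebra K\<^sub>1) \<rho> \<and> rho_representation E K\<^sub>1 K\<^sub>2 \<rho> \<Psi> \<and>
    (\<forall>a\<in>carrier A. \<phi> a =
      compose (carrier H\<^sub>1) (adj H\<^sub>1 K\<^sub>1 V) (compose (carrier H\<^sub>1) (\<rho> a) V)) \<and>
    (\<forall>x\<in>carrier E. \<Phi> x =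
      compose (carrier H\<^sub>1) (adj H\<^sub>2 K\<^sub>2 W) (compose (carrier H\<^sub>1) (\<Psi> x) V)) \<and>
    (\<phi> \<one>\<^bsub>A\<^esub> = \<one>\<^bsub>op_algebra H\<^sub>1\<^esub> \<longrightarrow> isometry H\<^sub>1 K\<^sub>1 V)"
proof -
  obtain K :: "('a \<times> 'h \<Rightarrow> complex) inner_space" and \<kappa> \<rho>
    where K: "hilbert_space K" and span: "spanning K X \<kappa>"
      and inner: "\<And>p q. \<lbrakk>p \<in> X; q \<in> X\<rbrakk> \<Longrightarrow> cinner K (\<kappa> p) (\<kappa> q) = cp_kernel p q"
      and hom: "star_hom A (op_algebra K) \<rho>"
      and \<rho>_\<kappa>: "\<And>c p. \<lbrakk>c \<in> carrier A; p \<in> X\<rbrakk> \<Longrightarrow> \<rho> c (\<kappa> p) = \<kappa> (act c p)"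
    using Stinespring by blast
  obtain L :: "('e \<times> 'h + 'k \<Rightarrow> complex) inner_space" and \<mu>
    where L: "hilbert_space L" and span2: "spanning L Y \<mu>"
      and inner2: "\<And>p q. \<lbrakk>p \<in> Y; q \<in> Y\<rbrakk> \<Longrightarrow> cinner L (\<mu> p) (\<mu> q) = dilation_kernel p q"
    using dilation_kernel_space by blast
  interpret K: hilbert_space K by (rule K)
  interpret L: hilbert_space L by (rule L)
  note \<kappa> = spanning_closed[OF span] and \<mu> = spanning_closed[OF span2]
  have \<rho>: "\<rho> c \<in> bounded_ops K K" if "c \<in> carrier A" for c
    using hom that by (auto simp: star_hom_def linear_maps_iff)
  define V where "V = (\<lambda>h\<in>carrier H\<^sub>1. \<kappa> (\<one>\<^bsub>A\<^esub>, h))"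
  define W where "W = (\<lambda>w\<in>carrier H\<^sub>2. \<mu> (Inr w))"
  have V: "V \<in> bounded_ops H\<^sub>1 K" unfolding V_def by (rule embedding_V[OF K span inner])
  have W: "isometry H\<^sub>2 L W" unfolding W_def by (rule embedding_W[OF L span2 inner2])
  have W': "W \<in> bounded_ops H\<^sub>2 L" using W by (simp add: isometry_def)
  have V_eq: "V h = \<kappa> (\<one>\<^bsub>A\<^esub>, h)" if "h \<in> carrier H\<^sub>1" for h using that by (simp add: V_def)
  have W_eq: "W w = \<mu> (Inr w)" if "w \<in> carrier H\<^sub>2" for w using that by (simp add: W_def)
  have one: "(\<one>\<^bsub>A\<^esub>, h) \<in> X" if "h \<in> carrier H\<^sub>1" for h using that by simp
  have "\<exists>T. \<forall>x\<in>carrier E. T x \<in> bounded_ops K L \<and> (\<forall>p\<in>X. T x (\<kappa> p) = \<mu> (tens x p))"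
    using tens_operator[OF K span inner \<rho> \<rho>_\<kappa> L span2 inner2] by (intro bchoice) blast
  then obtain \<Psi> where \<Psi>: "\<And>x. x \<in> carrier E \<Longrightarrow> \<Psi> x \<in> bounded_ops K L"
    and \<Psi>_\<kappa>: "\<And>x p. \<lbrakk>x \<in> carrier E; p \<in> X\<rbrakk> \<Longrightarrow> \<Psi> x (\<kappa> p) = \<mu> (tens x p)"
    by blast
  have entry: "cinner L (\<mu> q) (\<Psi> x (\<kappa> p)) = dilation_kernel q (tens x p)" if "x \<in> carrier E" "p \<in> X" "q \<in> Y" for x p q
    using inner2[OF that(3) tens_closed[OF that(1,2)]] \<Psi>_\<kappa>[OF that(1,2)] by simp
  have "rho_representation E K L \<rho> \<Psi>"
    unfolding rho_representation_def linear_maps_iff op_module_simps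
  proof (intro conjI ballI allI)
    show "\<Psi> \<in> carrier E \<rightarrow> bounded_ops K L" using \<Psi> by blast
  next
    fix x y assume xy: "x \<in> carrier E" "y \<in> carrier E"
    show "\<Psi> (x \<oplus>\<^bsub>E\<^esub> y) = (\<lambda>f\<in>carrier K. \<Psi> x f \<oplus>\<^bsub>L\<^esub> \<Psi> y f)"
    proof (rule spanning_weak_eqI[OF K L span span2 \<Psi> add_bounded_ops[OF K L \<Psi> \<Psi>]])
      fix p q assume p: "p \<in> X" and q: "q \<in> Y"
      show "cinner L (\<mu> q) (\<Psi> (x \<oplus>\<^bsub>E\<^esub> y) (\<kappa> p)) = cinner L (\<mu> q) ((\<lambda>f\<in>carrier K. \<Psi> x f \<oplus>\<^bsub>L\<^esub> \<Psi> y f) (\<kappa> p))"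
        using dilation_kernel_tens_add[OF xy p q] entry[OF xy(1) p q] entry[OF xy(2) p q] entry[OF EV.M.a_closed[OF xy] p q]
          \<kappa>[OF p] \<mu>[OF q] bounded_ops_closed[OF \<Psi>[OF xy(1)] \<kappa>[OF p]] bounded_ops_closed[OF \<Psi>[OF xy(2)] \<kappa>[OF p]]
        by (simp add: L.cinner_add)
    qed (use xy in auto)
    show "compose (carrier K) (adj K L (\<Psi> x)) (\<Psi> y) = \<rho> (ainner E x y)"
    proof (rule spanning_weak_eqI[OF K K span span compose_bounded_ops[OF K L K \<Psi> adj_bounded[OF K L \<Psi>]] \<rho>])
      fix p q assume p: "p \<in> X" and q: "q \<in> X"
      show "cinner K (\<kappa> q) (compose (carrier K) (adj K L (\<Psi> x)) (\<Psi> y) (\<kappa> p)) = cinner K (\<kappa> q) (\<rho> (ainner E x y) (\<kappa> p))"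
        using cinner_adj[OF K L \<Psi>[OF xy(1)] \<kappa>[OF q] bounded_ops_closed[OF \<Psi>[OF xy(2)] \<kappa>[OF p]]]
          \<Psi>_\<kappa>[OF xy(1) q] entry[OF xy(2) p tens_closed[OF xy(1) q]] dilation_kernel_tens[OF xy q p]
          \<rho>_\<kappa>[OF E_ainner_closed[OF xy] p] inner[OF q act_closed[OF E_ainner_closed[OF xy] p]] \<kappa>[OF p]
        by (simp add: compose_eq)
    qed (use xy in auto)
  next
    fix c x assume x: "x \<in> carrier E"
    show "\<Psi> (c \<odot>\<^bsub>E\<^esub> x) = (\<lambda>f\<in>carrier K. c \<odot>\<^bsub>L\<^esub> \<Psi> x f)"
    proof (rule spanning_weak_eqI[OF K L span span2 \<Psi> smult_bounded_ops[OF K L \<Psi>]])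
      fix p q assume p: "p \<in> X" and q: "q \<in> Y"
      show "cinner L (\<mu> q) (\<Psi> (c \<odot>\<^bsub>E\<^esub> x) (\<kappa> p)) = cinner L (\<mu> q) ((\<lambda>f\<in>carrier K. c \<odot>\<^bsub>L\<^esub> \<Psi> x f) (\<kappa> p))"
        using dilation_kernel_tens_smult[OF x p q] entry[OF x p q] entry[OF E_smult_closed[OF x] p q]
          \<kappa>[OF p] \<mu>[OF q] bounded_ops_closed[OF \<Psi>[OF x] \<kappa>[OF p]]
        by (simp add: L.cinner_smult)
    qed (use x in auto)
  qed
  moreover have "\<phi> a = compose (carrier H\<^sub>1) (adj H\<^sub>1 K V) (compose (carrier H\<^sub>1) (\<rho> a) V)" if a: "a \<in> carrier A" for a
  proof (rule bounded_ops_eqI[OF \<phi>_op[OF a]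
        compose_bounded_ops[OF hilbert K hilbert compose_bounded_ops[OF hilbert K K V \<rho>[OF a]] adj_bounded[OF hilbert K V]]])
    fix h assume h: "h \<in> carrier H\<^sub>1"
    have r: "\<rho> a (V h) \<in> carrier K" by (intro bounded_ops_closed[OF \<rho>[OF a]] bounded_ops_closed[OF V] h)
    have "\<phi> a h = adj H\<^sub>1 K V (\<rho> a (V h))"
    proof (rule H.cinner_eqI)
      fix g assume g: "g \<in> carrier H\<^sub>1"
      have "cinner H\<^sub>1 g (adj H\<^sub>1 K V (\<rho> a (V h))) = cinner K (\<kappa> (\<one>\<^bsub>A\<^esub>, g)) (\<kappa> (act a (\<one>\<^bsub>A\<^esub>, h)))"
        using cinner_adj[OF hilbert K V g r] V_eq[OF g] V_eq[OF h] \<rho>_\<kappa>[OF a one[OF h]] by simp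
      also have "\<dots> = cinner H\<^sub>1 g (\<phi> a h)"
        using inner[OF one[OF g] act_closed[OF a one[OF h]]] a by (simp add: A.star_one)
      finally show "cinner H\<^sub>1 g (\<phi> a h) = cinner H\<^sub>1 g (adj H\<^sub>1 K V (\<rho> a (V h)))" by simp
    qed (use a h bounded_ops_closed[OF adj_bounded[OF hilbert K V] r] in auto)
    then show "\<phi> a h = compose (carrier H\<^sub>1) (adj H\<^sub>1 K V) (compose (carrier H\<^sub>1) (\<rho> a) V) h"
      using h by (simp add: compose_eq)
  qed
  moreover have "\<Phi> x = compose (carrier H\<^sub>1) (adj H\<^sub>2 L W) (compose (carrier H\<^sub>1) (\<Psi> x) V)" if x: "x \<in> carrier E" for x
  proof (rule bounded_ops_eqI[OF \<Phi>_op[OF x]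
        compose_bounded_ops[OF hilbert L hilbert2 compose_bounded_ops[OF hilbert K L V \<Psi>[OF x]] adj_bounded[OF hilbert2 L W']]])
    fix h assume h: "h \<in> carrier H\<^sub>1"
    have r: "\<Psi> x (V h) \<in> carrier L" by (intro bounded_ops_closed[OF \<Psi>[OF x]] bounded_ops_closed[OF V] h)
    have "\<Phi> x h = adj H\<^sub>2 L W (\<Psi> x (V h))"
    proof (rule H2.cinner_eqI)
      fix w assume w: "w \<in> carrier H\<^sub>2"
      have "cinner H\<^sub>2 w (adj H\<^sub>2 L W (\<Psi> x (V h))) = cinner L (\<mu> (Inr w)) (\<Psi> x (\<kappa> (\<one>\<^bsub>A\<^esub>, h)))"
        using cinner_adj[OF hilbert2 L W' w r] V_eq[OF h] W_eq[OF w] by simp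
      also have "\<dots> = cinner H\<^sub>2 w (\<Phi> x h)"
        using entry[OF x one[OF h] InrI[OF w]] x by (simp add: tens_def E.ract_one)
      finally show "cinner H\<^sub>2 w (\<Phi> x h) = cinner H\<^sub>2 w (adj H\<^sub>2 L W (\<Psi> x (V h)))" by simp
    qed (use x h bounded_ops_closed[OF adj_bounded[OF hilbert2 L W'] r] in auto)
    then show "\<Phi> x h = compose (carrier H\<^sub>1) (adj H\<^sub>2 L W) (compose (carrier H\<^sub>1) (\<Psi> x) V) h"
      using h by (simp add: compose_eq)
  qed
  moreover have "isometry H\<^sub>1 K V" if "\<phi> \<one>\<^bsub>A\<^esub> = \<one>\<^bsub>op_algebra H\<^sub>1\<^esub>"
    using V that inner[OF one one] by (simp add: isometry_def hnorm_def V_eq A.star_one)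
  ultimately show ?thesis using K L V W hom by blast
qed

end

theorem theorem3p4:
  fixes A :: "'a normed_star_algebra" and E :: "('a, 'e) inner_module"
    and H\<^sub>1 :: "'h inner_space" and H\<^sub>2 :: "'k inner_space"
    and \<phi> :: "'a \<Rightarrow> 'h \<Rightarrow> 'h" and \<Phi> :: "'e \<Rightarrow> 'h \<Rightarrow> 'k"
  assumes "unital_cstar_algebra A"
    and "hilbert_module A E"
    and "hilbert_space H\<^sub>1" and "hilbert_space H\<^sub>2"
    and "completely_positive A (op_algebra H\<^sub>1) \<phi>"
    and "completely_semi A E H\<^sub>1 H\<^sub>2 \<phi> \<Phi>"
  shows "\<exists>(K\<^sub>1 :: ('a \<times> 'h \<Rightarrow> complex) inner_space) (K\<^sub>2 :: (('e \<times> 'h) + 'k \<Rightarrow> complex) inner_space)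
      V W \<rho> \<Psi>.
    hilbert_space K\<^sub>1 \<and> hilbert_space K\<^sub>2 \<and>
    V \<in> bounded_ops H\<^sub>1 K\<^sub>1 \<and> isometry H\<^sub>2 K\<^sub>2 W \<and>
    star_hom A (op_algebra K\<^sub>1) \<rho> \<and> rho_representation E K\<^sub>1 K\<^sub>2 \<rho> \<Psi> \<and>
    (\<forall>a\<in>carrier A. \<phi> a =
      compose (carrier H\<^sub>1) (adj H\<^sub>1 K\<^sub>1 V) (compose (carrier H\<^sub>1) (\<rho> a) V)) \<and>
    (\<forall>x\<in>carrier E. \<Phi> x =
      compose (carrier H\<^sub>1) (adj H\<^sub>2 K\<^sub>2 W) (compose (carrier H\<^sub>1) (\<Psi> x) V)) \<and>
    (\<phi> \<one>\<^bsub>A\<^esub> = \<one>\<^bsub>op_algebra H\<^sub>1\<^esub> \<longrightarrow> isometry H\<^sub>1 K\<^sub>1 V)"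
  by (rule semi_map.dilation[OF semi_map.intro[OF cp_map.intro semi_map_axioms.intro]]) fact+

end
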